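(* Let $d$ be a positive integer and let $\alpha$ be a real number with $\alpha\ge \frac{d+1}{2}$ if $d\ge 2$, and $\alpha\ge 2$ if $d=1$. Define $$\Lambda_{d,\alpha}(r) = {}_1F_2\left(\frac{d+1}{2};\, \frac{d+\alpha+1}{2},\, \frac{d+\alpha+2}{2};\, -\frac{r^2}{4}\right)\qquad(r\ge 0).$$ Then the following hold. (i) $\Lambda_{d,\alpha}$ is positive definite on $\mathbb{R}^d$ and $$\Lambda_{d,\alpha}(r) = \frac{1}{B(\alpha+1,\,d)}\int_0^\infty \Omega_{\frac{d-2}{2}}(rt)\,(1-t)_+^{\alpha}\, t^{d-1}\,dt\qquad(r\ge 0).$$ (ii) $0<\Lambda_{d,\alpha}(r)\le 1$ for each $r\ge 0$, and as $r\to\infty$, $$\Lambda_{d,\alpha}(r) = \frac{\Gamma(d+\alpha+1)}{\Gamma(\alpha)}\, r^{-d-1}\Big[1+O(r^{-2})\Big] + \frac{\Gamma(d+\alpha+1)}{2^{\frac{d-1}{2}}\Gamma\left(\frac{d+1}{2}\right)}\, r^{-\frac{d+2\alpha+1}{2}}\left[\cos\left(r-\frac{(d+2\alpha+1)\pi}{4}\right)+O(r^{-1})\right].$$ Moreover, $\Lambda_{d,\alpha}(r)\approx (1+r)^{-d-1}$ for $r\ge 0$. (iii) $\Lambda_{d,\alpha}\in C([0,\infty))\cap L^1\left([0,\infty),\,r^{d-1}dr\right)$ and $$(1-t)_+^{\alpha} = \frac{2\,\Gamma(\alpha+1)\,\Gamma\left(\frac{d+1}{2}\right)}{\sqrt{\pi}\,\Gamma(\alpha+d+1)\,\Gamma\left(\frac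 d2\right)}\int_0^\infty \Omega_{\frac{d-2}{2}}(rt)\,\Lambda_{d,\alpha}(r)\, r^{d-1}\,dr\qquad(t\ge 0).$$ As a consequence, the function $t\mapsto (1-t)_+^\alpha$ is positive definite on $\mathbb{R}^d$.
   Context: Notation. For $\lambda>-1$, $\Omega_\lambda:\mathbb{R}\to\mathbb{R}$ is $$\Omega_\lambda(t)=\Gamma(\lambda+1)\sum_{k=0}^\infty \frac{(-1)^k}{k!\,\Gamma(\lambda+k+1)}\left(\frac t2\right)^{2k}=\Gamma(\lambda+1)(t/2)^{-\lambda}J_\lambda(t),$$ where $J_\lambda$ is the Bessel function of the first kind. The generalized hypergeometric function is ${}_pF_q(a_1,\dots,a_p;b_1,\dots,b_q;r)=\sum_{k\ge0}\frac{(a_1)_k\cdots(a_p)_k}{k!\,(b_1)_k\cdots(b_q)_k}r^k$, with $(a)_0=1$ and $(a)_k=a(a+1)\cdots(a+k-1)$ for $k\ge1$. $B(a,b)=\int_0^1 t^{a-1}(1-t)^{b-1}dt$ is the Euler beta function, and $x_+=\max(x,0)$. For real functions $f,g$ on a set $X$, $f(x)\approx g(x)$ for $x\in X$ means there are positive constants $c_1,c_2$ with $c_1g(x)\le f(x)\le c_2 g(x)$ for all $x\in X$. A function $\Phi$ on $\mathbb{R}^d$ is positive definite if $\sum_{j,k=1}^N\Phi(\mathbf{x}_j-\mathbf{x}_k)z_j\overline{z_k}\ge0$ for every $N$, all (pairwise distinct) $\mathbf{x}_1,\dots,\mathbf{x}_N\in\mathbb{R}^d$ and all $z_1,\dots,z_N\in\mathbb{C}$,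 with equality only when $z_1=\cdots=z_N=0$. A function $\phi$ on $[0,\infty)$ is positive definite on $\mathbb{R}^d$ if its radial extension $\mathbf{x}\mapsto\phi(|\mathbf{x}|)$, $\mathbf{x}\in\mathbb{R}^d$, is positive definite, where $|\cdot|$ is the Euclidean norm. *)

theory Defs
  imports "HOL-Analysis.Analysis" "HOL-Library.Landau_Symbols"
begin

text \<open>
  Generalized hypergeometric function, as the evaluation of the library's formal
  power series; \<open>hypergeometric_eq_suminf\<close> below is the usual formula.
\<close>
definition hypergeometric :: "real list \<Rightarrow> real list \<Rightarrow> real \<Rightarrow> real" where
  "hypergeometric as bs r = eval_fps (fps_hypergeo as bs 1) r"

lemma foldl_times_eq_prod_list:
  fixes f :: "'a \<Rightarrow> real"
  shows "foldl (\<lambda>r a. r * f a) c xs = c * prod_list (map f xs)"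
  by (induction xs arbitrary: c) auto

lemma hypergeometric_eq_suminf:
  "hypergeometric as bs r =
     (\<Sum>k. prod_list (map (\<lambda>a. pochhammer a k) as) /
           (fact k * prod_list (map (\<lambda>b. pochhammer b k) bs)) * r ^ k)"
  by (simp add: hypergeometric_def eval_fps_def foldl_times_eq_prod_list mult_ac)

definition \<Omega> :: "real \<Rightarrow> real \<Rightarrow> real" where
  "\<Omega> \<nu> t = Gamma (\<nu> + 1) *
     (\<Sum>k. (- 1) ^ k / (fact k * Gamma (\<nu> + real k + 1)) * (t / 2) ^ (2 * k))"

definition \<Lambda> :: "nat \<Rightarrow> real \<Rightarrow> real \<Rightarrow> real" where
  "\<Lambda> d \<alpha> r = hypergeometric [(real d + 1) / 2]
     [(real d + \<alpha> + 1) / 2, (real d + \<alpha> + 2) / 2] (- (r ^ 2 / 4))"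

definition pos_part :: "real \<Rightarrow> real" where
  "pos_part x = max x 0"

text \<open>
  Positive definiteness in the strict sense: for pairwise distinct points the form
  vanishes only at zero coefficients. The nodes and coefficients indexed by
  \<open>{..<N}\<close> are the restrictions of arbitrary sequences.
\<close>
definition positive_definite :: "(real ^ 'n \<Rightarrow> complex) \<Rightarrow> bool" where
  "positive_definite \<Phi> \<longleftrightarrow>
     (\<forall>N. \<forall>x :: nat \<Rightarrow> real ^ 'n. \<forall>z :: nat \<Rightarrow> complex. inj_on x {..<N} \<longrightarrow>
        (\<Sum>j<N. \<Sum>k<N. \<Phi> (x j - x k) * z j * cnj (z k)) \<in> \<real>\<^sub>\<ge>\<^sub>0 \<and>
        ((\<Sum>j<N. \<Sum>k<N. \<Phi> (x j - x k) * z j * cnj (z k)) = 0 \<longrightarrow> (\<forall>j<N. z j = 0)))"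

text \<open>
  Positive definiteness of a function on \<open>[0,\<infinity>)\<close> on the space \<open>real ^ 'n\<close>;
  only the values of \<open>\<phi>\<close> at nonnegative arguments matter.
\<close>
definition radial_positive_definite :: "'n::finite itself \<Rightarrow> (real \<Rightarrow> real) \<Rightarrow> bool" where
  "radial_positive_definite TYPE('n) \<phi> \<longleftrightarrow>
     positive_definite (\<lambda>x :: real ^ 'n. complex_of_real (\<phi> (norm x)))"

definition comparable_on :: "'a set \<Rightarrow> ('a \<Rightarrow> real) \<Rightarrow> ('a \<Rightarrow> real) \<Rightarrow> bool" where
  "comparable_on X f g \<longleftrightarrow>
     (\<exists>c1 > 0. \<exists>c2 > 0. \<forall>x \<in> X. c1 * g x \<le> f x \<and> f x \<le> c2 * g x)"

end

(*
By Gaussian integrals the moments of the unit ball of R^d, hence the Fourier transforms of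
radial functions, are given by Omega_{(d-2)/2}. Termwise Beta integrals show that Lambda is a
positive multiple of the Fourier transform of (1-|y|)_+^alpha, so its positive definiteness is
that of a Fourier transform of a nonnegative function; the form can vanish only if a
trigonometric polynomial vanishes on a ball.

Positivity: for b = 3a a series in 1F2(a; b/2, (b+1)/2; -x^2/4) of Gauss sums exhibits the
function as a positive combination of integrals of squares of Omega; larger b follow by a Beta
mixture. For the asymptotics, Lambda is a fractional integral of t^d Omega_{d/2}, the latter is
given by Poisson's integral, and both integration paths are rotated into the upper half-plane,
where the integrands decay exponentially.

The expansion makes Lambda integrable, and Gaussian regularisation of the inversion integral
turns the first Fourier formula into the second one; the constants are matched by Legendre's
duplication formula.
*)
theory Submission
  imports Defs "HOL-Complex_Analysis.Complex_Analysis"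
begin

subsection \<open>Termwise integration of power series\<close>

text \<open>The bound on \<alpha> comes from positivity. For a = (d+1)/2 and b = d+\<alpha>+1 it
  says b \<ge> 3a. At b = 3a the sum of nonnegative terms consists of one bare square, which may
  vanish, and of averages of it, which do not but carry a factor a-1. For d = 1, so a = 1, only the
  square is left, it has zeros, and b > 3a is needed.

  Poisson's integral for index \<nu> has the weight (1-u^2)^(\<nu>-1/2). For \<nu> = (d-2)/2 the
  exponent is negative if d = 1 or 2; in effect an integration by parts raises the index to d/2, so
  that the exponent is p = (d-1)/2 \<ge> 0, and lowers \<alpha> to \<beta> = \<alpha>-1 > 0. After
  both rotations each ray carries a positive weight, up to a constant phase, times one complex
  power. Above 0 the first-order correction of that power is imaginary and disappears from the real
  part: hence O(r^-2) in one bracket and O(r^-1) in the other.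

  The volume V of the unit ball is never evaluated: pi^(d/2) enters as V Gamma(d/2+1), and V cancels
  in the inversion.\<close>

lemma has_bochner_integral_power_series:
  fixes c :: "nat \<Rightarrow> real" and h w :: "'a \<Rightarrow> real"
  assumes c: "\<And>z. summable (\<lambda>k. norm (c k * z ^ k))"
    and [measurable]: "h \<in> borel_measurable M" and h: "\<And>t. \<bar>h t\<bar> \<le> 1"
    and w: "integrable M w"
  shows "has_bochner_integral M (\<lambda>t. (\<Sum>k. c k * (z * h t) ^ k) * w t)
           (\<Sum>k. c k * z ^ k * (LINT t|M. h t ^ k * w t))"
proof -
  have [measurable]: "w \<in> borel_measurable M" using w by auto
  let ?f = "\<lambda>k t. c k * z ^ k * (h t ^ k * w t)"
  have b: "\<bar>h t ^ k * w t\<bar> \<le> \<bar>w t\<bar>" for k t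
    using h[of t] by (simp add: abs_mult power_abs power_le_one mult_left_le_one_le)
  have i0: "integrable M (\<lambda>t. h t ^ k * w t)" for k
    by (rule Bochner_Integration.integrable_bound[OF w]) (use b in auto)
  have i: "integrable M (?f k)" for k using i0 by simp
  have fe: "(\<Sum>k. ?f k t) = (\<Sum>k. c k * (z * h t) ^ k) * w t" for t
    using suminf_mult2[OF summable_norm_cancel[OF c[of "z * h t"]], of "w t"]
    by (simp add: power_mult_distrib mult_ac)
  have s1: "AE t in M. summable (\<lambda>k. norm (?f k t))"
  proof (rule AE_I2)
    fix t
    show "summable (\<lambda>k. norm (?f k t))"
      using summable_mult2[OF c[of "z * h t"], of "\<bar>w t\<bar>"]
      by (simp add: power_mult_distrib mult_ac abs_mult)
  qed
  \<comment> \<open>\<open>norm (c k * z ^ k)\<close> times the integral of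
    \<open>\<bar>w\<bar>\<close> majorises the k-th integral because \<open>h\<close> is bounded by
    1. Nothing but integrability is asked of the weight, which may be singular at the ends of an
    interval.\<close>
  have s2: "summable (\<lambda>k. \<integral>t. norm (?f k t) \<partial>M)"
  proof (rule summable_comparison_test')
    show "summable (\<lambda>k. norm (c k * z ^ k) * (\<integral>t. \<bar>w t\<bar> \<partial>M))"
      by (rule summable_mult2[OF c])
    fix k :: nat
    have "(\<integral>t. norm (?f k t) \<partial>M) = norm (c k * z ^ k) * (\<integral>t. \<bar>h t ^ k * w t\<bar> \<partial>M)"
      by (simp add: abs_mult mult.assoc)
    also have "\<dots> \<le> norm (c k * z ^ k) * (\<integral>t. \<bar>w t\<bar> \<partial>M)"
      by (intro mult_left_mono integral_mono integrable_abs i0 w b) auto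
    finally show "norm (\<integral>t. norm (?f k t) \<partial>M) \<le> norm (c k * z ^ k) * (\<integral>t. \<bar>w t\<bar> \<partial>M)"
      by simp
  qed
  show ?thesis
    using integrable_suminf[OF i s1 s2] integral_suminf[OF i s1 s2] fe
    by (simp add: has_bochner_integral_iff)
qed

section \<open>Beta integrals and Beta mixtures\<close>

lemma Gamma_add_nat:
  assumes "p > (0::real)"
  shows "Gamma (p + real n) = Gamma p * pochhammer p n"
proof -
  have "p \<notin> \<int>\<^sub>\<le>\<^sub>0" using assms nonpos_Ints_nonpos by force
  thus ?thesis using pochhammer_Gamma[of p n] by (simp add: field_simps Gamma_eq_zero_iff)
qed

lemma Beta_add_nat:
  assumes "p > 0" "q > (0::real)"
  shows "Beta (p + real n) q = Beta p q * pochhammer p n / pochhammer (p + q) n"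
proof -
  have "p + real n + q = (p + q) + real n" by simp
  thus ?thesis using assms
    by (simp only: Beta_def Gamma_add_nat[of p] Gamma_add_nat[of "p + q"] add_pos_pos) simp
qed

lemma has_bochner_integral_Beta:
  assumes "p > 0" "q > (0::real)"
  shows "has_bochner_integral lborel
           (\<lambda>t. indicator {0..1} t * (t powr (p - 1) * (1 - t) powr (q - 1))) (Beta p q)"
  using integrable_Beta[OF assms] has_integral_Beta_real[OF assms]
    set_borel_integral_eq_integral(2)[OF integrable_Beta[OF assms]]
  by (simp add: has_bochner_integral_iff set_integrable_def set_lebesgue_integral_def integral_unique)

text \<open>The factor \<open>indicator {0..1} t * t\<close> stands for t: cut off in this way it is
  bounded by 1 on the whole line, as termwise integration of power series demands.\<close>

lemma has_bochner_integral_Beta_power: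
  assumes "p > 0" "q > (0::real)"
  shows "has_bochner_integral lborel
           (\<lambda>t. (indicator {0..1} t * t) ^ n * (indicator {0..1} t * (t powr (p - 1) * (1 - t) powr (q - 1))))
           (Beta p q * pochhammer p n / pochhammer (p + q) n)"
proof -
  have "has_bochner_integral lborel
           (\<lambda>t. indicator {0..1} t * (t powr (p + real n - 1) * (1 - t) powr (q - 1)))
           (Beta p q * pochhammer p n / pochhammer (p + q) n)"
    using has_bochner_integral_Beta[of "p + real n" q] assms by (simp add: Beta_add_nat)
  also have "?this \<longleftrightarrow> ?thesis"
  proof (rule has_bochner_integral_cong_AE)
    show "AE t in lborel. indicator {0..1} t * (t powr (p + real n - 1) * (1 - t) powr (q - 1)) =
      (indicator {0..1} t * t) ^ n * (indicator {0..1} t * (t powr (p - 1) * (1 - t) powr (q - 1)))"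
      using AE_lborel_singleton[of "0::real"]
    proof eventually_elim
      case (elim t)
      have "t powr (p + real n - 1) = t ^ n * t powr (p - 1)" if "t > 0"
        using that by (simp add: powr_add[symmetric] powr_realpow[symmetric] algebra_simps)
      thus ?case using elim by (auto simp: indicator_def)
    qed
  qed measurable
  finally show ?thesis .
qed

text \<open>Averaging t over the Beta law with parameters p and q multiplies the coefficient of (r
  t)^(2k) by (p)_{2k} / (p+q)_{2k}. Three formulas for \<Lambda> are instances: its representation
  by \<Omega> against (1-t)^\<alpha>, the increase of the parameter b, and the fractional integral
  behind the asymptotics.\<close>

lemma Beta_mixture:
  fixes c :: "nat \<Rightarrow> real"
  assumes c: "\<And>z. summable (\<lambda>k. norm (c k * z ^ k))" and pq: "p > 0" "q > 0"
    and c': "\<And>k. c' k = c k * pochhammer p (2 * k) / pochhammer (p + q) (2 * k)"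
  shows "has_bochner_integral lborel
     (\<lambda>t. indicator {0..1} t * ((\<Sum>k. c k * ((r * t)\<^sup>2) ^ k) * (t powr (p - 1) * (1 - t) powr (q - 1))))
     (Beta p q * (\<Sum>k. c' k * (r\<^sup>2) ^ k))"
proof -
  let ?h = "\<lambda>t. (indicator {0..1} t * t)\<^sup>2"
  let ?w = "\<lambda>t. indicator {0..1} t * (t powr (p - 1) * (1 - t) powr (q - 1))"
  have pos: "pochhammer (p + q) k > 0" for k using pq by (intro pochhammer_pos) auto
  \<comment> \<open>The ratio of Pochhammer symbols is at most 1, so the new series inherits its
    convergence from the old one.\<close>
  have le: "\<bar>pochhammer p k / pochhammer (p + q) k\<bar> \<le> 1" for k
  proof -
    have "pochhammer p k \<le> pochhammer (p + q) k"
      using pq unfolding pochhammer_prod by (intro prod_mono) auto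
    thus ?thesis using pos[of k] pochhammer_pos[OF pq(1), of k] by simp
  qed
  have h1: "\<bar>?h t\<bar> \<le> 1" for t::real by (auto simp: indicator_def abs_square_le_1)
  have "summable (\<lambda>k. norm (c' k * (r\<^sup>2) ^ k))"
  proof (rule summable_comparison_test'[OF c[of "r\<^sup>2"]])
    fix k
    show "norm (norm (c' k * (r\<^sup>2) ^ k)) \<le> norm (c k * (r\<^sup>2) ^ k)"
      using mult_left_mono[OF le[of "2*k"], of "norm (c k * (r\<^sup>2) ^ k)"]
      by (simp add: c' abs_mult mult_ac)
  qed
  hence sm: "summable (\<lambda>k. c' k * (r\<^sup>2) ^ k)" by (rule summable_norm_cancel)
  have w: "integrable lborel ?w"
    using has_bochner_integral_Beta[OF pq] by (auto simp: has_bochner_integral_iff)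
  have "has_bochner_integral lborel (\<lambda>t. (\<Sum>k. c k * (r\<^sup>2 * ?h t) ^ k) * ?w t)
           (\<Sum>k. c k * (r\<^sup>2) ^ k * (LINT t|lborel. ?h t ^ k * ?w t))"
    by (rule has_bochner_integral_power_series[OF c _ h1 w]) measurable
  also have "(\<lambda>t. (\<Sum>k. c k * (r\<^sup>2 * ?h t) ^ k) * ?w t) =
    (\<lambda>t. indicator {0..1} t * ((\<Sum>k. c k * ((r * t)\<^sup>2) ^ k) * (t powr (p - 1) * (1 - t) powr (q - 1))))"
    by (auto simp: fun_eq_iff indicator_def power_mult_distrib)
  finally have "has_bochner_integral lborel
    (\<lambda>t. indicator {0..1} t * ((\<Sum>k. c k * ((r * t)\<^sup>2) ^ k) * (t powr (p - 1) * (1 - t) powr (q - 1))))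
    (\<Sum>k. c k * (r\<^sup>2) ^ k * (LINT t|lborel. ?h t ^ k * ?w t))" .
  moreover have "(\<lambda>k. LINT t|lborel. ?h t ^ k * ?w t) =
      (\<lambda>k. Beta p q * pochhammer p (2*k) / pochhammer (p + q) (2*k))"
    using has_bochner_integral_Beta_power[OF pq, of "2*k" for k]
    by (simp add: has_bochner_integral_iff power_mult)
  hence "(\<Sum>k. c k * (r\<^sup>2) ^ k * (LINT t|lborel. ?h t ^ k * ?w t)) =
      (\<Sum>k. Beta p q * (c' k * (r\<^sup>2) ^ k))"
    by (simp add: c' mult_ac fun_eq_iff)
  also have "\<dots> = Beta p q * (\<Sum>k. c' k * (r\<^sup>2) ^ k)"
    by (rule suminf_mult[OF sm])
  ultimately show ?thesis by simp
qed

section \<open>Coefficients of \<Omega> and \<Lambda> as series in the squared argument\<close>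

definition \<Omega>_coeff :: "real \<Rightarrow> nat \<Rightarrow> real" where
  "\<Omega>_coeff \<nu> k = (- 1 / 4) ^ k / (fact k * pochhammer (\<nu> + 1) k)"

text \<open>Coefficient of r^(2k) in 1F2(a; b/2, (b+1)/2; -r^2/4). The power 4^k of the argument
  merges with the two lower symbols by the duplication (b)_{2k} = 4^k (b/2)_k ((b+1)/2)_k, which
  leaves a single parameter b for Beta mixtures to shift.\<close>

definition \<Lambda>_coeff :: "real \<Rightarrow> real \<Rightarrow> nat \<Rightarrow> real" where
  "\<Lambda>_coeff a b k = (- 1) ^ k * pochhammer a k / (fact k * pochhammer b (2 * k))"

text \<open>Only the first factor of the product can be below 1. This matters for \<nu> = -1/2, the
  index that belongs to d = 1.\<close>

lemma pochhammer_ge_min: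
  assumes "x > (0::real)"
  shows "min 1 x \<le> pochhammer x k"
proof (cases k)
  case (Suc n)
  have "1 \<le> pochhammer (x + 1) n"
    unfolding pochhammer_prod using assms by (intro prod_ge_1) auto
  with assms have "x * 1 \<le> pochhammer x k"
    unfolding Suc pochhammer_rec by (intro mult_left_mono) auto
  thus ?thesis by simp
qed simp

lemma summable_bounded_by_exp:
  fixes c :: "nat \<Rightarrow> real"
  assumes "\<And>k. \<bar>c k\<bar> \<le> K / fact k"
  shows "summable (\<lambda>k. norm (c k * z ^ k))"
proof (rule summable_comparison_test')
  show "summable (\<lambda>k. K * (inverse (fact k) * \<bar>z\<bar> ^ k))"
    by (intro summable_mult summable_exp)
  show "norm (norm (c k * z ^ k)) \<le> K * (inverse (fact k) * \<bar>z\<bar> ^ k)" for k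
    using mult_right_mono[OF assms[of k], of "\<bar>z\<bar> ^ k"]
    by (simp add: abs_mult power_abs field_simps)
qed

lemma summable_\<Omega>_coeff:
  assumes "\<nu> > -1"
  shows "summable (\<lambda>k. norm (\<Omega>_coeff \<nu> k * z ^ k))"
proof (rule summable_bounded_by_exp[of _ "1 / min 1 (\<nu> + 1)"])
  fix k
  have m: "0 < min 1 (\<nu> + 1)" "min 1 (\<nu> + 1) \<le> pochhammer (\<nu> + 1) k"
    using assms pochhammer_ge_min[of "\<nu> + 1" k] by auto
  have "\<bar>\<Omega>_coeff \<nu> k\<bar> = (1/4)^k / (fact k * pochhammer (\<nu> + 1) k)"
    using m by (simp add: \<Omega>_coeff_def abs_mult power_abs power_divide)
  also have "\<dots> \<le> 1 / (fact k * min 1 (\<nu> + 1))"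
    using m by (intro frac_le mult_left_mono) (auto simp: power_le_one)
  finally show "\<bar>\<Omega>_coeff \<nu> k\<bar> \<le> 1 / min 1 (\<nu> + 1) / fact k" by (simp add: mult.commute)
qed

lemma \<Omega>_eq_suminf:
  assumes "\<nu> > -1"
  shows "\<Omega> \<nu> t = (\<Sum>k. \<Omega>_coeff \<nu> k * (t\<^sup>2) ^ k)"
proof -
  have G: "Gamma (\<nu> + real k + 1) = Gamma (\<nu> + 1) * pochhammer (\<nu> + 1) k" "Gamma (\<nu> + 1) > 0" for k
    using assms Gamma_add_nat[of "\<nu> + 1" k] Gamma_real_pos[of "\<nu> + 1"] by (simp_all add: add_ac)
  have e: "(- 1) ^ k / (fact k * Gamma (\<nu> + real k + 1)) * (t / 2) ^ (2 * k) =
     \<Omega>_coeff \<nu> k * (t\<^sup>2) ^ k / Gamma (\<nu> + 1)" for k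
  proof -
    have "(t / 2) ^ (2 * k) = (t\<^sup>2) ^ k / 4 ^ k" by (simp add: power_divide power_mult)
    thus ?thesis
      by (simp only:) (simp add: G(1) \<Omega>_coeff_def power_divide power_minus[of "1/4"] mult_ac)
  qed
  show ?thesis
    unfolding \<Omega>_def e using G(2)
    by (simp add: suminf_divide[OF summable_norm_cancel[OF summable_\<Omega>_coeff[OF assms]]])
qed

text \<open>\<open>b \<ge> 2 * a\<close> compares (a)_k with (b/2)_k factor by factor, and
  \<open>b \<ge> 1\<close> makes ((b+1)/2)_k at least 1; the coefficients are then dominated by
  those of exp.\<close>

lemma summable_\<Lambda>_coeff:
  assumes "a > 0" "b \<ge> 2 * a" "b \<ge> 1"
  shows "summable (\<lambda>k. norm (\<Lambda>_coeff a b k * z ^ k))"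
proof (rule summable_bounded_by_exp[of _ 1])
  fix k
  have "pochhammer b (2*k) = 4^k * pochhammer (b/2) k * pochhammer (b/2+1/2) k"
    using pochhammer_double[of "b/2" k] by (simp add: power_mult)
  moreover have "pochhammer a k \<le> pochhammer (b/2) k"
    unfolding pochhammer_prod using assms by (intro prod_mono) auto
  moreover have "1 \<le> pochhammer (b/2+1/2) k"
    unfolding pochhammer_prod using assms by (intro prod_ge_1) auto
  ultimately have "1 * pochhammer a k * 1 \<le> pochhammer b (2*k)"
    using assms by (simp only:) (intro mult_mono, auto intro!: mult_nonneg_nonneg pochhammer_nonneg)
  moreover have "pochhammer b (2*k) > 0" "pochhammer a k > 0" using assms by (auto intro: pochhammer_pos)
  ultimately show "\<bar>\<Lambda>_coeff a b k\<bar> \<le> 1 / fact k"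
    by (simp add: \<Lambda>_coeff_def abs_mult field_simps)
qed

lemma \<Lambda>_eq_suminf:
  "\<Lambda> d \<alpha> r = (\<Sum>k. \<Lambda>_coeff ((real d + 1) / 2) (real d + \<alpha> + 1) k * (r\<^sup>2) ^ k)"
proof -
  have "pochhammer (real d + \<alpha> + 1) (2*k) =
     4^k * pochhammer ((real d + \<alpha> + 1)/2) k * pochhammer ((real d + \<alpha> + 2)/2) k" for k
    using pochhammer_double[of "(real d + \<alpha> + 1)/2" k] by (simp add: power_mult add_divide_distrib add_ac)
  moreover have "(- (r\<^sup>2 / 4)) ^ k = (-1)^k * (r\<^sup>2)^k / 4^k" for k
    by (simp add: power_minus[of "r\<^sup>2/4"] power_divide)
  ultimately show ?thesis
    by (simp add: \<Lambda>_def hypergeometric_eq_suminf \<Lambda>_coeff_def mult_ac del: minus_divide_left)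
qed

text \<open>Vanishing is assumed only to the right of 0 because z will be a square. By strong
  induction the terms below \<open>m\<close> drop out; division by z^m leaves a continuous series
  that vanishes on (0,\<delta>) and has the value \<open>c m\<close> at 0.\<close>

lemma power_series_coeffs_zero:
  fixes c :: "nat \<Rightarrow> real"
  assumes c: "\<And>z. summable (\<lambda>k. norm (c k * z ^ k))" and \<delta>: "\<delta> > 0"
    and z: "\<And>z. 0 < z \<Longrightarrow> z < \<delta> \<Longrightarrow> (\<Sum>k. c k * z ^ k) = 0"
  shows "c k = 0"
proof (induction k rule: less_induct)
  case (less m)
  define g where "g = (\<lambda>z. \<Sum>k. c (k + m) * z ^ k)"
  have sc: "summable (\<lambda>k. c k * z ^ k)" for z by (rule summable_norm_cancel[OF c])
  have sm: "summable (\<lambda>k. c (k + m) * z ^ k)" for z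
  proof (cases "z = 0")
    case False
    have "summable (\<lambda>k. c (k + m) * z ^ (k + m))"
      using sc[of z] by (simp add: summable_iff_shift[of "\<lambda>k. c k * z ^ k"])
    from summable_divide[OF this, of "z ^ m"] show ?thesis
      using False by (simp add: power_add mult_ac)
  qed (simp add: summable_0_powser)
  have "g z = 0" if "0 < z" "z < \<delta>" for z
  proof -
    have "0 = (\<Sum>k. c (k + m) * z ^ (k + m)) + (\<Sum>k<m. c k * z ^ k)"
      using suminf_split_initial_segment[OF sc, of z m] z[OF that] by simp
    also have "(\<Sum>k<m. c k * z ^ k) = 0" using less by simp
    also have "(\<Sum>k. c (k + m) * z ^ (k + m)) = z ^ m * g z"
      unfolding g_def by (subst suminf_mult[OF sm, symmetric]) (simp add: power_add mult_ac)
    finally show ?thesis using that by simp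
  qed
  hence "\<forall>\<^sub>F z in at_right 0. g z = 0"
    using \<delta> unfolding eventually_at_right_field by auto
  hence "(g \<longlongrightarrow> 0) (at_right 0)" by (rule tendsto_eventually)
  moreover have "isCont g 0" unfolding g_def
    by (rule isCont_powser[OF sm[of 1]]) simp
  hence "(g \<longlongrightarrow> g 0) (at_right 0)"
    unfolding isCont_def by (rule filterlim_mono) (auto intro: at_within_le_at)
  ultimately have "g 0 = 0" using tendsto_unique[of "at_right (0::real)"] by force
  thus ?case by (simp add: g_def)
qed

lemma cosh_paired:
  "(\<lambda>k. u ^ (2 * k) / fact (2 * k)) sums cosh (u::real)"
proof -
  have "(\<lambda>k. if even k then u ^ k / fact k else 0) sums cosh u"
    using cosh_converges[of u] by (simp add: field_simps scaleR_conv_of_real cong: if_cong)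
  also have "?this \<longleftrightarrow> ?thesis"
    by (subst sums_mono_reindex[of "\<lambda>k. 2 * k", symmetric]) (auto simp: strict_mono_def elim!: evenE)
  finally show ?thesis .
qed

subsection \<open>Moments of the ball and radial Fourier integrals\<close>

text \<open>The absolute values of the terms sum to w cosh(u), so summability of
  \<open>m k / fact (2 * k)\<close> amounts to integrability of w cosh(u) and supplies the
  domination. It is applied to balls, to Gaussians and to Poisson's weight.\<close>

lemma has_bochner_integral_cos_moments:
  fixes u w :: "'a \<Rightarrow> real"
  assumes [measurable]: "u \<in> borel_measurable M" and w: "\<And>y. w y \<ge> 0"
    and m: "\<And>k. has_bochner_integral M (\<lambda>y. w y * u y ^ (2 * k)) (m k)"
    and s: "summable (\<lambda>k. m k / fact (2 * k))"
  shows "has_bochner_integral M (\<lambda>y. w y * cos (u y)) (\<Sum>k. (- 1) ^ k * m k / fact (2 * k))"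
proof -
  let ?f = "\<lambda>k y. (- 1) ^ k / fact (2 * k) * (w y * u y ^ (2 * k))"
  have cs: "(\<lambda>k. (- 1) ^ k / fact (2 * k) * u y ^ (2 * k)) sums cos (u y)" for y
    using cos_paired[of "u y"] by (simp add: field_simps)
  have i: "integrable M (?f k)" for k using m[of k] by (auto simp: has_bochner_integral_iff)
  have n: "norm (?f k y) = w y * u y ^ (2 * k) / fact (2 * k)" for k y
    using w[of y] by (simp add: abs_mult power_mult)
  have s1: "AE y in M. summable (\<lambda>k. norm (?f k y))"
  proof (rule AE_I2)
    fix y
    have "summable (\<lambda>k. w y * (u y ^ (2 * k) / fact (2 * k)))"
      by (intro summable_mult sums_summable[OF cosh_paired])
    thus "summable (\<lambda>k. norm (?f k y))" unfolding n by simp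
  qed
  have s2: "summable (\<lambda>k. \<integral>y. norm (?f k y) \<partial>M)"
    unfolding n using s m by (simp add: has_bochner_integral_iff)
  have e: "(\<Sum>k. ?f k y) = w y * cos (u y)" for y
    using sums_mult[OF cs[of y], of "w y"] by (simp add: sums_iff mult_ac)
  have e2: "(LINT y|M. ?f k y) = (- 1) ^ k * m k / fact (2 * k)" for k
    using m[of k] by (simp add: has_bochner_integral_iff)
  show ?thesis
    using integrable_suminf[OF i s1 s2] integral_suminf[OF i s1 s2]
    unfolding e e2 by (simp add: has_bochner_integral_iff)
qed

section \<open>Gaussian moments and moments of the ball\<close>

lemma nn_integral_scaleR:
  fixes f :: "'a::euclidean_space \<Rightarrow> ennreal"
  assumes [measurable]: "f \<in> borel_measurable borel" and "c \<noteq> 0"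
  shows "(\<integral>\<^sup>+y. f y \<partial>lborel) = ennreal (\<bar>c\<bar> ^ DIM('a)) * (\<integral>\<^sup>+y. f (c *\<^sub>R y) \<partial>lborel)"
  using assms(2) by (subst lborel_affine[of c 0])
    (simp_all add: nn_integral_density nn_integral_distr nn_integral_cmult)

lemma pred_in_cball [measurable]: "Measurable.pred borel (\<lambda>x. x \<in> cball (a::'a::euclidean_space) r)"
proof -
  have "{x \<in> space borel. x \<in> cball a r} = cball a r" by auto
  thus ?thesis unfolding pred_def by simp
qed

lemma nn_integral_cball_scale:
  fixes x :: "'a::euclidean_space"
  assumes "R > 0"
  shows "(\<integral>\<^sup>+y. ennreal (indicator (cball (0::'a) R) y * (x \<bullet> y) ^ (2 * k)) \<partial>lborel) =
    ennreal (R ^ (DIM('a) + 2 * k)) *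
      (\<integral>\<^sup>+y. ennreal (indicator (cball 0 1) y * (x \<bullet> y) ^ (2 * k)) \<partial>lborel)"
proof -
  have "(\<integral>\<^sup>+y. ennreal (indicator (cball (0::'a) R) y * (x \<bullet> y) ^ (2 * k)) \<partial>lborel) =
    ennreal (R ^ DIM('a)) * (\<integral>\<^sup>+y. ennreal (indicator (cball (0::'a) R) (R *\<^sub>R y) * (x \<bullet> (R *\<^sub>R y)) ^ (2 * k)) \<partial>lborel)"
    by (rule trans[OF nn_integral_scaleR[of _ R]]) (use assms in \<open>measurable, simp_all\<close>)
  also have "(\<lambda>y. ennreal (indicator (cball (0::'a) R) (R *\<^sub>R y) * (x \<bullet> (R *\<^sub>R y)) ^ (2 * k))) =
     (\<lambda>y. ennreal (R ^ (2 * k)) * ennreal (indicator (cball 0 1) y * (x \<bullet> y) ^ (2 * k)))"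
    using assms by (auto simp: fun_eq_iff indicator_def power_mult_distrib ennreal_mult' )
  also have "(\<integral>\<^sup>+y. ennreal (R ^ (2 * k)) * ennreal (indicator (cball 0 1) y * (x \<bullet> y) ^ (2 * k)) \<partial>lborel)
    = ennreal (R ^ (2 * k)) * (\<integral>\<^sup>+y. ennreal (indicator (cball 0 1) y * (x \<bullet> y) ^ (2 * k)) \<partial>lborel)"
    by (rule nn_integral_cmult) measurable
  finally show ?thesis using assms by (simp add: power_add ennreal_mult mult.assoc)
qed

lemma nn_integral_exp_tail:
  "(\<integral>\<^sup>+v. ennreal (exp (- v)) * indicator {b::real..} v \<partial>lborel) = ennreal (exp (- b))"
proof -
    have "(\<integral>\<^sup>+v. ennreal (exp (- v)) * indicator {b..} v \<partial>lborel) = ennreal (0 - (- exp (- b)))"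
    proof (rule nn_integral_FTC_atLeast)
      show "((\<lambda>x::real. - exp (- x)) \<longlongrightarrow> 0) at_top"
        using tendsto_minus[OF filterlim_compose[OF exp_at_bot filterlim_uminus_at_bot_at_top]] by simp
      show "((\<lambda>x. - exp (- x)) has_real_derivative exp (- x)) (at x)" for x :: real
        by (auto intro!: derivative_eq_intros)
    qed auto
    thus ?thesis by simp
qed

text \<open>Layer cake: \<open>exp (- |y|\<^sup>2)\<close> is the integral of \<open>exp (- v)\<close> over \<open>v \<ge> |y|\<^sup>2\<close>.\<close>
lemma nn_integral_Gauss_eq_cball:
  fixes x :: "'a::euclidean_space"
  shows "(\<integral>\<^sup>+y. ennreal (exp (- (norm (y::'a))\<^sup>2) * (x \<bullet> y) ^ (2 * k)) \<partial>lborel) =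
    ennreal (Gamma (DIM('a) / 2 + k + 1)) *
      (\<integral>\<^sup>+y. ennreal (indicator (cball 0 1) y * (x \<bullet> y) ^ (2 * k)) \<partial>lborel)" (is "?L = _ * ?m")
proof -
  have "?L = (\<integral>\<^sup>+y. (\<integral>\<^sup>+v. ennreal (exp (- v)) * indicator {(norm (y::'a))\<^sup>2..} v * ennreal ((x \<bullet> y) ^ (2 * k)) \<partial>lborel) \<partial>lborel)"
    by (intro nn_integral_cong) (simp add: ennreal_mult' nn_integral_exp_tail nn_integral_multc)
  also have "\<dots> = (\<integral>\<^sup>+v. (\<integral>\<^sup>+y. ennreal (exp (- v)) * indicator {(norm (y::'a))\<^sup>2..} v * ennreal ((x \<bullet> y) ^ (2 * k)) \<partial>lborel) \<partial>lborel)"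
  proof (rule lborel_pair.Fubini')
    have i: "indicator {(norm (y::'a))\<^sup>2..} v = (if (norm y)\<^sup>2 \<le> v then 1 else 0 :: ennreal)" for y v
      by (simp add: indicator_def)
    show "(\<lambda>(v, y). ennreal (exp (- v)) * indicator {(norm (y::'a))\<^sup>2..} v * ennreal ((x \<bullet> y) ^ (2 * k)))
      \<in> borel_measurable (lborel \<Otimes>\<^sub>M lborel)"
      unfolding case_prod_unfold i by measurable
  qed
  \<comment> \<open>For fixed v > 0 the inner region is the ball of radius sqrt v, and homogeneity
    of degree d+2k gives v^(d/2+k) times the moment of the unit ball. What remains is a Gamma
    integral.\<close>
  also have "\<dots> = (\<integral>\<^sup>+v. ennreal (indicator {0..} v * v powr (DIM('a) / 2 + k + 1 - 1) / exp v) * ?m \<partial>lborel)"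
  proof (rule nn_integral_cong_AE)
    show "AE v in lborel. (\<integral>\<^sup>+y. ennreal (exp (- v)) * indicator {(norm (y::'a))\<^sup>2..} v * ennreal ((x \<bullet> y) ^ (2 * k)) \<partial>lborel) =
        ennreal (indicator {0..} v * v powr (DIM('a) / 2 + k + 1 - 1) / exp v) * ?m"
      using AE_lborel_singleton[of "0::real"]
    proof eventually_elim
      case (elim v)
      show ?case
      proof (cases "v > 0")
        case False
        hence "indicator {(norm (y::'a))\<^sup>2..} v = (0::ennreal)" for y
        proof -
          have "\<not> (norm y)\<^sup>2 \<le> v" using False elim by (smt (verit) zero_le_power2)
          thus ?thesis by simp
        qed
        thus ?thesis using False elim by simp
      next
        case True
        let ?i = "\<lambda>y. ennreal (indicator (cball (0::'a) (sqrt v)) y * (x \<bullet> y) ^ (2 * k))"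
        have "(norm y)\<^sup>2 \<le> v \<longleftrightarrow> norm y \<le> sqrt v" for y :: 'a
          using True abs_le_square_iff[of "norm y" "sqrt v"] by simp
        hence "(\<integral>\<^sup>+y. ennreal (exp (- v)) * indicator {(norm (y::'a))\<^sup>2..} v * ennreal ((x \<bullet> y) ^ (2 * k)) \<partial>lborel) =
          (\<integral>\<^sup>+y. ennreal (exp (- v)) * ?i y \<partial>lborel)"
          by (intro nn_integral_cong) (simp add: indicator_def)
        also have "\<dots> = ennreal (exp (- v)) * (\<integral>\<^sup>+y. ?i y \<partial>lborel)"
          by (rule nn_integral_cmult) measurable
        also have "(\<integral>\<^sup>+y. ?i y \<partial>lborel) = ennreal (sqrt v ^ (DIM('a) + 2 * k)) * ?m"
          using True by (intro nn_integral_cball_scale) simp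
        also have "sqrt v ^ (DIM('a) + 2 * k) = v powr (DIM('a) / 2 + k)"
        proof -
          have "sqrt v ^ (DIM('a) + 2 * k) = (v powr (1/2)) powr real (DIM('a) + 2 * k)"
            using True by (subst powr_realpow) (simp_all add: powr_half_sqrt)
          also have "\<dots> = v powr (DIM('a) / 2 + k)" by (simp add: powr_powr add_divide_distrib)
          finally show ?thesis .
        qed
        also have "ennreal (exp (- v)) * (ennreal (v powr (DIM('a) / 2 + k)) * ?m) =
            ennreal (exp (- v) * v powr (DIM('a) / 2 + k)) * ?m"
          by (simp only: ennreal_mult'[OF exp_ge_zero] mult.assoc)
        also have "exp (- v) * v powr (DIM('a) / 2 + k) =
            indicator {0..} v * v powr (DIM('a) / 2 + k + 1 - 1) / exp v"
        proof -
          have "indicator {0..} v = (1::real)" using True by simp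
          thus ?thesis
            by (simp only: exp_minus divide_inverse mult_1 add_diff_cancel_right' mult.commute)
        qed
        finally show ?thesis .
      qed
    qed
  qed
  also have "\<dots> = ennreal (Gamma (DIM('a) / 2 + k + 1)) * ?m"
    by (subst nn_integral_multc) (simp_all add: Gamma_conv_nn_integral_real add_nonneg_pos)
  finally show ?thesis .
qed

lemma nn_integral_Gauss_translate:
  fixes v :: "'a::euclidean_space"
  shows "(\<integral>\<^sup>+y. ennreal (exp (- (norm y)\<^sup>2 + 2 * (v \<bullet> y))) \<partial>lborel) =
     ennreal (exp ((norm v)\<^sup>2)) * (\<integral>\<^sup>+y. ennreal (exp (- (norm (y::'a::euclidean_space))\<^sup>2)) \<partial>lborel)"
proof -
  have "(\<integral>\<^sup>+y. ennreal (exp (- (norm y)\<^sup>2 + 2 * (v \<bullet> y))) \<partial>lborel) =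
     (\<integral>\<^sup>+y. ennreal (exp (- (norm y)\<^sup>2 + 2 * (v \<bullet> y))) \<partial>distr lborel borel ((+) v))"
    by (simp only: lborel_distr_plus)
  also have "\<dots> = (\<integral>\<^sup>+y. ennreal (exp ((norm v)\<^sup>2)) * ennreal (exp (- (norm (y::'a))\<^sup>2)) \<partial>lborel)"
    by (subst nn_integral_distr)
       (auto simp: power2_norm_eq_inner algebra_simps inner_commute simp flip: ennreal_mult' exp_add
         intro!: nn_integral_cong)
  finally show ?thesis by (simp add: nn_integral_cmult)
qed

lemma nn_integral_Gauss_cosh:
  fixes x :: "'a::euclidean_space"
  shows "(\<integral>\<^sup>+y. ennreal (exp (- (norm y)\<^sup>2) * cosh (s * (x \<bullet> y))) \<partial>lborel) =
     ennreal (exp (s\<^sup>2 * (norm x)\<^sup>2 / 4)) * (\<integral>\<^sup>+y. ennreal (exp (- (norm (y::'a))\<^sup>2)) \<partial>lborel)"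
proof -
  let ?G = "\<integral>\<^sup>+y. ennreal (exp (- (norm (y::'a))\<^sup>2)) \<partial>lborel"
  let ?e = "\<lambda>s y. exp (- (norm y)\<^sup>2 + 2 * (((s / 2) *\<^sub>R x) \<bullet> y))"
  have 1: "(\<integral>\<^sup>+y. ennreal (?e s y) \<partial>lborel) = ennreal (exp (s\<^sup>2 * (norm x)\<^sup>2 / 4)) * ?G" for s
    by (simp only: nn_integral_Gauss_translate) (simp add: power_mult_distrib power_divide)
  have c: "ennreal (exp (- (norm y)\<^sup>2) * cosh (s * (x \<bullet> y))) = ennreal (1/2) * (ennreal (?e s y) + ennreal (?e (- s) y))" for y
  proof -
    have "exp (- (norm y)\<^sup>2) * cosh (s * (x \<bullet> y)) = 1/2 * (?e s y + ?e (- s) y)"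
      unfolding cosh_def exp_add by (simp add: algebra_simps)
    thus ?thesis
      by (simp only:) (subst ennreal_mult, simp, simp, subst ennreal_plus, simp_all)
  qed
  have "(\<integral>\<^sup>+y. ennreal (exp (- (norm y)\<^sup>2) * cosh (s * (x \<bullet> y))) \<partial>lborel) =
     ennreal (1/2) * ((\<integral>\<^sup>+y. ennreal (?e s y) \<partial>lborel) + (\<integral>\<^sup>+y. ennreal (?e (- s) y) \<partial>lborel))"
    unfolding c by (subst nn_integral_cmult, measurable, subst nn_integral_add, measurable)
  also have "\<dots> = ennreal (1/2) * (2 * (ennreal (exp (s\<^sup>2 * (norm x)\<^sup>2 / 4)) * ?G))"
    unfolding 1 by (simp add: mult_2)
  also have "\<dots> = (ennreal (1/2) * ennreal 2) * (ennreal (exp (s\<^sup>2 * (norm x)\<^sup>2 / 4)) * ?G)"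
    by (simp only: mult.assoc ennreal_numeral[symmetric])
  also have "ennreal (1/2) * ennreal 2 = 1" by (simp only: ennreal_mult''[symmetric]) simp
  finally show ?thesis by simp
qed

lemma emeasure_cball_pos_finite:
  "emeasure lborel (cball (0::'a::euclidean_space) 1) = ennreal (measure lborel (cball (0::'a) 1))"
  "measure lborel (cball (0::'a) 1) > 0"
proof -
  show "emeasure lborel (cball (0::'a::euclidean_space) 1) = ennreal (measure lborel (cball (0::'a) 1))"
    by (rule emeasure_eq_ennreal_measure) (use emeasure_lborel_cball_finite[of "0::'a" 1] in auto)
  show "measure lborel (cball (0::'a) 1) > 0"
    using content_cball_pos[of 1 "0::'a"] by simp
qed

text \<open>Completing the square evaluates the Gaussian integral of \<open>cosh (s (x \<bullet> y))\<close>; comparing powers of \<open>s\<close> gives the moments,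
  so no spherical coordinates are needed.\<close>
lemma nn_integral_Gauss_moment:
  fixes x :: "'a::euclidean_space"
  defines "C \<equiv> measure lborel (cball (0::'a) 1) * Gamma (DIM('a) / 2 + 1)"
  shows "(\<integral>\<^sup>+y. ennreal (exp (- (norm (y::'a))\<^sup>2) * (x \<bullet> y) ^ (2 * k)) \<partial>lborel) =
    ennreal (C * ((norm x)\<^sup>2 / 4) ^ k * fact (2 * k) / fact k)"
proof -
  define G where "G k = (\<integral>\<^sup>+y. ennreal (exp (- (norm (y::'a))\<^sup>2) * (x \<bullet> y) ^ (2 * k)) \<partial>lborel)" for k :: nat
  have Gam: "Gamma (DIM('a) / 2 + 1) > 0" by (intro Gamma_real_pos) auto
  have C: "C > 0" unfolding C_def using Gam emeasure_cball_pos_finite(2)[where 'a='a] by simp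
  have V: "(\<integral>\<^sup>+y. ennreal (indicator (cball (0::'a) 1) y) \<partial>lborel) = ennreal (measure lborel (cball (0::'a) 1))"
    by (simp add: ennreal_indicator nn_integral_indicator emeasure_cball_pos_finite(1))
  \<comment> \<open>\<open>C\<close> is pi^(d/2), obtained as volume times Gamma value from the
    layer cake formula with k = 0.\<close>
  have G0: "G 0 = ennreal C"
    using nn_integral_Gauss_eq_cball[of x 0] Gam by (simp add: G_def V C_def ennreal_mult mult.commute)
  \<comment> \<open>Generating function of the moments: the cosh integral expanded termwise. All
    terms are nonnegative, so no integrability has to be known beforehand.\<close>
  have S: "(\<Sum>k. ennreal (s ^ (2 * k) / fact (2 * k)) * G k) = ennreal (exp (s\<^sup>2 * (norm x)\<^sup>2 / 4) * C)" for s
  proof -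
    have "(\<Sum>k. ennreal (s ^ (2 * k) / fact (2 * k)) * G k) =
       (\<Sum>k. \<integral>\<^sup>+y. ennreal (exp (- (norm (y::'a))\<^sup>2)) * ennreal ((s * (x \<bullet> y)) ^ (2 * k) / fact (2 * k)) \<partial>lborel)"
    proof (intro arg_cong[of _ _ suminf] ext)
      fix k
      have e: "ennreal (s ^ (2 * k) / fact (2 * k)) * ennreal (exp (- (norm y)\<^sup>2) * (x \<bullet> y) ^ (2 * k)) =
        ennreal (exp (- (norm y)\<^sup>2)) * ennreal ((s * (x \<bullet> y)) ^ (2 * k) / fact (2 * k))" for y :: 'a
        by (subst (1 2) ennreal_mult[symmetric]) (simp_all add: power_mult_distrib)
      show "ennreal (s ^ (2 * k) / fact (2 * k)) * G k =
        (\<integral>\<^sup>+y. ennreal (exp (- (norm (y::'a))\<^sup>2)) * ennreal ((s * (x \<bullet> y)) ^ (2 * k) / fact (2 * k)) \<partial>lborel)"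
        unfolding G_def e[symmetric] by (rule nn_integral_cmult[symmetric]) measurable
    qed
    also have "\<dots> = (\<integral>\<^sup>+y. (\<Sum>k. ennreal (exp (- (norm (y::'a))\<^sup>2)) * ennreal ((s * (x \<bullet> y)) ^ (2 * k) / fact (2 * k))) \<partial>lborel)"
      by (rule nn_integral_suminf[symmetric]) measurable
    also have "\<dots> = (\<integral>\<^sup>+y. ennreal (exp (- (norm y)\<^sup>2) * cosh (s * (x \<bullet> y))) \<partial>lborel)"
    proof (intro nn_integral_cong)
      fix y :: 'a
      have "(\<Sum>k. ennreal ((s * (x \<bullet> y)) ^ (2 * k) / fact (2 * k))) = ennreal (cosh (s * (x \<bullet> y)))"
        by (intro suminf_ennreal_eq cosh_paired) auto
      thus "(\<Sum>k. ennreal (exp (- (norm (y::'a))\<^sup>2)) * ennreal ((s * (x \<bullet> y)) ^ (2 * k) / fact (2 * k))) =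
         ennreal (exp (- (norm y)\<^sup>2) * cosh (s * (x \<bullet> y)))"
        by (simp add: ennreal_mult)
    qed
    also have "\<dots> = ennreal (exp (s\<^sup>2 * (norm x)\<^sup>2 / 4)) * G 0"
      unfolding nn_integral_Gauss_cosh by (simp add: G_def)
    finally show ?thesis using C by (simp add: G0 ennreal_mult)
  qed
  \<comment> \<open>An infinite moment would make the sum in \<open>S\<close> infinite at s =
    1.\<close>
  have fin: "G k \<noteq> top" for k
  proof
    assume "G k = top"
    hence "ennreal (1 ^ (2 * k) / fact (2 * k)) * G k = top" by (simp add: ennreal_mult_eq_top_iff)
    moreover have "(\<Sum>i<Suc k. ennreal (1 ^ (2 * i) / fact (2 * i)) * G i) \<le> (\<Sum>k. ennreal (1 ^ (2 * k) / fact (2 * k)) * G k)"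
      by (rule sum_le_suminf) auto
    ultimately show False unfolding S by (simp add: top_unique)
  qed
  define g where "g k = enn2real (G k)" for k
  have Gg: "G k = ennreal (g k)" and g0: "g k \<ge> 0" for k
    using fin[of k] by (auto simp: g_def less_top)
  have sg: "(\<lambda>k. g k / fact (2 * k) * z ^ k) sums (exp (z * (norm x)\<^sup>2 / 4) * C)" if "z \<ge> 0" for z
  proof -
    have E: "(\<Sum>k. ennreal (g k / fact (2 * k) * z ^ k)) = ennreal (exp (z * (norm x)\<^sup>2 / 4) * C)"
    proof -
      have "ennreal (sqrt z ^ (2 * k) / fact (2 * k)) * G k = ennreal (g k / fact (2 * k) * z ^ k)" for k
        unfolding Gg using that g0[of k] by (subst ennreal_mult[symmetric]) (auto simp: power_mult)
      thus ?thesis using S[of "sqrt z"] that by simp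
    qed
    moreover have nn: "g k / fact (2 * k) * z ^ k \<ge> 0" for k using that g0 by simp
    moreover have "summable (\<lambda>k. g k / fact (2 * k) * z ^ k)"
      by (rule summable_suminf_not_top[OF nn]) (simp only: E ennreal_neq_top not_False_eq_True)
    ultimately show ?thesis using C E
      by (auto simp: sums_iff suminf_ennreal2 suminf_nonneg)
  qed
  have se: "(\<lambda>k. C * ((norm x)\<^sup>2 / 4) ^ k / fact k * z ^ k) sums (exp (z * (norm x)\<^sup>2 / 4) * C)" for z
    using sums_mult[OF exp_converges[of "z * (norm x)\<^sup>2 / 4"], of C]
    by (simp add: power_mult_distrib power_divide field_simps)
  have "g k / fact (2 * k) - C * ((norm x)\<^sup>2 / 4) ^ k / fact k = 0"
  proof (rule power_series_coeffs_zero[of _ 1])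
    fix z :: real
    have "summable (\<lambda>k. g k / fact (2 * k) * \<bar>z\<bar> ^ k + C * ((norm x)\<^sup>2 / 4) ^ k / fact k * \<bar>z\<bar> ^ k)"
      using sg[of "\<bar>z\<bar>"] se[of "\<bar>z\<bar>"] by (intro summable_add) (auto simp: sums_iff)
    thus "summable (\<lambda>k. norm ((g k / fact (2 * k) - C * ((norm x)\<^sup>2 / 4) ^ k / fact k) * z ^ k))"
    proof (rule summable_comparison_test')
      fix k
      have "\<bar>g k / fact (2 * k) - C * ((norm x)\<^sup>2 / 4) ^ k / fact k\<bar> \<le> g k / fact (2 * k) + C * ((norm x)\<^sup>2 / 4) ^ k / fact k"
        using g0[of k] C by (intro abs_leI) (auto simp: diff_le_eq)
      from mult_right_mono[OF this, of "\<bar>z\<bar> ^ k"] 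
      show "norm (norm ((g k / fact (2 * k) - C * ((norm x)\<^sup>2 / 4) ^ k / fact k) * z ^ k)) \<le>
          g k / fact (2 * k) * \<bar>z\<bar> ^ k + C * ((norm x)\<^sup>2 / 4) ^ k / fact k * \<bar>z\<bar> ^ k"
        by (simp add: abs_mult power_abs distrib_right)
    qed
    assume "0 < z"
    thus "(\<Sum>k. (g k / fact (2 * k) - C * ((norm x)\<^sup>2 / 4) ^ k / fact k) * z ^ k) = 0"
      using sums_diff[OF sg[of z] se[of z]] by (simp add: sums_iff left_diff_distrib)
  qed simp
  hence "g k = C * ((norm x)\<^sup>2 / 4) ^ k * fact (2 * k) / fact k" by (simp add: field_simps)
  thus ?thesis using Gg[of k] by (simp add: G_def)
qed

text \<open>The Gaussian moment divided by the Gamma factor of the layer cake formula, rescaled to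
  radius R by homogeneity. The Pochhammer symbol originates in Gamma(d/2+k+1) = Gamma(d/2+1)
  (d/2+1)_k.\<close>

lemma has_bochner_integral_cball_moment:
  fixes x :: "'a::euclidean_space"
  defines "V \<equiv> measure lborel (cball (0::'a) 1)" and "D \<equiv> real DIM('a)"
  assumes R: "R > 0"
  shows "has_bochner_integral lborel (\<lambda>y. indicator (cball (0::'a) R) y * (x \<bullet> y) ^ (2 * k))
    (V * R ^ DIM('a) * (fact (2 * k) * ((R * norm x)\<^sup>2 / 4) ^ k / (fact k * pochhammer (D / 2 + 1) k)))"
proof (rule has_bochner_integral_nn_integral)
  let ?m = "\<integral>\<^sup>+y. ennreal (indicator (cball 0 1) y * (x \<bullet> y) ^ (2 * k)) \<partial>lborel"
  have V: "V > 0" using emeasure_cball_pos_finite(2)[where 'a='a] by (simp add: V_def)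
  have D: "D \<ge> 0" by (simp add: D_def)
  have Gk: "Gamma (D / 2 + k + 1) = Gamma (D / 2 + 1) * pochhammer (D / 2 + 1) k"
    using Gamma_add_nat[of "D / 2 + 1" k] D by (simp add: add_ac)
  have pos: "Gamma (D / 2 + k + 1) > 0" "Gamma (D / 2 + 1) > 0" "pochhammer (D / 2 + 1) k > 0"
    using D by (auto intro!: Gamma_real_pos pochhammer_pos)
  have "?m = ennreal (1 / Gamma (D / 2 + k + 1)) * (ennreal (Gamma (D / 2 + k + 1)) * ?m)"
    using pos by (simp flip: mult.assoc ennreal_mult')
  also have "\<dots> = ennreal (1 / Gamma (D / 2 + k + 1)) *
     ennreal (V * Gamma (D / 2 + 1) * ((norm x)\<^sup>2 / 4) ^ k * fact (2 * k) / fact k)"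
    unfolding D_def V_def nn_integral_Gauss_eq_cball[symmetric] nn_integral_Gauss_moment ..
  also have "\<dots> = ennreal (V * (fact (2 * k) * ((norm x)\<^sup>2 / 4) ^ k / (fact k * pochhammer (D / 2 + 1) k)))"
    using pos V unfolding Gk by (subst ennreal_mult[symmetric]) (simp_all add: mult_ac)
  finally have m: "?m = \<dots>" .
  show "(\<integral>\<^sup>+y. ennreal (indicator (cball (0::'a) R) y * (x \<bullet> y) ^ (2 * k)) \<partial>lborel) =
    ennreal (V * R ^ DIM('a) * (fact (2 * k) * ((R * norm x)\<^sup>2 / 4) ^ k / (fact k * pochhammer (D / 2 + 1) k)))"
  proof -
    have "((R * norm x)\<^sup>2 / 4) ^ k = R ^ (2 * k) * ((norm x)\<^sup>2 / 4) ^ k"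
      by (simp add: power_mult_distrib power_divide power_mult)
    thus ?thesis
      unfolding nn_integral_cball_scale[OF R] m using R V pos
      by (subst ennreal_mult[symmetric]) (simp_all add: power_add mult_ac)
  qed
  show "0 \<le> V * R ^ DIM('a) * (fact (2 * k) * ((R * norm x)\<^sup>2 / 4) ^ k / (fact k * pochhammer (D / 2 + 1) k))"
    using R V pos by auto
qed (auto simp: power_mult intro!: borel_measurable_times borel_measurable_indicator)

text \<open>The factor (2k)! of the moments cancels that of the cosine series, and the coefficients
  of \<Omega> with index d/2 remain. The index (d-2)/2 belongs to the sphere and is reached by
  differentiation in R.\<close>

lemma has_bochner_integral_cball_cos:
  fixes x :: "'a::euclidean_space"
  assumes R: "R > 0"
  shows "has_bochner_integral lborel (\<lambda>y. indicator (cball (0::'a) R) y * cos (x \<bullet> y))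
    (measure lborel (cball (0::'a) 1) * (R ^ DIM('a) * \<Omega> (DIM('a) / 2) (R * norm x)))"
proof -
  define V where "V = measure lborel (cball (0::'a) 1)"
  define \<nu> where "\<nu> = real DIM('a) / 2"
  define z where "z = (R * norm x)\<^sup>2"
  define m where "m k = V * R ^ DIM('a) * (fact (2 * k) * (z / 4) ^ k / (fact k * pochhammer (\<nu> + 1) k))" for k
  have \<nu>: "\<nu> > -1" by (simp add: \<nu>_def less_le_trans[of _ 0])
  have e: "(- 1) ^ k * m k / fact (2 * k) = V * R ^ DIM('a) * (\<Omega>_coeff \<nu> k * z ^ k)" for k
    by (simp add: m_def \<Omega>_coeff_def power_divide power_minus[of "1/4"])
  have s: "summable (\<lambda>k. \<Omega>_coeff \<nu> k * z ^ k)"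
    by (rule summable_norm_cancel[OF summable_\<Omega>_coeff[OF \<nu>]])
  have pos: "pochhammer (\<nu> + 1) k > 0" for k using \<nu> by (intro pochhammer_pos) simp
  have e': "m k / fact (2 * k) = V * R ^ DIM('a) * norm (\<Omega>_coeff \<nu> k * z ^ k)" for k
    using pos[of k] R by (simp add: m_def \<Omega>_coeff_def power_divide abs_mult power_abs z_def)
  have "summable (\<lambda>k. m k / fact (2 * k))"
    unfolding e' by (intro summable_mult summable_\<Omega>_coeff[OF \<nu>])
  moreover have "has_bochner_integral lborel (\<lambda>y. indicator (cball (0::'a) R) y * (x \<bullet> y) ^ (2 * k)) (m k)" for k
    using has_bochner_integral_cball_moment[OF R, of x k]
    unfolding m_def z_def \<nu>_def V_def .
  ultimately have "has_bochner_integral lborel (\<lambda>y. indicator (cball (0::'a) R) y * cos (x \<bullet> y))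
      (\<Sum>k. (- 1) ^ k * m k / fact (2 * k))"
    by (intro has_bochner_integral_cos_moments) auto
  thus ?thesis
    unfolding e suminf_mult[OF s] by (simp add: mult.assoc \<Omega>_eq_suminf \<nu> V_def z_def flip: \<nu>_def)
qed

lemma exp_sums: "(\<lambda>k. z ^ k / fact k) sums exp (z::real)"
  using exp_converges[of z] by (simp add: field_simps)

lemma has_bochner_integral_Gauss_cos:
  fixes x :: "'a::euclidean_space"
  defines "C \<equiv> measure lborel (cball (0::'a) 1) * Gamma (DIM('a) / 2 + 1)"
  shows "has_bochner_integral lborel (\<lambda>y. exp (- (norm y)\<^sup>2) * cos (x \<bullet> y)) (C * exp (- (norm x)\<^sup>2 / 4))"
proof -
  define m where "m k = C * ((norm x)\<^sup>2 / 4) ^ k * fact (2 * k) / fact k" for k :: nat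
  have Gam: "Gamma (DIM('a) / 2 + 1) > 0" by (intro Gamma_real_pos) auto
  have C: "C > 0" unfolding C_def using Gam emeasure_cball_pos_finite(2)[where 'a='a] by simp
  have m: "has_bochner_integral lborel (\<lambda>y. exp (- (norm y)\<^sup>2) * (x \<bullet> y) ^ (2 * k)) (m k)" for k
  proof (rule has_bochner_integral_nn_integral)
    show "(\<integral>\<^sup>+y. ennreal (exp (- (norm y)\<^sup>2) * (x \<bullet> y) ^ (2 * k)) \<partial>lborel) = ennreal (m k)"
      unfolding m_def C_def by (rule nn_integral_Gauss_moment)
  qed (use C in \<open>auto simp: m_def power_mult\<close>)
  have "(\<lambda>k. C * (((norm x)\<^sup>2 / 4) ^ k / fact k)) sums (C * exp ((norm x)\<^sup>2 / 4))"
    by (intro sums_mult exp_sums)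
  hence s: "summable (\<lambda>k. m k / fact (2 * k))"
    by (simp add: m_def sums_iff)
  have "(\<lambda>k. C * ((- ((norm x)\<^sup>2 / 4)) ^ k / fact k)) sums (C * exp (- ((norm x)\<^sup>2 / 4)))"
    by (intro sums_mult exp_sums)
  hence "(\<Sum>k. (- 1) ^ k * m k / fact (2 * k)) = C * exp (- (norm x)\<^sup>2 / 4)"
    by (simp add: m_def sums_iff power_minus[of "(norm x)\<^sup>2 / 4"] mult_ac)
  with has_bochner_integral_cos_moments[OF _ _ m s] show ?thesis by simp
qed

section \<open>From balls to spheres and radial functions\<close>

lemma \<Omega>_0: "\<nu> > -1 \<Longrightarrow> \<Omega> \<nu> 0 = 1"
  by (simp add: \<Omega>_eq_suminf powser_zero) (simp add: \<Omega>_coeff_def)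

text \<open>Up to the volume of the unit ball, r^d \<Omega>(r t) with index d/2 is a Fourier
  integral over the ball of radius r; its derivative is one over the sphere and has the index
  lowered by 1. On coefficients this is (d+2k) / (d/2+1)_k = d / (d/2)_k.\<close>

lemma DERIV_power_times_\<Omega>:
  assumes d: "d > (0::nat)"
  shows "((\<lambda>r. r ^ d * \<Omega> (d / 2) (r * t)) has_real_derivative
           d * r ^ (d - 1) * \<Omega> (d / 2 - 1) (r * t)) (at r)"
proof -
  define c where "c = \<Omega>_coeff (d / 2)"
  define F where "F z = (\<Sum>k. c k * z ^ k)" for z
  define F' where "F' z = (\<Sum>k. diffs c k * z ^ k)" for z
  have \<nu>: "real d / 2 > -1" "real d / 2 - 1 > -1" using d by auto
  have sc: "summable (\<lambda>k. c k * z ^ k)" for z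
    unfolding c_def by (rule summable_norm_cancel[OF summable_\<Omega>_coeff[OF \<nu>(1)]])
  have so: "summable (\<lambda>k. \<Omega>_coeff (d / 2 - 1) k * z ^ k)" for z
    by (rule summable_norm_cancel[OF summable_\<Omega>_coeff[OF \<nu>(2)]])
  have F: "(F has_real_derivative F' z) (at z)" for z
    unfolding F_def F'_def by (rule termdiffs_strong_converges_everywhere[OF sc])
  have \<Omega>F: "\<Omega> (d / 2) s = F (s\<^sup>2)" for s
    by (simp add: \<Omega>_eq_suminf[OF \<nu>(1)] F_def c_def)
  have sd: "summable (\<lambda>n. diffs c n * z ^ n)" for z
    by (rule termdiff_converges_all[OF sc])
  have "real (d + 2 * k) * c k = real d * \<Omega>_coeff (d / 2 - 1) k" for k
  proof -
    have "pochhammer (real d / 2) (Suc k) = real d / 2 * pochhammer (real d / 2 + 1) k"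
      by (simp add: pochhammer_rec)
    moreover have "pochhammer (real d / 2) (Suc k) = pochhammer (real d / 2) k * (real d / 2 + k)"
      by (simp add: pochhammer_Suc)
    moreover have "pochhammer (real d / 2) k > 0" "pochhammer (real d / 2 + 1) k > 0"
      using d by (auto intro!: pochhammer_pos)
    ultimately have "real (d + 2 * k) / pochhammer (real d / 2 + 1) k = real d / pochhammer (real d / 2) k"
      by (simp add: frac_eq_eq) (simp add: algebra_simps)
    hence "(- 1 / 4) ^ k / fact k * (real (d + 2 * k) / pochhammer (real d / 2 + 1) k) =
       (- 1 / 4) ^ k / fact k * (real d / pochhammer (real d / 2) k)" by simp
    thus ?thesis by (simp only: c_def \<Omega>_coeff_def) (simp add: mult.commute)
  qed
  hence co: "real d * c k + 2 * (real k * c k) = real d * \<Omega>_coeff (d / 2 - 1) k" for k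
    by (simp add: algebra_simps)
  \<comment> \<open>\<open>F\<close> is the series in the squared argument z, so the operator d + 2
    z d/dz multiplies its k-th coefficient by d + 2k.\<close>
  have key: "real d * F z + 2 * (z * F' z) = real d * \<Omega>' " if "\<Omega>' = (\<Sum>k. \<Omega>_coeff (d / 2 - 1) k * z ^ k)" for z \<Omega>'
  proof -
    have "(\<lambda>n. real n * c n * z ^ (n - Suc 0)) sums F' z"
      unfolding F'_def by (rule diffs_equiv[OF sd])
    from sums_mult[OF this, of "2 * z"]
    have "(\<lambda>n. 2 * (real n * c n) * z ^ n) sums (2 * (z * F' z))"
    proof -
      have "(\<lambda>n. 2 * z * (real n * c n * z ^ (n - Suc 0))) = (\<lambda>n. 2 * (real n * c n) * z ^ n)"
        by (rule ext, case_tac n) auto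
      thus ?thesis using \<open>(\<lambda>n. 2 * z * (real n * c n * z ^ (n - Suc 0))) sums (2 * z * F' z)\<close>
        by (simp only: mult.assoc)
    qed
    moreover have "(\<lambda>n. real d * c n * z ^ n) sums (real d * F z)"
      using sums_mult[OF summable_sums[OF sc[of z]], of "real d"] by (simp add: F_def mult.assoc)
    ultimately have "(\<lambda>n. real d * c n * z ^ n + 2 * (real n * c n) * z ^ n) sums (real d * F z + 2 * (z * F' z))"
      by (intro sums_add)
    hence "(\<lambda>n. real d * (\<Omega>_coeff (d / 2 - 1) n * z ^ n)) sums (real d * F z + 2 * (z * F' z))"
    proof -
      have "real d * c n * z ^ n + 2 * (real n * c n) * z ^ n = real d * (\<Omega>_coeff (d / 2 - 1) n * z ^ n)" for n
        using arg_cong[OF co[of n], of "\<lambda>u. u * z ^ n"] by (simp add: distrib_right mult.assoc)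
      thus ?thesis using \<open>(\<lambda>n. real d * c n * z ^ n + 2 * (real n * c n) * z ^ n) sums _\<close> by (simp only:)
    qed
    moreover have "(\<lambda>n. real d * (\<Omega>_coeff (d / 2 - 1) n * z ^ n)) sums (real d * \<Omega>')"
      unfolding that by (intro sums_mult summable_sums so)
    ultimately show ?thesis by (rule sums_unique2)
  qed
  have "((\<lambda>r. r ^ d * F ((r * t)\<^sup>2)) has_real_derivative
     real d * r ^ (d - 1) * F ((r * t)\<^sup>2) + r ^ d * (F' ((r * t)\<^sup>2) * (2 * (r * t) * t))) (at r)"
    by (auto intro!: derivative_eq_intros DERIV_chain2[OF F] simp: mult_ac)
  also have "real d * r ^ (d - 1) * F ((r * t)\<^sup>2) + r ^ d * (F' ((r * t)\<^sup>2) * (2 * (r * t) * t)) =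
     r ^ (d - 1) * (real d * F ((r * t)\<^sup>2) + 2 * ((r * t)\<^sup>2 * F' ((r * t)\<^sup>2)))"
    using d by (cases d) (auto simp: power2_eq_square algebra_simps)
  also have "\<dots> = d * r ^ (d - 1) * \<Omega> (d / 2 - 1) (r * t)"
    by (subst key[OF \<Omega>_eq_suminf[OF \<nu>(2)]]) simp
  finally show ?thesis by (simp add: \<Omega>F)
qed

text \<open>The derivative in \<open>R\<close> of the integral of \<open>cos (x \<bullet> y)\<close> over the ball of radius \<open>R\<close> is dominated by that of its volume.\<close>
lemma abs_\<Omega>_le_1: "\<bar>\<Omega> (DIM('a::euclidean_space) / 2 - 1) s\<bar> \<le> 1"
proof -
  obtain x :: 'a where x: "norm x = \<bar>s\<bar>" using vector_choose_size[of "\<bar>s\<bar>"] by auto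
  let ?V = "measure lborel (cball (0::'a) 1)"
  have V: "?V > 0" by (rule emeasure_cball_pos_finite)
  have even: "\<Omega> (DIM('a) / 2 - 1) \<bar>s\<bar> = \<Omega> (DIM('a) / 2 - 1) s"
    using DIM_positive[where 'a='a] by (simp add: \<Omega>_eq_suminf)
  \<comment> \<open>The weight 1 + \<sigma> cos is nonnegative, so its integral \<open>J R\<close>
    over the ball of radius R increases with R, which a negative derivative at R = 1 would
    contradict. The values 1 and -1 of \<sigma> give the two bounds.\<close>
  have one: "0 \<le> 1 + \<sigma> * \<Omega> (DIM('a) / 2 - 1) s" if \<sigma>: "\<bar>\<sigma>\<bar> \<le> 1" for \<sigma>
  proof (rule ccontr)
    assume neg: "\<not> ?thesis"
    define J where "J R = ?V * (R ^ DIM('a) * \<Omega> (DIM('a) / 2) (R * 0)) + \<sigma> * (?V * (R ^ DIM('a) * \<Omega> (DIM('a) / 2) (R * norm x)))" for R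
    have hJ: "has_bochner_integral lborel (\<lambda>y::'a. indicator (cball 0 R) y * cos (0 \<bullet> y) + \<sigma> * (indicator (cball 0 R) y * cos (x \<bullet> y))) (J R)" if "R > 0" for R
      unfolding J_def using that has_bochner_integral_cball_cos[of R 0]
      by (intro has_bochner_integral_add has_bochner_integral_mult_right has_bochner_integral_cball_cos) auto
    have mono: "J R \<le> J R'" if "0 < R" "R \<le> R'" for R R'
    proof -
     have "(LINT y|lborel. indicator (cball (0::'a) R) y * cos (0 \<bullet> y) + \<sigma> * (indicator (cball 0 R) y * cos (x \<bullet> y))) \<le>
       (LINT y|lborel. indicator (cball (0::'a) R') y * cos (0 \<bullet> y) + \<sigma> * (indicator (cball 0 R') y * cos (x \<bullet> y)))"
     proof (rule integral_mono)
      fix y :: 'a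
      have "\<bar>\<sigma> * cos (x \<bullet> y)\<bar> \<le> 1 * 1" unfolding abs_mult using \<sigma> by (intro mult_mono) auto
      thus "indicator (cball 0 R) y * cos (0 \<bullet> y) + \<sigma> * (indicator (cball 0 R) y * cos (x \<bullet> y)) \<le>
        indicator (cball 0 R') y * cos (0 \<bullet> y) + \<sigma> * (indicator (cball 0 R') y * cos (x \<bullet> y))"
        using that by (auto simp: indicator_def)
     qed (use that hJ in \<open>auto simp: has_bochner_integral_iff\<close>)
     thus ?thesis using that hJ by (simp add: has_bochner_integral_iff)
    qed
    have "(J has_real_derivative ?V * (real DIM('a) * 1 ^ (DIM('a) - 1) * \<Omega> (DIM('a) / 2 - 1) (1 * 0)) +
       \<sigma> * (?V * (real DIM('a) * 1 ^ (DIM('a) - 1) * \<Omega> (DIM('a) / 2 - 1) (1 * norm x)))) (at 1)"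
      unfolding J_def by (intro DERIV_add DERIV_cmult DERIV_power_times_\<Omega>) auto
    moreover have "\<Omega> (DIM('a) / 2 - 1) 0 = 1"
      using DIM_positive[where 'a='a]
      by (intro \<Omega>_0) simp
    ultimately have "(J has_real_derivative ?V * DIM('a) * (1 + \<sigma> * \<Omega> (DIM('a) / 2 - 1) s)) (at 1)"
      by (simp add: x even algebra_simps)
    moreover have "?V * DIM('a) * (1 + \<sigma> * \<Omega> (DIM('a) / 2 - 1) s) < 0"
      using neg V by (intro mult_pos_neg) (auto simp: DIM_positive)
    ultimately obtain e where e: "e > 0" "\<And>h. h > 0 \<Longrightarrow> h < e \<Longrightarrow> J (1 + h) < J 1"
      using DERIV_neg_dec_right by blast
    show False using e(2)[of "e / 2"] e(1) mono[of 1 "1 + e / 2"] by simp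
  qed
  show ?thesis using one[of 1] one[of "-1"] by simp
qed

lemma continuous_on_\<Omega> [continuous_intros]:
  assumes "\<nu> > -1" "continuous_on A f"
  shows "continuous_on A (\<lambda>x. \<Omega> \<nu> (f x))"
proof -
  have "isCont (\<lambda>z. \<Sum>k. \<Omega>_coeff \<nu> k * z ^ k) z" for z
    by (rule isCont_powser_converges_everywhere)
       (rule summable_norm_cancel[OF summable_\<Omega>_coeff[OF assms(1)]])
  hence "continuous_on UNIV (\<lambda>z. \<Sum>k. \<Omega>_coeff \<nu> k * z ^ k)"
    by (simp add: continuous_at_imp_continuous_on)
  from continuous_on_compose2[OF this continuous_on_power[OF assms(2), of 2]] show ?thesis
    by (simp add: \<Omega>_eq_suminf[OF assms(1)])
qed

lemma borel_measurable_\<Omega> [measurable (raw)]: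
  assumes "\<nu> > -1" "f \<in> borel_measurable M"
  shows "(\<lambda>x. \<Omega> \<nu> (f x)) \<in> borel_measurable M"
  using assms by (intro borel_measurable_continuous_on[of "\<Omega> \<nu>"] continuous_on_\<Omega>) auto

text \<open>The measures on the half-line agree on the generating sets \<open>{..R}\<close>: this replaces integration in polar coordinates.\<close>
lemma distr_norm_density_cos:
  fixes x :: "'a::euclidean_space"
  defines "V \<equiv> measure lborel (cball (0::'a) 1)"
  shows "distr (density lborel (\<lambda>y::'a. ennreal (1 + cos (x \<bullet> y)))) borel norm =
    density lborel (\<lambda>r. ennreal (indicator {0..} r *
      (V * (real DIM('a) * r ^ (DIM('a) - 1) * (1 + \<Omega> (DIM('a) / 2 - 1) (r * norm x))))))"
    (is "?M = ?N")
proof -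
  let ?d = "DIM('a)"
  \<comment> \<open>\<open>J R\<close> is the mass of the ball of radius R and \<open>g\<close> its
    derivative. The density is 1 + cos and not cos so that both sides are measures; on the radial
    side nonnegativity is the bound by 1 on \<Omega>.\<close>
  define g where "g r = V * (real ?d * r ^ (?d - 1) * (1 + \<Omega> (?d / 2 - 1) (r * norm x)))" for r
  define J where "J R = V * (R ^ ?d * \<Omega> (?d / 2) (R * 0) + R ^ ?d * \<Omega> (?d / 2) (R * norm x))" for R
  have V: "V > 0" using emeasure_cball_pos_finite(2)[where 'a='a] by (simp add: V_def)
  have d: "?d > 0" by simp
  have \<nu>: "real ?d / 2 - 1 > -1" by simp
  have [measurable]: "g \<in> borel_measurable borel" unfolding g_def using \<nu> by measurable
  have g0: "g r \<ge> 0" if "r \<ge> 0" for r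
    unfolding g_def using V that abs_\<Omega>_le_1[where 'a='a, of "r * norm x"]
    by (intro mult_nonneg_nonneg) auto
  have J: "(J has_real_derivative g r) (at r)" for r
    unfolding J_def g_def
    using DERIV_cmult[OF DERIV_add[OF DERIV_power_times_\<Omega>[OF d, of 0 r] DERIV_power_times_\<Omega>[OF d, of "norm x" r]], of V]
      \<Omega>_0[OF \<nu>] by (simp add: algebra_simps)
  have J0: "J 0 = 0" using d by (simp add: J_def)
  have nv: "norm -` {..R} = cball (0::'a) R" for R by auto
  have eq: "emeasure ?M {..R} = emeasure ?N {..R}" for R
  proof (cases "R > 0")
    case True
    have h: "has_bochner_integral lborel (\<lambda>y::'a. indicator (cball 0 R) y * cos (0 \<bullet> y) + indicator (cball 0 R) y * cos (x \<bullet> y)) (J R)"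
      using has_bochner_integral_add[OF has_bochner_integral_cball_cos[OF True, of 0] has_bochner_integral_cball_cos[OF True, of x]]
      by (simp add: J_def V_def algebra_simps)
    have c: "0 \<le> 1 + cos (x \<bullet> y)" for y using cos_ge_minus_one[of "x \<bullet> y"] by linarith
    have nn: "0 \<le> indicator (cball 0 R) y * cos (0 \<bullet> y) + indicator (cball 0 R) y * cos (x \<bullet> y)" for y :: 'a
      using c[of y] by (auto simp: indicator_def)
    have "emeasure ?M {..R} = (\<integral>\<^sup>+y. ennreal (1 + cos (x \<bullet> y)) * indicator (norm -` {..R}) y \<partial>lborel)"
      by (simp add: emeasure_distr emeasure_density nv)
    also have "\<dots> = (\<integral>\<^sup>+y. ennreal (indicator (cball 0 R) y * cos (0 \<bullet> y) + indicator (cball 0 R) y * cos (x \<bullet> y)) \<partial>lborel)"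
      by (intro nn_integral_cong) (auto simp: indicator_def)
    also have "\<dots> = ennreal (J R)"
      using h nn by (subst nn_integral_eq_integral) (auto simp: has_bochner_integral_iff)
    finally have 1: "emeasure ?M {..R} = ennreal (J R)" .
    have "emeasure ?N {..R} = (\<integral>\<^sup>+r. ennreal (g r) * indicator {0..R} r \<partial>lborel)"
      using \<nu> by (subst emeasure_density) (auto simp: g_def indicator_def intro!: nn_integral_cong)
    also have "\<dots> = ennreal (J R - J 0)"
      using True J g0 by (intro nn_integral_FTC_Icc)
        (auto simp: has_real_derivative_iff_has_vector_derivative intro: has_vector_derivative_at_within)
    finally show ?thesis using 1 by (simp add: J0)
  next
    case False
    have "emeasure ?M {..R} = (\<integral>\<^sup>+y. ennreal (1 + cos (x \<bullet> y)) * indicator (norm -` {..R}) y \<partial>lborel)"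
      by (simp add: emeasure_distr emeasure_density nv)
    also have "\<dots> = (\<integral>\<^sup>+y. 0 \<partial>(lborel :: 'a measure))"
    proof (intro nn_integral_cong_AE, use AE_lborel_singleton[of "0::'a"] in eventually_elim)
      fix y :: 'a assume "y \<noteq> 0"
      hence "\<not> norm y \<le> R" using False by (smt (verit) zero_less_norm_iff)
      thus "ennreal (1 + cos (x \<bullet> y)) * indicator (norm -` {..R}) y = 0" by (simp add: indicator_def)
    qed
    finally have 1: "emeasure ?M {..R} = 0" by simp
    have "emeasure ?N {..R} = (\<integral>\<^sup>+r. 0 \<partial>(lborel :: real measure))"
    proof (subst emeasure_density)
      show "(\<integral>\<^sup>+r. ennreal (indicator {0..} r * (V * (real ?d * r ^ (?d - 1) * (1 + \<Omega> (?d / 2 - 1) (r * norm x))))) * indicator {..R} r \<partial>lborel)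
        = (\<integral>\<^sup>+r. 0 \<partial>(lborel :: real measure))"
      proof (intro nn_integral_cong_AE, use AE_lborel_singleton[of "0::real"] in eventually_elim)
        fix r :: real assume "r \<noteq> 0"
        thus "ennreal (indicator {0..} r * (V * (real ?d * r ^ (?d - 1) * (1 + \<Omega> (?d / 2 - 1) (r * norm x))))) * indicator {..R} r = 0"
          using False by (auto simp: indicator_def)
      qed
    qed (use \<nu> in auto)
    thus ?thesis using 1 by simp
  qed
  show ?thesis
  proof (rule measure_eqI_generator_eq[where E="range (\<lambda>a::real. {..a})" and \<Omega>=UNIV and A="\<lambda>i. {..real i}"])
    show "Int_stable (range (\<lambda>a::real. {..a}))" by (auto simp: Int_stable_def)
    show "(\<Union>i. {..real i}) = UNIV" using real_arch_simple by auto
    show "emeasure ?M {..real i} \<noteq> \<infinity>" for i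
      unfolding eq using \<nu>
    proof (subst emeasure_density)
      have "(\<integral>\<^sup>+r. ennreal (indicator {0..} r * (V * (real ?d * r ^ (?d - 1) * (1 + \<Omega> (?d / 2 - 1) (r * norm x))))) * indicator {..real i} r \<partial>lborel)
        = (\<integral>\<^sup>+r. ennreal (g r) * indicator {0..real i} r \<partial>lborel)"
        by (auto simp: g_def indicator_def intro!: nn_integral_cong)
      also have "\<dots> = ennreal (J i - J 0)"
        using J g0 by (intro nn_integral_FTC_Icc)
          (auto simp: has_real_derivative_iff_has_vector_derivative intro: has_vector_derivative_at_within)
      finally show "(\<integral>\<^sup>+r. ennreal (indicator {0..} r * (V * (real ?d * r ^ (?d - 1) * (1 + \<Omega> (?d / 2 - 1) (r * norm x))))) * indicator {..real i} r \<partial>lborel) \<noteq> \<infinity>"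
        by simp
    qed (use \<nu> in auto)
  qed (use eq in \<open>auto simp: borel_eq_atMost\<close>)
qed

text \<open>Obtained by integrating h against two equal measures on the half-line.
  \<open>real DIM('a) * V\<close> is the area of the unit sphere, and \<Omega> plays the part of the
  spherical mean of the cosine.\<close>

lemma has_bochner_integral_radial_cos:
  fixes x :: "'a::euclidean_space" and h :: "real \<Rightarrow> real"
  defines "V \<equiv> measure lborel (cball (0::'a) 1)"
  assumes [measurable]: "h \<in> borel_measurable borel"
    and h: "integrable lborel (\<lambda>r. indicator {0..} r * (h r * r ^ (DIM('a) - 1)))"
  shows "integrable lborel (\<lambda>r. indicator {0..} r * (\<Omega> (DIM('a) / 2 - 1) (r * norm x) * h r * r ^ (DIM('a) - 1)))"
    and "has_bochner_integral lborel (\<lambda>y::'a. h (norm y) * cos (x \<bullet> y))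
      (real DIM('a) * V * (LINT r|lborel. indicator {0..} r * (\<Omega> (DIM('a) / 2 - 1) (r * norm x) * h r * r ^ (DIM('a) - 1))))"
proof -
  let ?d = "DIM('a)"
  let ?\<Omega> = "\<lambda>x r. \<Omega> (?d / 2 - 1) (r * norm (x::'a))"
  have V: "V > 0" using emeasure_cball_pos_finite(2)[where 'a='a] by (simp add: V_def)
  have \<nu>: "real ?d / 2 - 1 > -1" by simp
  note [measurable] = borel_measurable_\<Omega>[OF \<nu>]
  have i\<Omega>: "integrable lborel (\<lambda>r. indicator {0..} r * (?\<Omega> x r * h r * r ^ (?d - 1)))" for x
  proof (rule Bochner_Integration.integrable_bound[OF h])
    show "AE r in lborel. norm (indicator {0..} r * (?\<Omega> x r * h r * r ^ (?d - 1))) \<le> norm (indicator {0..} r * (h r * r ^ (?d - 1)))"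
    proof (rule AE_I2)
      fix r :: real
      show "norm (indicator {0..} r * (?\<Omega> x r * h r * r ^ (?d - 1))) \<le> norm (indicator {0..} r * (h r * r ^ (?d - 1)))"
        using mult_right_mono[OF abs_\<Omega>_le_1[where 'a='a, of "r * norm x"], of "\<bar>indicator {0..} r * (h r * r ^ (?d - 1))\<bar>"]
        by (simp add: abs_mult mult_ac)
    qed
  qed measurable
  show "integrable lborel (\<lambda>r. indicator {0..} r * (\<Omega> (?d / 2 - 1) (r * norm x) * h r * r ^ (?d - 1)))"
    by (rule i\<Omega>)
  define I where "I x = (LINT r|lborel. indicator {0..} r * (?\<Omega> x r * h r * r ^ (?d - 1)))" for x
  define I0 where "I0 = (LINT r|lborel. indicator {0..} r * (h r * r ^ (?d - 1)))"
  have main: "has_bochner_integral lborel (\<lambda>y::'a. (1 + cos (x \<bullet> y)) * h (norm y)) (real ?d * V * (I0 + I x))" for x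
  proof -
    define G where "G r = indicator {0..} r * (V * (real ?d * r ^ (?d - 1) * (1 + ?\<Omega> x r)))" for r
    have G0: "G r \<ge> 0" for r
      unfolding G_def using V abs_\<Omega>_le_1[where 'a='a, of "r * norm x"]
      by (auto simp: indicator_def intro!: mult_nonneg_nonneg)
    have [measurable]: "G \<in> borel_measurable borel" unfolding G_def by measurable
    have Ge: "(\<lambda>r. G r * h r) = (\<lambda>r. ?d * V * (indicator {0..} r * (h r * r ^ (?d - 1)) + indicator {0..} r * (?\<Omega> x r * h r * r ^ (?d - 1))))"
      by (auto simp: fun_eq_iff G_def algebra_simps)
    have hG: "has_bochner_integral lborel (\<lambda>r. G r * h r) (real ?d * V * (I0 + I x))"
      unfolding Ge I0_def I_def
      by (intro has_bochner_integral_mult_right has_bochner_integral_add has_bochner_integral_integrable h i\<Omega>)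
    have M: "distr (density lborel (\<lambda>y::'a. ennreal (1 + cos (x \<bullet> y)))) borel norm = density lborel (\<lambda>r. ennreal (G r))"
      using distr_norm_density_cos[of x] by (simp add: G_def V_def)
    have c: "0 \<le> 1 + cos (x \<bullet> y)" for y using cos_ge_minus_one[of "x \<bullet> y"] by linarith
    have "integrable (density lborel (\<lambda>r. ennreal (G r))) h"
      using hG G0 by (subst integrable_density) (auto simp: has_bochner_integral_iff)
    hence "integrable (distr (density lborel (\<lambda>y::'a. ennreal (1 + cos (x \<bullet> y)))) borel norm) h"
      by (simp add: M)
    hence 1: "integrable lborel (\<lambda>y::'a. (1 + cos (x \<bullet> y)) * h (norm y))"
      using c by (subst (asm) integrable_distr_eq) (auto simp: integrable_density)
    have "?d * V * (I0 + I x) = integral\<^sup>L (density lborel (\<lambda>r. ennreal (G r))) h"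
      using hG G0 by (subst integral_density) (auto simp: has_bochner_integral_iff)
    also have "\<dots> = (LINT y|lborel. (1 + cos (x \<bullet> y)) * h (norm y))"
      unfolding M[symmetric] using c by (subst integral_distr) (auto simp: integral_density)
    finally show ?thesis using 1 by (simp add: has_bochner_integral_iff)
  qed
  have "I 0 = I0" using \<Omega>_0[OF \<nu>] by (simp add: I_def I0_def)
  \<comment> \<open>At x = 0 the weight 1 + cos is the constant 2; half of that case removes the
    summand 1.\<close>
  hence "has_bochner_integral lborel (\<lambda>y::'a. (1 + cos (x \<bullet> y)) * h (norm y) - 1 / 2 * ((1 + cos (0 \<bullet> y)) * h (norm y)))
      (real ?d * V * (I0 + I x) - 1 / 2 * (real ?d * V * (I0 + I0)))"
    using main[of 0] by (intro has_bochner_integral_diff has_bochner_integral_mult_right main) simp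
  thus "has_bochner_integral lborel (\<lambda>y::'a. h (norm y) * cos (x \<bullet> y))
      (real ?d * V * (LINT r|lborel. indicator {0..} r * (\<Omega> (?d / 2 - 1) (r * norm x) * h r * r ^ (?d - 1))))"
    by (simp add: I_def algebra_simps)
qed

subsection \<open>Strict positive definiteness from a radial Fourier integral\<close>

text \<open>The addition theorem for cos(a_j - a_k) splits the form into a cosine part and a sine
  part, and each of them is the squared modulus of a single sum.\<close>

lemma sum_Re_mult_cos_diff_nonneg:
  fixes a :: "nat \<Rightarrow> real"
  shows "0 \<le> (\<Sum>j<N. \<Sum>k<N. Re (z j * cnj (z k)) * cos (a j - a k))"
proof -
  have sq: "(\<Sum>j<N. \<Sum>k<N. Re (z j * cnj (z k)) * (c j * c k)) = (cmod (\<Sum>j<N. z j * of_real (c j)))\<^sup>2" for c :: "nat \<Rightarrow> real"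
  proof -
    have "complex_of_real ((cmod (\<Sum>j<N. z j * of_real (c j)))\<^sup>2) =
      (\<Sum>j<N. z j * of_real (c j)) * cnj (\<Sum>j<N. z j * of_real (c j))"
      by (rule complex_norm_square)
    also have "\<dots> = (\<Sum>j<N. \<Sum>k<N. z j * cnj (z k) * of_real (c j * c k))"
      unfolding cnj_sum sum_product by (simp add: mult_ac)
    finally have "Re (complex_of_real ((cmod (\<Sum>j<N. z j * of_real (c j)))\<^sup>2)) = Re \<dots>" by simp
    thus ?thesis by (simp add: algebra_simps)
  qed
  have "(\<Sum>j<N. \<Sum>k<N. Re (z j * cnj (z k)) * cos (a j - a k)) =
     (\<Sum>j<N. \<Sum>k<N. Re (z j * cnj (z k)) * (cos (a j) * cos (a k))) +
     (\<Sum>j<N. \<Sum>k<N. Re (z j * cnj (z k)) * (sin (a j) * sin (a k)))"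
    unfolding sum.distrib[symmetric] by (simp add: cos_diff distrib_left)
  also have "\<dots> \<ge> 0" unfolding sq by simp
  finally show ?thesis .
qed

text \<open>The moments are, up to constants, the Taylor coefficients in s of the form with kernel
  exp(-s |x_j - x_k|^2), which therefore vanishes for every s. As s tends to infinity the
  off-diagonal terms die, the points being distinct, and the sum of |z_j|^2 is left.\<close>

lemma zero_if_distance_moments_vanish:
  fixes x :: "nat \<Rightarrow> 'a::real_normed_vector" and z :: "nat \<Rightarrow> complex"
  assumes x: "inj_on x {..<N}"
    and m: "\<And>m. (\<Sum>j<N. \<Sum>k<N. Re (z j * cnj (z k)) * ((norm (x j - x k))\<^sup>2) ^ m) = 0"
  shows "\<forall>j<N. z j = 0"
proof -
  define w where "w j k = Re (z j * cnj (z k))" for j k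
  define D where "D j k = (norm (x j - x k))\<^sup>2" for j k
  have zero: "(\<Sum>j<N. \<Sum>k<N. w j k * exp (- s * D j k)) = 0" for s
  proof -
    have "(\<lambda>m. \<Sum>j<N. \<Sum>k<N. w j k * ((- s * D j k) ^ m / fact m)) sums (\<Sum>j<N. \<Sum>k<N. w j k * exp (- s * D j k))"
      by (intro sums_sum sums_mult exp_sums)
    moreover have "(\<Sum>j<N. \<Sum>k<N. w j k * ((- s * D j k) ^ i / fact i)) = 0" for i
    proof -
      have "(\<Sum>j<N. \<Sum>k<N. w j k * ((- s * D j k) ^ i / fact i)) =
        (- s) ^ i / fact i * (\<Sum>j<N. \<Sum>k<N. w j k * D j k ^ i)"
        by (simp only: sum_distrib_left power_mult_distrib) (simp add: mult_ac)
      also have "\<dots> = 0" using m[of i] by (simp add: w_def D_def)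
      finally show ?thesis .
    qed
    ultimately show ?thesis by (simp add: sums_iff)
  qed
  have "((\<lambda>s. \<Sum>j<N. \<Sum>k<N. w j k * exp (- s * D j k)) \<longlongrightarrow> (\<Sum>j<N. \<Sum>k<N. w j k * (if j = k then 1 else 0))) at_top"
  proof (intro tendsto_sum tendsto_mult tendsto_const)
    fix j k assume jk: "j \<in> {..<N}" "k \<in> {..<N}"
    show "((\<lambda>s. exp (- s * D j k)) \<longlongrightarrow> (if j = k then 1 else 0)) at_top"
    proof (cases "j = k")
      case False
      hence "D j k > 0" using x jk by (auto simp: D_def inj_on_def)
      hence "filterlim (\<lambda>s. - (D j k * s)) at_bot at_top"
        by (intro filterlim_compose[OF filterlim_uminus_at_bot_at_top] filterlim_tendsto_pos_mult_at_top[OF tendsto_const] filterlim_ident)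
      from filterlim_compose[OF exp_at_bot this] show ?thesis using False by (simp add: mult.commute)
    qed (simp add: D_def)
  qed
  hence "(\<Sum>j<N. \<Sum>k<N. w j k * (if j = k then 1 else 0)) = 0"
    unfolding zero by (simp add: tendsto_const_iff)
  moreover have "w j j = (cmod (z j))\<^sup>2" for j
    unfolding w_def cmod_power2 by (simp add: power2_eq_square)
  ultimately have "(\<Sum>j<N. (cmod (z j))\<^sup>2) = 0"
    by (simp add: if_distrib[of "\<lambda>u. _ * u"] cong: if_cong)
  thus ?thesis by (subst (asm) sum_nonneg_eq_0_iff) auto
qed

text \<open>Up to the factor K the form is the integral of h times a nonnegative trigonometric
  polynomial q. Positivity of h is demanded on [0,1) only, since (1-t)_+^\<alpha> offers no more. If
  the form is 0, then q vanishes a.e. on the unit ball, and its integrals over smaller concentric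
  balls yield all moments of the squared distances.\<close>

lemma radial_positive_definite_Fourier:
  fixes h \<phi> :: "real \<Rightarrow> real"
  assumes [measurable]: "h \<in> borel_measurable borel" and h0: "\<And>r. r \<ge> 0 \<Longrightarrow> h r \<ge> 0"
    and h1: "\<And>r. 0 \<le> r \<Longrightarrow> r < 1 \<Longrightarrow> h r > 0" and K: "K > 0"
    and F: "\<And>x::real^'n. has_bochner_integral lborel (\<lambda>y::real^'n. h (norm y) * cos (x \<bullet> y)) (K * \<phi> (norm x))"
  shows "radial_positive_definite TYPE('n::finite) \<phi>"
  unfolding radial_positive_definite_def positive_definite_def
proof (intro allI impI)
  fix N and x :: "nat \<Rightarrow> real^'n" and z :: "nat \<Rightarrow> complex"
  assume x: "inj_on x {..<N}"
  define w where "w j k = Re (z j * cnj (z k))" for j k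
  define S where "S = (\<Sum>j<N. \<Sum>k<N. complex_of_real (\<phi> (norm (x j - x k))) * z j * cnj (z k))"
  define q where "q y = (\<Sum>j<N. \<Sum>k<N. w j k * cos ((x j - x k) \<bullet> y))" for y
  have q0: "q y \<ge> 0" for y
    unfolding q_def w_def inner_diff_left by (rule sum_Re_mult_cos_diff_nonneg)
  have [measurable]: "q \<in> borel_measurable borel" unfolding q_def by measurable
  \<comment> \<open>Exchanging j and k conjugates the sum because the kernel is real and symmetric;
    only the real parts \<open>w\<close> of the coefficient products contribute.\<close>
  have "cnj S = S"
  proof -
    have "cnj S = (\<Sum>j<N. \<Sum>k<N. complex_of_real (\<phi> (norm (x k - x j))) * z k * cnj (z j))"
      unfolding S_def cnj_sum by (simp add: norm_minus_commute mult_ac)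
    also have "\<dots> = S" unfolding S_def by (rule sum.swap)
    finally show ?thesis .
  qed
  hence "S \<in> \<real>" by (rule Reals_cnj_iff[THEN iffD2])
  hence S: "S = of_real (Re S)" by simp
  have ReS: "Re S = (\<Sum>j<N. \<Sum>k<N. w j k * \<phi> (norm (x j - x k)))"
    by (simp add: S_def w_def mult.assoc algebra_simps)
  have int: "has_bochner_integral lborel (\<lambda>y. h (norm y) * q y) (K * Re S)"
  proof -
    have "has_bochner_integral lborel (\<lambda>y. \<Sum>j<N. \<Sum>k<N. w j k * (h (norm y) * cos ((x j - x k) \<bullet> y)))
       (\<Sum>j<N. \<Sum>k<N. w j k * (K * \<phi> (norm (x j - x k))))"
      by (intro has_bochner_integral_sum has_bochner_integral_mult_right F)
    thus ?thesis by (simp add: q_def ReS sum_distrib_left mult_ac)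
  qed
  have nn: "h (norm y) * q y \<ge> 0" for y :: "real^'n" using h0 q0 by simp
  have "K * Re S \<ge> 0"
    using int Bochner_Integration.integral_nonneg[of lborel "\<lambda>y. h (norm y) * q y"] nn by (simp add: has_bochner_integral_iff)
  hence ReS0: "Re S \<ge> 0" using K by (simp add: zero_le_mult_iff)
  have "\<forall>j<N. z j = 0" if "S = 0"
  proof -
    have "(LINT y|lborel. h (norm y) * q y) = 0" "integrable lborel (\<lambda>y. h (norm y) * q y)"
      using int that by (auto simp: has_bochner_integral_iff)
    hence "AE y in lborel. h (norm y) * q y = 0"
      using nn by (subst integral_nonneg_eq_0_iff_AE[symmetric]) auto
    hence q1: "AE y in lborel. norm y < 1 \<longrightarrow> q y = 0"
    proof eventually_elim
      case (elim y)
      thus ?case using h1[of "norm y"] by auto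
    qed
    \<comment> \<open>Up to the factors V and R^d, the integral of q over the ball of radius R =
      sqrt t is a power series in t, and \<open>c m\<close> is its m-th coefficient.\<close>
    define c where "c m = \<Omega>_coeff (CARD('n) / 2) m * (\<Sum>j<N. \<Sum>k<N. w j k * ((norm (x j - x k))\<^sup>2) ^ m)" for m
    let ?V = "measure lborel (cball (0::real^'n) 1)"
    have V: "?V > 0" by (rule emeasure_cball_pos_finite)
    have \<nu>: "real CARD('n) / 2 > -1" by (rule less_le_trans[of _ 0]) auto
    have cs: "(\<lambda>m. c m * t ^ m) = (\<lambda>m. \<Sum>j<N. \<Sum>k<N. w j k * (\<Omega>_coeff (CARD('n) / 2) m * (t * (norm (x j - x k))\<^sup>2) ^ m))" for t
      by (simp add: fun_eq_iff c_def sum_distrib_left sum_distrib_right power_mult_distrib mult_ac)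
    have c0: "c m = 0" for m
    proof (rule power_series_coeffs_zero[of c 1])
      fix t :: real
      have "summable (\<lambda>m. \<Sum>j<N. \<Sum>k<N. \<bar>w j k\<bar> * norm (\<Omega>_coeff (CARD('n) / 2) m * (t * (norm (x j - x k))\<^sup>2) ^ m))"
        by (intro summable_sum summable_mult summable_\<Omega>_coeff \<nu>)
      thus "summable (\<lambda>m. norm (c m * t ^ m))"
      proof (rule summable_comparison_test')
        fix m
        show "norm (norm (c m * t ^ m)) \<le>
           (\<Sum>j<N. \<Sum>k<N. \<bar>w j k\<bar> * norm (\<Omega>_coeff (CARD('n) / 2) m * (t * (norm (x j - x k))\<^sup>2) ^ m))"
          unfolding fun_cong[OF cs] real_norm_def abs_idempotent abs_mult[of "w _ _", symmetric]
          by (intro order.trans[OF sum_abs] sum_mono order.refl)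
      qed
      assume t: "0 < t" "t < 1"
      let ?R = "sqrt t"
      have "has_bochner_integral lborel (\<lambda>y. \<Sum>j<N. \<Sum>k<N. w j k * (indicator (cball 0 ?R) y * cos ((x j - x k) \<bullet> y)))
         (\<Sum>j<N. \<Sum>k<N. w j k * (?V * (?R ^ CARD('n) * \<Omega> (CARD('n) / 2) (?R * norm (x j - x k)))))"
        using t has_bochner_integral_cball_cos[where 'a="real^'n", of ?R]
        by (intro has_bochner_integral_sum has_bochner_integral_mult_right) simp
      also have "(\<lambda>y. \<Sum>j<N. \<Sum>k<N. w j k * (indicator (cball 0 ?R) y * cos ((x j - x k) \<bullet> y))) =
         (\<lambda>y. indicator (cball 0 ?R) y * q y)"
        by (simp add: q_def sum_distrib_left mult_ac)
      finally have "(\<Sum>j<N. \<Sum>k<N. w j k * (?V * (?R ^ CARD('n) * \<Omega> (CARD('n) / 2) (?R * norm (x j - x k))))) =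
         (LINT y|lborel. indicator (cball 0 ?R) y * q y)"
        by (simp add: has_bochner_integral_iff)
      also have "\<dots> = (LINT y|(lborel::(real^'n) measure). 0)"
      proof (rule integral_cong_AE)
        show "AE y in lborel. indicator (cball 0 ?R) y * q y = 0"
          using q1
        proof eventually_elim
          case (elim y)
          have "norm y < 1" if "norm y \<le> ?R" using that t real_sqrt_lt_1_iff[of t] by linarith
          thus ?case using elim by (auto simp: indicator_def)
        qed
      qed measurable
      finally have "?V * ?R ^ CARD('n) * (\<Sum>j<N. \<Sum>k<N. w j k * \<Omega> (CARD('n) / 2) (?R * norm (x j - x k))) = 0"
        by (simp add: sum_distrib_left mult_ac)
      hence "(\<Sum>j<N. \<Sum>k<N. w j k * \<Omega> (CARD('n) / 2) (?R * norm (x j - x k))) = 0"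
        using V t by simp
      moreover have "(\<lambda>m. \<Sum>j<N. \<Sum>k<N. w j k * (\<Omega>_coeff (CARD('n) / 2) m * (t * (norm (x j - x k))\<^sup>2) ^ m)) sums
         (\<Sum>j<N. \<Sum>k<N. w j k * (\<Sum>m. \<Omega>_coeff (CARD('n) / 2) m * (t * (norm (x j - x k))\<^sup>2) ^ m))"
        by (intro sums_sum sums_mult summable_sums summable_norm_cancel[OF summable_\<Omega>_coeff] \<nu>)
      ultimately show "(\<Sum>m. c m * t ^ m) = 0"
        unfolding cs using t by (simp add: \<Omega>_eq_suminf[OF \<nu>] power_mult_distrib sums_iff)
    qed simp
    have "\<Omega>_coeff (CARD('n) / 2) m \<noteq> 0" for m
      using pochhammer_pos[of "real CARD('n) / 2 + 1" m] \<nu> by (simp add: \<Omega>_coeff_def)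
    hence "(\<Sum>j<N. \<Sum>k<N. w j k * ((norm (x j - x k))\<^sup>2) ^ m) = 0" for m
      using c0[of m] unfolding c_def mult_eq_0_iff by blast
    thus ?thesis using zero_if_distance_moments_vanish[OF x, of z] by (simp add: w_def)
  qed
  moreover have "S \<in> \<real>\<^sub>\<ge>\<^sub>0" using S ReS0 by (simp add: complex_nonneg_Reals_iff complex_eq_iff)
  ultimately show "(\<Sum>j<N. \<Sum>k<N. complex_of_real (\<phi> (norm (x j - x k))) * z j * cnj (z k)) \<in> \<real>\<^sub>\<ge>\<^sub>0 \<and>
     ((\<Sum>j<N. \<Sum>k<N. complex_of_real (\<phi> (norm (x j - x k))) * z j * cnj (z k)) = 0 \<longrightarrow> (\<forall>j<N. z j = 0))"
    unfolding S_def by blast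
qed

subsection \<open>Fourier inversion\<close>

lemma has_bochner_integral_affine:
  fixes f :: "'a::euclidean_space \<Rightarrow> real"
  assumes f: "has_bochner_integral lborel f I" and c: "c > 0"
  shows "has_bochner_integral lborel (\<lambda>y. f (t + c *\<^sub>R y)) (I / c ^ DIM('a))"
proof -
  have [measurable]: "f \<in> borel_measurable borel" using f by (auto simp: has_bochner_integral_iff)
  let ?D = "density (distr lborel borel (\<lambda>y::'a. t + c *\<^sub>R y)) (\<lambda>_. ennreal (\<bar>c\<bar> ^ DIM('a)))"
  have D: "lborel = ?D" using lborel_affine[of c t] c by simp
  have f': "integrable ?D f" "integral\<^sup>L ?D f = I"
    using f unfolding D[symmetric] by (auto simp: has_bochner_integral_iff)
  have 1: "integrable lborel (\<lambda>y. \<bar>c\<bar> ^ DIM('a) * f (t + c *\<^sub>R y))"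
    using f'(1) by (subst (asm) integrable_density, simp_all, subst (asm) integrable_distr_eq, simp_all)
  have "integral\<^sup>L ?D f = (LINT y|lborel. \<bar>c\<bar> ^ DIM('a) * f (t + c *\<^sub>R y))"
    by (subst integral_density, simp_all, subst integral_distr, simp_all)
  hence "has_bochner_integral lborel (\<lambda>y. c ^ DIM('a) * f (t + c *\<^sub>R y)) I"
    using 1 f'(2) c by (simp add: has_bochner_integral_iff)
  from has_bochner_integral_mult_right[OF this, of "1 / c ^ DIM('a)"] show ?thesis
    using c by simp
qed

text \<open>With C = pi^(d/2) the constant is (2 pi)^d. The damping factor exp(-|s \<xi>|^2) admits
  Fubini and turns the integral into Gaussian means of G around x and -x; as s tends to 0 both sides
  converge by domination, with |L| on one side and the bound M on the other.\<close>

lemma Fourier_inversion_cos: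
  fixes G L :: "'a::euclidean_space \<Rightarrow> real"
  defines "C \<equiv> measure lborel (cball (0::'a) 1) * Gamma (DIM('a) / 2 + 1)"
  assumes G: "continuous_on UNIV G" and M: "\<And>y. \<bar>G y\<bar> \<le> M" and Gi: "integrable lborel G"
    and even: "\<And>y. G (- y) = G y" and L: "integrable lborel L"
    and F: "\<And>\<xi>. has_bochner_integral lborel (\<lambda>y. G y * cos (\<xi> \<bullet> y)) (L \<xi>)"
  shows "has_bochner_integral lborel (\<lambda>\<xi>. L \<xi> * cos (x \<bullet> \<xi>)) (2 ^ DIM('a) * C\<^sup>2 * G x)"
proof -
  let ?d = "DIM('a)"
  have [measurable]: "G \<in> borel_measurable borel" "L \<in> borel_measurable borel"
    using G L by (auto intro: borel_measurable_continuous_onI)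
  define e where "e v = exp (- (norm (v::'a))\<^sup>2)" for v
  have [measurable]: "e \<in> borel_measurable borel" unfolding e_def by measurable
  have ei: "has_bochner_integral lborel e C"
    using has_bochner_integral_Gauss_cos[of "0::'a"] by (simp add: e_def[abs_def] C_def)
  have e0: "e v \<ge> 0" "e v \<le> 1" for v by (auto simp: e_def)
  \<comment> \<open>Scaling by s in \<xi> becomes scaling by 1/(2s) in v, which is the origin of the
    width 2s of the means below.\<close>
  have es: "has_bochner_integral lborel (\<lambda>\<xi>. e (s *\<^sub>R \<xi>) * cos (v \<bullet> \<xi>)) (C / s ^ ?d * e ((1 / (2 * s)) *\<^sub>R v))"
    if "s > 0" for s and v :: 'a
  proof -
    have "has_bochner_integral lborel (\<lambda>\<xi>. e (0 + s *\<^sub>R \<xi>) * cos (((1 / s) *\<^sub>R v) \<bullet> (0 + s *\<^sub>R \<xi>)))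
        (C * exp (- (norm ((1 / s) *\<^sub>R v))\<^sup>2 / 4) / s ^ ?d)"
      using has_bochner_integral_affine[OF has_bochner_integral_Gauss_cos[of "(1 / s) *\<^sub>R v"] that, of 0]
      by (simp add: e_def C_def)
    thus ?thesis using that by (simp add: e_def power_mult_distrib power_divide mult.commute)
  qed
  have Ge: "integrable lborel (\<lambda>w. G (y + c *\<^sub>R w) * e w)" for y c
  proof (rule Bochner_Integration.integrable_bound)
    show "integrable lborel (\<lambda>w. M * e w)" using ei by (auto simp: has_bochner_integral_iff)
    show "AE w in lborel. norm (G (y + c *\<^sub>R w) * e w) \<le> norm (M * e w)"
      using M e0 by (intro AE_I2) (simp add: abs_mult, intro mult_right_mono, auto intro: order_trans[OF M abs_ge_self])
  qed measurable
  have sub: "(LINT y|lborel. G y * e ((1 / (2 * s)) *\<^sub>R (y - x))) = (2 * s) ^ ?d * (LINT w|lborel. G (x + (2 * s) *\<^sub>R w) * e w)"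
      (is ?A) and subi: "integrable lborel (\<lambda>y. G y * e ((1 / (2 * s)) *\<^sub>R (y - x)))" (is ?B)
    if s: "s > 0" for s and x :: 'a
  proof -
    have h: "has_bochner_integral lborel (\<lambda>w. G (x + (2 * s) *\<^sub>R w) * e w) (LINT w|lborel. G (x + (2 * s) *\<^sub>R w) * e w)"
      by (rule has_bochner_integral_integrable[OF Ge])
    have "has_bochner_integral lborel
        (\<lambda>y. G (x + (2 * s) *\<^sub>R (- (1 / (2 * s)) *\<^sub>R x + (1 / (2 * s)) *\<^sub>R y)) * e (- (1 / (2 * s)) *\<^sub>R x + (1 / (2 * s)) *\<^sub>R y))
        ((LINT w|lborel. G (x + (2 * s) *\<^sub>R w) * e w) / (1 / (2 * s)) ^ ?d)"
      using has_bochner_integral_affine[OF h, of "1 / (2 * s)" "- (1 / (2 * s)) *\<^sub>R x"] s by simp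
    moreover have "x + (2 * s) *\<^sub>R (- (1 / (2 * s)) *\<^sub>R x + (1 / (2 * s)) *\<^sub>R y) = y" for y
      using s by (simp only: scaleR_add_right scaleR_scaleR) simp
    moreover have "- (1 / (2 * s)) *\<^sub>R x + (1 / (2 * s)) *\<^sub>R y = (1 / (2 * s)) *\<^sub>R (y - x)" for y
      by (simp add: scaleR_diff_right)
    ultimately have "has_bochner_integral lborel (\<lambda>y. G y * e ((1 / (2 * s)) *\<^sub>R (y - x)))
       ((LINT w|lborel. G (x + (2 * s) *\<^sub>R w) * e w) / (1 / (2 * s)) ^ ?d)"
      by (simp only:)
    thus ?A ?B using s by (auto simp: has_bochner_integral_iff power_divide mult.commute)
  qed
  \<comment> \<open>The product of the cosines of \<xi> \<bullet> y and x \<bullet> \<xi> is half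
    the sum of those with frequencies y - x and y + x. Hence one mean is taken around x and one
    around -x; evenness of G joins them in the limit.\<close>
  have reg: "(LINT \<xi>|lborel. L \<xi> * (e (s *\<^sub>R \<xi>) * cos (x \<bullet> \<xi>))) =
     2 ^ ?d * C * (1/2 * ((LINT w|lborel. G (x + (2 * s) *\<^sub>R w) * e w) + (LINT w|lborel. G (- x + (2 * s) *\<^sub>R w) * e w)))"
    if s: "s > 0" for s
  proof -
    have esi: "integrable lborel (\<lambda>\<xi>. e (s *\<^sub>R \<xi>))"
      using es[OF s, of 0] by (auto simp: has_bochner_integral_iff)
    let ?f = "\<lambda>\<xi> y. G y * cos (\<xi> \<bullet> y) * (e (s *\<^sub>R \<xi>) * cos (x \<bullet> \<xi>))"
    have prod: "integrable (lborel \<Otimes>\<^sub>M lborel) (\<lambda>(\<xi>, y). e (s *\<^sub>R \<xi>) * G y)"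
    proof (rule lborel_pair.Fubini_integrable)
      show "integrable lborel (\<lambda>\<xi>. LINT y|lborel. norm (case (\<xi>, y) of (\<xi>, y) \<Rightarrow> e (s *\<^sub>R \<xi>) * G y))"
        using esi e0 by (simp add: abs_mult)
      show "AE \<xi> in lborel. integrable lborel (\<lambda>y. case (\<xi>, y) of (\<xi>, y) \<Rightarrow> e (s *\<^sub>R \<xi>) * G y)"
        using Gi by simp
    qed measurable
    have int: "integrable (lborel \<Otimes>\<^sub>M lborel) (\<lambda>(\<xi>, y). ?f \<xi> y)"
    proof (rule Bochner_Integration.integrable_bound[OF prod])
      have "\<bar>?f \<xi> y\<bar> \<le> \<bar>e (s *\<^sub>R \<xi>) * G y\<bar>" for \<xi> y
      proof -
        have "\<bar>cos (\<xi> \<bullet> y)\<bar> * \<bar>cos (x \<bullet> \<xi>)\<bar> \<le> 1 * 1" by (intro mult_mono) auto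
        from mult_left_mono[OF this, of "\<bar>e (s *\<^sub>R \<xi>) * G y\<bar>"] show ?thesis
          by (simp add: abs_mult mult_ac)
      qed
      thus "AE p in lborel \<Otimes>\<^sub>M lborel. norm (case p of (\<xi>, y) \<Rightarrow> ?f \<xi> y) \<le> norm (case p of (\<xi>, y) \<Rightarrow> e (s *\<^sub>R \<xi>) * G y)"
        by (intro AE_I2) auto
    qed measurable
    have "(LINT \<xi>|lborel. L \<xi> * (e (s *\<^sub>R \<xi>) * cos (x \<bullet> \<xi>))) = (LINT \<xi>|lborel. LINT y|lborel. ?f \<xi> y)"
      using F by (simp add: has_bochner_integral_iff)
    also have "\<dots> = (LINT y|lborel. LINT \<xi>|lborel. ?f \<xi> y)"
      using lborel_pair.Fubini_integral[OF int] by simp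
    also have "(\<lambda>y. LINT \<xi>|lborel. ?f \<xi> y) = (\<lambda>y. C / s ^ ?d * (1/2 * (G y * e ((1 / (2 * s)) *\<^sub>R (y - x)) + G y * e ((1 / (2 * s)) *\<^sub>R (y - (- x))))))"
    proof (rule ext)
      fix y
      have "has_bochner_integral lborel (\<lambda>\<xi>. G y * (1/2 * (e (s *\<^sub>R \<xi>) * cos ((y - x) \<bullet> \<xi>) + e (s *\<^sub>R \<xi>) * cos ((y - (- x)) \<bullet> \<xi>))))
        (G y * (1/2 * (C / s ^ ?d * e ((1 / (2 * s)) *\<^sub>R (y - x)) + C / s ^ ?d * e ((1 / (2 * s)) *\<^sub>R (y - (- x))))))"
        by (intro has_bochner_integral_mult_right has_bochner_integral_add es s)
      moreover have "G y * (1/2 * (e (s *\<^sub>R \<xi>) * cos ((y - x) \<bullet> \<xi>) + e (s *\<^sub>R \<xi>) * cos ((y - (- x)) \<bullet> \<xi>))) = ?f \<xi> y" for \<xi>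
        by (simp add: inner_diff_left inner_add_left cos_diff cos_add algebra_simps inner_commute)
      ultimately have "has_bochner_integral lborel (\<lambda>\<xi>. ?f \<xi> y)
        (G y * (1/2 * (C / s ^ ?d * e ((1 / (2 * s)) *\<^sub>R (y - x)) + C / s ^ ?d * e ((1 / (2 * s)) *\<^sub>R (y - (- x))))))"
        by (simp only:)
      thus "(LINT \<xi>|lborel. ?f \<xi> y) = C / s ^ ?d * (1/2 * (G y * e ((1 / (2 * s)) *\<^sub>R (y - x)) + G y * e ((1 / (2 * s)) *\<^sub>R (y - (- x)))))"
        by (simp add: has_bochner_integral_iff algebra_simps)
    qed
    also have "(LINT y|lborel. C / s ^ ?d * (1/2 * (G y * e ((1 / (2 * s)) *\<^sub>R (y - x)) + G y * e ((1 / (2 * s)) *\<^sub>R (y - (- x)))))) =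
      C / s ^ ?d * (1/2 * ((LINT y|lborel. G y * e ((1 / (2 * s)) *\<^sub>R (y - x))) + (LINT y|lborel. G y * e ((1 / (2 * s)) *\<^sub>R (y - (- x))))))"
      using subi[OF s, of x] subi[OF s, of "- x"] by (simp only: integral_mult_right_zero Bochner_Integration.integral_add)
    also have "\<dots> = 2 ^ ?d * C * (1/2 * ((LINT w|lborel. G (x + (2 * s) *\<^sub>R w) * e w) + (LINT w|lborel. G (- x + (2 * s) *\<^sub>R w) * e w)))"
      unfolding sub[OF s] using s by (simp add: power_mult_distrib field_simps)
    finally show ?thesis .
  qed
  define s where "s n = 1 / real (Suc n)" for n
  have s0: "s n > 0" for n by (simp add: s_def)
  have slim: "s \<longlonglongrightarrow> 0" unfolding s_def by (rule lim_1_over_n[THEN LIMSEQ_Suc])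
  have limG: "(\<lambda>n. LINT w|lborel. G (x + (2 * s n) *\<^sub>R w) * e w) \<longlonglongrightarrow> C * G x" for x
  proof -
    have "(\<lambda>n. LINT w|lborel. G (x + (2 * s n) *\<^sub>R w) * e w) \<longlonglongrightarrow> (LINT w|lborel. G x * e w)"
    proof (rule integral_dominated_convergence)
      show "integrable lborel (\<lambda>w. M * e w)" using ei by (auto simp: has_bochner_integral_iff)
      show "AE w in lborel. norm (G (x + (2 * s n) *\<^sub>R w) * e w) \<le> M * e w" for n
        using M e0 by (intro AE_I2) (simp add: abs_mult, intro mult_right_mono, auto)
      show "AE w in lborel. (\<lambda>n. G (x + (2 * s n) *\<^sub>R w) * e w) \<longlonglongrightarrow> G x * e w"
      proof (rule AE_I2)
        fix w
        have "(\<lambda>n. x + (2 * s n) *\<^sub>R w) \<longlonglongrightarrow> x + (2 * 0) *\<^sub>R w"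
          by (intro tendsto_intros slim)
        hence l: "(\<lambda>n. x + (2 * s n) *\<^sub>R w) \<longlonglongrightarrow> x" by simp
        have c: "isCont G x" using G by (simp add: continuous_on_eq_continuous_at)
        show "(\<lambda>n. G (x + (2 * s n) *\<^sub>R w) * e w) \<longlonglongrightarrow> G x * e w"
          by (rule tendsto_mult[OF isCont_tendsto_compose[OF c l] tendsto_const])
      qed
    qed measurable
    thus ?thesis using ei by (simp add: has_bochner_integral_iff mult.commute)
  qed
  have "(\<lambda>n. LINT \<xi>|lborel. L \<xi> * (e (s n *\<^sub>R \<xi>) * cos (x \<bullet> \<xi>))) \<longlonglongrightarrow> (LINT \<xi>|lborel. L \<xi> * (1 * cos (x \<bullet> \<xi>)))"
  proof (rule integral_dominated_convergence)
    show "integrable lborel (\<lambda>\<xi>. \<bar>L \<xi>\<bar>)" using L by simp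
    show "AE \<xi> in lborel. norm (L \<xi> * (e (s n *\<^sub>R \<xi>) * cos (x \<bullet> \<xi>))) \<le> \<bar>L \<xi>\<bar>" for n
    proof (rule AE_I2)
      fix \<xi> :: 'a
      have "e (s n *\<^sub>R \<xi>) * \<bar>cos (x \<bullet> \<xi>)\<bar> \<le> 1 * 1" using e0 by (intro mult_mono) auto
      from mult_left_mono[OF this, of "\<bar>L \<xi>\<bar>"] show "norm (L \<xi> * (e (s n *\<^sub>R \<xi>) * cos (x \<bullet> \<xi>))) \<le> \<bar>L \<xi>\<bar>"
        using e0 by (simp add: abs_mult)
    qed
    show "AE \<xi> in lborel. (\<lambda>n. L \<xi> * (e (s n *\<^sub>R \<xi>) * cos (x \<bullet> \<xi>))) \<longlonglongrightarrow> L \<xi> * (1 * cos (x \<bullet> \<xi>))"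
    proof (rule AE_I2)
      fix \<xi> :: 'a
      have "(\<lambda>n. exp (- (norm (s n *\<^sub>R \<xi>))\<^sup>2)) \<longlonglongrightarrow> exp (- (norm (0 *\<^sub>R \<xi>))\<^sup>2)"
        by (intro tendsto_intros slim)
      hence "(\<lambda>n. e (s n *\<^sub>R \<xi>)) \<longlonglongrightarrow> 1" by (simp add: e_def)
      thus "(\<lambda>n. L \<xi> * (e (s n *\<^sub>R \<xi>) * cos (x \<bullet> \<xi>))) \<longlonglongrightarrow> L \<xi> * (1 * cos (x \<bullet> \<xi>))"
        by (intro tendsto_intros)
    qed
  qed measurable
  moreover have "(\<lambda>n. LINT \<xi>|lborel. L \<xi> * (e (s n *\<^sub>R \<xi>) * cos (x \<bullet> \<xi>))) \<longlonglongrightarrow> 2 ^ ?d * C * (1/2 * (C * G x + C * G (- x)))"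
    unfolding reg[OF s0] by (intro tendsto_intros limG)
  ultimately have "(LINT \<xi>|lborel. L \<xi> * (1 * cos (x \<bullet> \<xi>))) = 2 ^ ?d * C * (1/2 * (C * G x + C * G (- x)))"
    by (rule LIMSEQ_unique)
  moreover have "integrable lborel (\<lambda>\<xi>. L \<xi> * cos (x \<bullet> \<xi>))"
    by (rule Bochner_Integration.integrable_bound[OF L])
       (auto simp: abs_mult mult_left_le)
  ultimately show ?thesis by (simp add: even has_bochner_integral_iff power2_eq_square algebra_simps)
qed

subsection \<open>Positivity\<close>

lemma binomial_series_pochhammer:
  fixes A t :: real
  assumes "\<bar>t\<bar> < 1"
  shows "(\<lambda>n. pochhammer A n / fact n * t ^ n) sums ((1 - t) powr (- A))"
proof -
  have "(\<lambda>n. ((- A) gchoose n) * (- t) ^ n) sums ((1 + (- t)) powr (- A))"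
    by (rule gen_binomial_real) (use assms in simp)
  moreover have "((- A) gchoose n) * (- t) ^ n = pochhammer A n / fact n * t ^ n" for n
    by (simp add: gbinomial_pochhammer power_minus[of t] minus_one_power_iff)
  ultimately show ?thesis by simp
qed

text \<open>Euler's integral at argument 1: the binomial series of (1-t)^(-A) is integrated termwise
  against a Beta weight. With nonnegative terms monotone convergence suffices and yields summability
  as well. The case B = 0, where that weight is not integrable, is separate and arises below for a =
  1.\<close>

lemma Gauss_summation:
  fixes A B c :: real
  assumes "A > 0" "B \<ge> 0" "c > A + B"
  shows "(\<lambda>n. pochhammer A n * pochhammer B n / (fact n * pochhammer c n)) sums
           (Gamma c * Gamma (c - A - B) / (Gamma (c - A) * Gamma (c - B)))"
proof (cases "B = 0")
  case True
  have "(\<lambda>n. pochhammer A n * pochhammer B n / (fact n * pochhammer c n)) = (\<lambda>n. if n = 0 then 1 else 0)"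
    using True by (auto simp: fun_eq_iff pochhammer_0_left)
  moreover have "Gamma c > 0" "Gamma (c - A) > 0"
    using assms by (auto intro!: Gamma_real_pos)
  ultimately show ?thesis using True sums_single[of 0 "\<lambda>_. 1::real"] by simp
next
  case False
  hence B: "B > 0" using assms(2) by (simp add: less_le)
  define u where "u n = pochhammer A n * pochhammer B n / (fact n * pochhammer c n)" for n
  let ?b = "Beta B (c - B)"
  have c: "c > 0" "c - B > 0" "c - A - B > 0" "c - A > 0" using assms B by auto
  have G: "Gamma B > 0" "Gamma c > 0" "Gamma (c - B) > 0" "Gamma (c - A - B) > 0" "Gamma (c - A) > 0"
    using c B by (auto intro!: Gamma_real_pos)
  have b: "?b > 0" using G by (simp add: Beta_def)
  have u0: "u n \<ge> 0" for n using assms c B by (auto simp: u_def intro!: divide_nonneg_nonneg mult_nonneg_nonneg pochhammer_nonneg)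
  define w where "w t = indicator {0..1} t * (t powr (B - 1) * (1 - t) powr (c - B - 1))" for t :: real
  have w0: "w t \<ge> 0" for t by (auto simp: w_def indicator_def)
  have [measurable]: "w \<in> borel_measurable borel" unfolding w_def by measurable
  have tm: "(\<integral>\<^sup>+t. ennreal (pochhammer A n / fact n * ((indicator {0..1} t * t) ^ n * w t)) \<partial>lborel) = ennreal (?b * u n)" for n
  proof -
    have "has_bochner_integral lborel (\<lambda>t. pochhammer A n / fact n * ((indicator {0..1} t * t) ^ n * w t)) (?b * u n)"
      using has_bochner_integral_mult_right[OF has_bochner_integral_Beta_power[OF B c(2), of n], of "pochhammer A n / fact n"]
      by (simp add: w_def u_def mult_ac)
    thus ?thesis
      using assms(1) w0 by (subst nn_integral_eq_integral)
        (auto simp: has_bochner_integral_iff indicator_def intro!: mult_nonneg_nonneg divide_nonneg_nonneg pochhammer_nonneg)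
  qed
  have "(\<Sum>n. ennreal (?b * u n)) =
    (\<integral>\<^sup>+t. (\<Sum>n. ennreal (pochhammer A n / fact n * ((indicator {0..1} t * t) ^ n * w t))) \<partial>lborel)"
    unfolding tm[symmetric] by (rule nn_integral_suminf[symmetric]) measurable
  also have "\<dots> = (\<integral>\<^sup>+t. ennreal (indicator {0..1} t * (t powr (B - 1) * (1 - t) powr (c - A - B - 1))) \<partial>lborel)"
  proof (rule nn_integral_cong_AE, use AE_lborel_singleton[of "1::real"] in eventually_elim)
    fix t :: real assume t1: "t \<noteq> 1"
    show "(\<Sum>n. ennreal (pochhammer A n / fact n * ((indicator {0..1} t * t) ^ n * w t))) =
      ennreal (indicator {0..1} t * (t powr (B - 1) * (1 - t) powr (c - A - B - 1)))"
    proof (cases "t \<in> {0..1}")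
      case False
      thus ?thesis by (simp add: w_def)
    next
      case True
      have "(\<lambda>n. pochhammer A n / fact n * t ^ n * w t) sums ((1 - t) powr (- A) * w t)"
        using True t1 by (intro sums_mult2 binomial_series_pochhammer) auto
      hence "(\<Sum>n. ennreal (pochhammer A n / fact n * t ^ n * w t)) = ennreal ((1 - t) powr (- A) * w t)"
        using assms(1) w0 True
        by (intro suminf_ennreal_eq) (auto intro!: mult_nonneg_nonneg divide_nonneg_nonneg pochhammer_nonneg)
      moreover have "(1 - t) powr (- A) * (1 - t) powr (c - B - 1) = (1 - t) powr (c - A - B - 1)"
        by (simp flip: powr_add) (simp add: algebra_simps)
      ultimately show ?thesis using True by (simp add: w_def mult_ac)
    qed
  qed
  also have "\<dots> = ennreal (Beta B (c - A - B))"
    using has_bochner_integral_Beta[OF B c(3)]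
    by (subst nn_integral_eq_integral) (auto simp: has_bochner_integral_iff indicator_def)
  finally have E: "(\<Sum>n. ennreal (?b * u n)) = ennreal (Beta B (c - A - B))" .
  have nn: "0 \<le> ?b * u n" for n using b u0[of n] by simp
  have s: "summable (\<lambda>n. ?b * u n)"
    by (rule summable_suminf_not_top[OF nn]) (simp only: E ennreal_neq_top not_False_eq_True)
  have "(\<lambda>n. ?b * u n) sums Beta B (c - A - B)"
    using E suminf_ennreal2[OF nn s] s suminf_nonneg[OF s nn] G c by (simp add: sums_iff Beta_def)
  from sums_divide[OF this, of ?b] have "u sums (Beta B (c - A - B) / ?b)" using b by simp
  also have "Beta B (c - A - B) / ?b = Gamma c * Gamma (c - A - B) / (Gamma (c - A) * Gamma (c - B))"
    using G by (simp add: Beta_def)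
  finally show ?thesis by (simp add: u_def[abs_def])
qed

text \<open>With c = \<nu>+1, the reversals 1/(k-i)! = (-1)^i (-k)_i / k! and 1/(c)_{k-i} = (-1)^i
  (1-c-k)_i / (c)_k turn the convolution into a terminating 2F1 at 1, which the Chu-Vandermonde
  identity sums.\<close>

lemma sum_\<Omega>_coeff_product:
  assumes "\<nu> > -1/2"
  shows "(\<Sum>i\<le>k. \<Omega>_coeff \<nu> i * \<Omega>_coeff \<nu> (k - i)) =
    (-1) ^ k * pochhammer (\<nu> + 1/2) k / (fact k * pochhammer (\<nu> + 1) k * pochhammer (2 * \<nu> + 1) k)"
proof -
  define c where "c = \<nu> + 1"
  have c: "c > 1/2" using assms by (simp add: c_def)
  have pos: "pochhammer c i > 0" for i using c by (intro pochhammer_pos) simp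
  have t: "\<Omega>_coeff \<nu> i * \<Omega>_coeff \<nu> (k - i) =
     (-1/4) ^ k / (fact k * pochhammer c k) * (pochhammer (1 - c - k) i * pochhammer (- of_nat k) i / (of_nat (fact i) * pochhammer c i))"
    if i: "i \<le> k" for i
  proof -
    have sg: "(-1) ^ i * ((-1) ^ i * X) = X" for X :: real by (simp add: minus_one_power_iff)
    have r: "real k - real i = real (k - i)" using i by simp
    have f: "(fact k :: real) = fact (k - i) * ((-1) ^ i * pochhammer (- real k) i)"
      using pochhammer_product[of "k - i" k "1::real"] i
      unfolding pochhammer_fact pochhammer_minus sg r by (simp add: add.commute)
    have p: "pochhammer c k = pochhammer c (k - i) * ((-1) ^ i * pochhammer (1 - c - k) i)"
    proof -
      have n: "1 - c - real k = - (c + real k - 1)" "c + real k - 1 - real i + 1 = c + real (k - i)"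
        using i by auto
      show ?thesis
        using pochhammer_product[of "k - i" k c] i unfolding n(1) pochhammer_minus sg n(2) by simp
    qed
    have nz: "(-1) ^ i * pochhammer (- real k) i \<noteq> 0"
    proof
      assume "(-1) ^ i * pochhammer (- real k) i = 0"
      with f have "(fact k :: real) = 0" by (simp only: mult_zero_right)
      thus False by simp
    qed
    have nz': "(-1) ^ i * pochhammer (1 - c - k) i \<noteq> 0"
    proof
      assume "(-1) ^ i * pochhammer (1 - c - k) i = 0"
      with p have "pochhammer c k = 0" by (simp only: mult_zero_right)
      thus False using pos[of k] by simp
    qed
    have "1 / fact (k - i) = ((-1) ^ i * pochhammer (- real k) i) / fact k" unfolding f using nz by simp
    moreover have "1 / pochhammer c (k - i) = ((-1) ^ i * pochhammer (1 - c - k) i) / pochhammer c k" unfolding p using nz' by simp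
    ultimately have "1 / fact (k - i) * (1 / pochhammer c (k - i)) =
      pochhammer (- real k) i * pochhammer (1 - c - k) i / (fact k * pochhammer c k)"
      by simp
    moreover have "(- 1 / 4 :: real) ^ i * (- 1 / 4) ^ (k - i) = (- 1 / 4) ^ k"
      using i by (simp flip: power_add)
    moreover have "\<Omega>_coeff \<nu> i * \<Omega>_coeff \<nu> (k - i) = ((- 1 / 4 :: real) ^ i * (- 1 / 4) ^ (k - i)) *
       (1 / fact (k - i) * (1 / pochhammer c (k - i))) / (fact i * pochhammer c i)"
      by (simp add: \<Omega>_coeff_def c_def)
    ultimately show ?thesis by (simp add: mult_ac)
  qed
  have V: "(\<Sum>i=0..k. pochhammer (1 - c - k) i * pochhammer (- of_nat k) i / (of_nat (fact i) * pochhammer c i)) =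
      pochhammer (c - (1 - c - k)) k / pochhammer c k"
  proof (rule Vandermonde_pochhammer)
    show "\<forall>i\<in>{0..<k}. c \<noteq> - real i" using c by auto
  qed
  \<comment> \<open>c - (1-c-k) equals 2\<nu>+1+k, so the numerator of the Vandermonde sum is the
    upper half of (2\<nu>+1)_{2k}; duplication then rewrites the whole symbol.\<close>
  have d1: "pochhammer (2 * \<nu> + 1) (2 * k) = pochhammer (2 * \<nu> + 1) k * pochhammer (c - (1 - c - k)) k"
    using pochhammer_product'[of "2 * \<nu> + 1" k k] unfolding mult_2[of k] by (simp add: c_def algebra_simps)
  have d2: "pochhammer (2 * \<nu> + 1) (2 * k) = 4 ^ k * pochhammer (\<nu> + 1/2) k * pochhammer c k"
  proof -
    have "real (2 ^ (2 * k)) = 4 ^ k" "2 * (\<nu> + 1/2) = 2 * \<nu> + 1" "\<nu> + 1/2 + 1/2 = c"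
      by (simp_all add: power_mult c_def)
    thus ?thesis using pochhammer_double[of "\<nu> + 1/2" k] by (simp only:)
  qed
  have p2: "pochhammer (2 * \<nu> + 1) k > 0" using assms by (intro pochhammer_pos) simp
  have d3: "pochhammer (c - (1 - c - k)) k = 4 ^ k * pochhammer (\<nu> + 1/2) k * pochhammer c k / pochhammer (2 * \<nu> + 1) k"
    using d1 d2 p2 by (simp add: field_simps)
  have "(\<Sum>i\<le>k. \<Omega>_coeff \<nu> i * \<Omega>_coeff \<nu> (k - i)) =
     (-1/4) ^ k / (fact k * pochhammer c k) * (\<Sum>i=0..k. pochhammer (1 - c - k) i * pochhammer (- of_nat k) i / (of_nat (fact i) * pochhammer c i))"
    unfolding sum_distrib_left atMost_atLeast0 by (intro sum.cong t) auto
  also have "\<dots> = (-1/4) ^ k * 4 ^ k * pochhammer (\<nu> + 1/2) k / (fact k * pochhammer c k * pochhammer (2 * \<nu> + 1) k)"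
    unfolding V d3 using pos[of k] by simp
  also have "(-1/4) ^ k * 4 ^ k = (-1 :: real) ^ k" by (simp flip: power_mult_distrib)
  finally show ?thesis by (simp add: c_def)
qed

text \<open>Cauchy product of the series with itself, giving 1F2(\<nu>+1/2; \<nu>+1, 2\<nu>+1;
  -y^2). For \<nu> = a-1/2 and y = x/2 this is 1F2(a; a+1/2, 2a; -x^2/4), which shares its numerator
  parameter with \<Lambda>.\<close>

lemma \<Omega>_square:
  assumes "\<nu> > -1/2"
  shows "(\<Omega> \<nu> y)\<^sup>2 = (\<Sum>k. (-1) ^ k * pochhammer (\<nu> + 1/2) k /
           (fact k * pochhammer (\<nu> + 1) k * pochhammer (2 * \<nu> + 1) k) * (y\<^sup>2) ^ k)"
proof -
  have s: "summable (\<lambda>k. norm (\<Omega>_coeff \<nu> k * (y\<^sup>2) ^ k))" using assms by (intro summable_\<Omega>_coeff) simp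
  have "(\<Omega> \<nu> y)\<^sup>2 = (\<Sum>k. \<Omega>_coeff \<nu> k * (y\<^sup>2) ^ k) * (\<Sum>k. \<Omega>_coeff \<nu> k * (y\<^sup>2) ^ k)"
    using assms by (simp add: \<Omega>_eq_suminf power2_eq_square)
  also have "\<dots> = (\<Sum>k. \<Sum>i\<le>k. (\<Omega>_coeff \<nu> i * (y\<^sup>2) ^ i) * (\<Omega>_coeff \<nu> (k - i) * (y\<^sup>2) ^ (k - i)))"
    by (rule Cauchy_product[OF s s])
  also have "\<dots> = (\<Sum>k. (\<Sum>i\<le>k. \<Omega>_coeff \<nu> i * \<Omega>_coeff \<nu> (k - i)) * (y\<^sup>2) ^ k)"
  proof (intro arg_cong[of _ _ suminf] ext)
    fix k
    have "(y\<^sup>2) ^ i * (y\<^sup>2) ^ (k - i) = (y\<^sup>2) ^ k" if "i \<le> k" for i using that by (simp flip: power_add)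
    thus "(\<Sum>i\<le>k. (\<Omega>_coeff \<nu> i * (y\<^sup>2) ^ i) * (\<Omega>_coeff \<nu> (k - i) * (y\<^sup>2) ^ (k - i))) =
      (\<Sum>i\<le>k. \<Omega>_coeff \<nu> i * \<Omega>_coeff \<nu> (k - i)) * (y\<^sup>2) ^ k"
      unfolding sum_distrib_right by (intro sum.cong refl) (simp add: mult_ac)
  qed
  finally show ?thesis by (simp add: sum_\<Omega>_coeff_product[OF assms])
qed

section \<open>Comparison of \<Lambda> with squares of \<Omega>\<close>

text \<open>\<Lambda> with a and b in place of (d+1)/2 and d+\<alpha>+1, so that b can move while a
  stays fixed.\<close>

definition \<Lambda>_series :: "real \<Rightarrow> real \<Rightarrow> real \<Rightarrow> real" where
  "\<Lambda>_series a b r = (\<Sum>k. \<Lambda>_coeff a b k * (r\<^sup>2) ^ k)"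

text \<open>f may have zeros inside the interval. Strictness comes from a neighbourhood of 0, where
  f is positive by continuity: a vanishing integral would force f w to be 0 a.e. there.\<close>

lemma weighted_integral_pos:
  fixes f w :: "real \<Rightarrow> real"
  assumes I: "has_bochner_integral lborel (\<lambda>t. indicator {0..1} t * (f t * w t)) I"
    and f: "\<And>t. 0 \<le> t \<Longrightarrow> t \<le> 1 \<Longrightarrow> f t \<ge> 0" and f0: "isCont f 0" "f 0 > 0"
    and w: "\<And>t. w t \<ge> 0" "\<And>t. 0 < t \<Longrightarrow> t < 1 \<Longrightarrow> w t > 0"
  shows "I > 0"
proof (rule ccontr)
  assume "\<not> I > 0"
  have nn: "indicator {0..1} t * (f t * w t) \<ge> 0" for t using f w(1) by (simp add: indicator_def)
  have "I \<ge> 0" using I nn by (metis (no_types, lifting) Bochner_Integration.integral_nonneg has_bochner_integral_iff)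
  hence "(LINT t|lborel. indicator {0..1} t * (f t * w t)) = 0" "integrable lborel (\<lambda>t. indicator {0..1} t * (f t * w t))"
    using I \<open>\<not> I > 0\<close> by (auto simp: has_bochner_integral_iff)
  hence ae: "AE t in lborel. indicator {0..1} t * (f t * w t) = 0"
    using nn by (subst integral_nonneg_eq_0_iff_AE[symmetric]) auto
  have "\<forall>\<^sub>F t in at 0. f t > 0"
    using order_tendstoD(1)[OF f0(1)[unfolded isCont_def] f0(2)] .
  then obtain \<delta> where \<delta>: "\<delta> > 0" "\<And>t. t \<noteq> 0 \<Longrightarrow> dist t 0 < \<delta> \<Longrightarrow> f t > 0"
    unfolding eventually_at by auto
  define m where "m = min \<delta> 1"
  have "AE t in lborel. t \<notin> {0<..<m}"
    using ae
  proof eventually_elim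
    case (elim t)
    show ?case
    proof
      assume t: "t \<in> {0<..<m}"
      hence "f t > 0" "w t > 0" using \<delta>(2)[of t] w(2)[of t] by (auto simp: m_def)
      thus False using elim t by (auto simp: m_def)
    qed
  qed
  hence "{0<..<m} \<in> null_sets lborel"
    by (simp add: AE_iff_null_sets)
  hence "emeasure lborel {0<..<m} = 0" by auto
  thus False using \<delta>(1) by (simp add: m_def)
qed

lemma isCont_\<Lambda>_series:
  assumes "a > 0" "b \<ge> 2 * a" "b \<ge> 1"
  shows "isCont (\<Lambda>_series a b) r"
proof -
  have c: "isCont (\<lambda>z. \<Sum>k. \<Lambda>_coeff a b k * z ^ k) z" for z
    by (rule isCont_powser_converges_everywhere[OF summable_norm_cancel[OF summable_\<Lambda>_coeff[OF assms]]])
  have "isCont (\<lambda>r. (\<lambda>z. \<Sum>k. \<Lambda>_coeff a b k * z ^ k) (r\<^sup>2)) r"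
    by (rule isCont_o2[OF _ c]) (intro continuous_intros)
  thus ?thesis by (simp add: \<Lambda>_series_def[abs_def])
qed

lemma \<Lambda>_series_0: "\<Lambda>_series a b 0 = 1"
  by (simp add: \<Lambda>_series_def powser_zero) (simp add: \<Lambda>_coeff_def)

text \<open>Gasper's sum-of-squares argument: Gauss's summation of \<open>2F1 (a/2, (a-1)/2; 2a+k; 1)\<close> replaces the denominator parameters \<open>3a/2, (3a+1)/2\<close>
  by \<open>a+1/2, 2a\<close>, for which the series is the square of \<open>\<Omega> (a-1/2) (x/2)\<close>.\<close>
lemma \<Lambda>_series_3a_expansion:
  fixes a x :: real
  assumes a: "a \<ge> 1"
  defines "jc \<equiv> \<lambda>k. (-1/4) ^ k * pochhammer a k / (fact k * pochhammer (a + 1/2) k * pochhammer (2 * a) k)"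
    and "K \<equiv> Gamma (2 * a) * Gamma (a + 1/2) / (Gamma (3 * a / 2) * Gamma (3 * a / 2 + 1/2))"
    and "W \<equiv> \<lambda>n. pochhammer (a / 2) n * pochhammer ((a - 1) / 2) n / fact n"
  shows "(\<lambda>n. W n * (\<Sum>k. jc k / pochhammer (2 * a + real k) n * (x\<^sup>2) ^ k)) sums (K * \<Lambda>_series a (3 * a) x)"
    and "\<And>z. summable (\<lambda>k. norm (jc k * z ^ k))"
    and "\<And>z. z \<ge> 0 \<Longrightarrow> (\<Sum>k. jc k * z ^ k) \<ge> 0"
proof -
  have p1: "pochhammer (2 * a + real k) n > 0" for k n
    using a by (intro pochhammer_pos) auto
  have p: "pochhammer (a + 1/2) k > 0" "pochhammer (2 * a) k > 0" "pochhammer a k > 0"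
      "pochhammer (3 * a) k > 0" for k
    using a by (auto intro!: pochhammer_pos)
  show sj: "summable (\<lambda>k. norm (jc k * z ^ k))" for z
  proof (rule summable_bounded_by_exp[of _ 1])
    fix k
    have "pochhammer a k \<le> pochhammer (a + 1/2) k"
      unfolding pochhammer_prod using a by (intro prod_mono) auto
    moreover have "1 \<le> pochhammer (2 * a) k"
      unfolding pochhammer_prod using a by (intro prod_ge_1) auto
    ultimately have "1 * pochhammer a k * 1 \<le> 4 ^ k * pochhammer (a + 1/2) k * pochhammer (2 * a) k"
      using a p by (intro mult_mono) (auto intro!: mult_nonneg_nonneg pochhammer_nonneg)
    thus "\<bar>jc k\<bar> \<le> 1 / fact k"
      using p[of k] by (simp add: jc_def abs_mult power_abs field_simps)
  qed
  show "(\<Sum>k. jc k * z ^ k) \<ge> 0" if "z \<ge> 0" for z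
  proof -
    have "(\<Omega> (a - 1/2) (sqrt z / 2))\<^sup>2 = (\<Sum>k. jc k * z ^ k)"
    proof (subst \<Omega>_square)
      show "(\<Sum>k. (-1) ^ k * pochhammer (a - 1/2 + 1/2) k / (fact k * pochhammer (a - 1/2 + 1) k * pochhammer (2 * (a - 1/2) + 1) k) * ((sqrt z / 2)\<^sup>2) ^ k)
        = (\<Sum>k. jc k * z ^ k)"
        using that by (intro arg_cong[of _ _ suminf] ext)
          (simp add: jc_def power_divide power_minus[of "1/4"] algebra_simps)
    qed (use a in simp)
    thus ?thesis by (metis zero_le_power2)
  qed
  have W0: "W n \<ge> 0" for n
    unfolding W_def pochhammer_prod
    using a by (intro divide_nonneg_nonneg mult_nonneg_nonneg prod_nonneg) auto
  define f where "f k n = jc k * (x\<^sup>2) ^ k * (W n / pochhammer (2 * a + real k) n)" for k n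
  \<comment> \<open>Gauss summation with A = a/2, B = (a-1)/2 and c = 2a+k: here c-A, c-B and c-A-B
    are 3a/2+k, 3a/2+1/2+k and a+1/2+k. The dependence on k is thus exactly the exchange of lower
    parameters, and \<open>K\<close> is the value at k = 0.\<close>
  have Gs: "(\<lambda>n. W n / pochhammer (2 * a + real k) n) sums
     (K * (pochhammer (2 * a) k * pochhammer (a + 1/2) k / (pochhammer (3 * a / 2) k * pochhammer (3 * a / 2 + 1/2) k)))" for k
  proof -
    have "Gamma (2 * a + real k) * Gamma (2 * a + real k - a / 2 - (a - 1) / 2) /
        (Gamma (2 * a + real k - a / 2) * Gamma (2 * a + real k - (a - 1) / 2)) =
      Gamma (2 * a + real k) * Gamma (a + 1/2 + real k) / (Gamma (3 * a / 2 + real k) * Gamma (3 * a / 2 + 1/2 + real k))"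
      by (intro arg_cong2[of _ _ _ _ "(/)"] arg_cong2[of _ _ _ _ "(*)"] arg_cong[of _ _ Gamma]) (simp_all add: field_simps)
    also have "\<dots> = K * (pochhammer (2 * a) k * pochhammer (a + 1/2) k / (pochhammer (3 * a / 2) k * pochhammer (3 * a / 2 + 1/2) k))"
      using a by (subst (1 2 3 4) Gamma_add_nat) (auto simp: K_def mult_ac)
    finally have e: "Gamma (2 * a + real k) * Gamma (2 * a + real k - a / 2 - (a - 1) / 2) /
        (Gamma (2 * a + real k - a / 2) * Gamma (2 * a + real k - (a - 1) / 2)) =
      K * (pochhammer (2 * a) k * pochhammer (a + 1/2) k / (pochhammer (3 * a / 2) k * pochhammer (3 * a / 2 + 1/2) k))" .
    have "(\<lambda>n. W n / pochhammer (2 * a + real k) n) =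
       (\<lambda>n. pochhammer (a / 2) n * pochhammer ((a - 1) / 2) n / (fact n * pochhammer (2 * a + real k) n))"
      by (simp add: W_def fun_eq_iff)
    moreover have "(\<lambda>n. pochhammer (a / 2) n * pochhammer ((a - 1) / 2) n / (fact n * pochhammer (2 * a + real k) n)) sums
      (Gamma (2 * a + real k) * Gamma (2 * a + real k - a / 2 - (a - 1) / 2) /
        (Gamma (2 * a + real k - a / 2) * Gamma (2 * a + real k - (a - 1) / 2)))"
      using a by (intro Gauss_summation) (auto simp: field_simps)
    ultimately show ?thesis by (simp only: e)
  qed
  have Gf: "f k sums (K * (\<Lambda>_coeff a (3 * a) k * (x\<^sup>2) ^ k))" for k
  proof -
    have "pochhammer (3 * a) (2 * k) = 4 ^ k * pochhammer (3 * a / 2) k * pochhammer (3 * a / 2 + 1/2) k"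
      using pochhammer_double[of "3 * a / 2" k] by (simp add: power_mult)
    hence e: "jc k * (pochhammer (2 * a) k * pochhammer (a + 1/2) k / (pochhammer (3 * a / 2) k * pochhammer (3 * a / 2 + 1/2) k)) = \<Lambda>_coeff a (3 * a) k"
      using p[of k] by (simp add: jc_def \<Lambda>_coeff_def power_divide power_minus[of "1/4"])
    have "f k sums (jc k * (x\<^sup>2) ^ k * (K * (pochhammer (2 * a) k * pochhammer (a + 1/2) k / (pochhammer (3 * a / 2) k * pochhammer (3 * a / 2 + 1/2) k))))"
      unfolding f_def by (intro sums_mult Gs)
    thus ?thesis unfolding e[symmetric] by (simp add: mult_ac)
  qed
  have nf: "norm (f k n) = norm (jc k * (x\<^sup>2) ^ k) * (W n / pochhammer (2 * a + real k) n)" for k n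
    using W0[of n] p1[of k n] by (simp add: f_def abs_mult)
  \<comment> \<open>The symbol (2a+k)_n is smallest at k = 0. Hence the double series is dominated
    by a convergent series in k times one in n, and the two summations may be exchanged.\<close>
  have Wle: "W n / pochhammer (2 * a + real k) n \<le> W n / pochhammer (2 * a) n" for k n
  proof (rule divide_left_mono)
    show "pochhammer (2 * a) n \<le> pochhammer (2 * a + real k) n"
      unfolding pochhammer_prod using a by (intro prod_mono) auto
  qed (use W0 p p1 in \<open>auto intro: mult_pos_pos\<close>)
  have fle: "norm (f k n) \<le> norm (jc k * (x\<^sup>2) ^ k) * (W n / pochhammer (2 * a) n)" for k n
    unfolding nf by (intro mult_left_mono Wle) auto
  have sW: "summable (\<lambda>n. W n / pochhammer (2 * a + real k) n)" for k using Gs[of k] by (simp add: sums_iff)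
  have sn: "summable (\<lambda>n. norm (f k n))" for k unfolding nf by (intro summable_mult sW)
  have i1: "integrable (count_space UNIV) (f k)" for k
    unfolding integrable_count_space_nat_iff by (rule sn)
  have i1': "(\<integral>n. f k n \<partial>count_space UNIV) = K * (\<Lambda>_coeff a (3 * a) k * (x\<^sup>2) ^ k)" for k
    using sums_integral_count_space_nat[OF i1[of k]] Gf[of k] sums_unique2 by blast
  have sk: "summable (\<lambda>k. norm (f k n))" for n
  proof (rule summable_comparison_test'[OF summable_mult2[OF sj[of "x\<^sup>2"], of "W n / pochhammer (2 * a) n"]])
    fix k
    from fle[of k n] show "norm (norm (f k n)) \<le> norm (jc k * (x\<^sup>2) ^ k) * (W n / pochhammer (2 * a) n)" by simp
  qed
  have s2: "summable (\<lambda>k. \<integral>n. norm (f k n) \<partial>count_space UNIV)"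
  proof (rule summable_comparison_test'[OF summable_mult2[OF sj[of "x\<^sup>2"], of "\<Sum>n. W n / pochhammer (2 * a) n"]])
    fix k
    have i: "integrable (count_space UNIV) (\<lambda>n. norm (f k n))" using i1 by simp
    have "(\<integral>n. norm (f k n) \<partial>count_space UNIV) = (\<Sum>n. norm (f k n))"
      using sums_integral_count_space_nat[OF i] by (simp add: sums_iff)
    also have "\<dots> \<le> (\<Sum>n. norm (jc k * (x\<^sup>2) ^ k) * (W n / pochhammer (2 * a) n))"
      using sW[of 0] by (intro suminf_le sn summable_mult fle) simp
    also have "\<dots> = norm (jc k * (x\<^sup>2) ^ k) * (\<Sum>n. W n / pochhammer (2 * a) n)"
      using sW[of 0] by (intro suminf_mult) simp
    finally show "norm (\<integral>n. norm (f k n) \<partial>count_space UNIV) \<le> norm (jc k * (x\<^sup>2) ^ k) * (\<Sum>n. W n / pochhammer (2 * a) n)"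
      by simp
  qed
  have ae: "AE n in count_space UNIV. summable (\<lambda>k. norm (f k n))" using sk by (intro AE_I2)
  have "integrable (count_space UNIV) (\<lambda>n. \<Sum>k. f k n)" by (rule integrable_suminf[OF i1 ae s2])
  from sums_integral_count_space_nat[OF this]
  have "(\<lambda>n. \<Sum>k. f k n) sums (\<Sum>k. K * (\<Lambda>_coeff a (3 * a) k * (x\<^sup>2) ^ k))"
    unfolding integral_suminf[OF i1 ae s2] i1' .
  also have "(\<Sum>k. K * (\<Lambda>_coeff a (3 * a) k * (x\<^sup>2) ^ k)) = K * \<Lambda>_series a (3 * a) x"
    unfolding \<Lambda>_series_def using a
    by (intro suminf_mult summable_norm_cancel[OF summable_\<Lambda>_coeff]) auto
  also have "(\<lambda>n. \<Sum>k. f k n) = (\<lambda>n. W n * (\<Sum>k. jc k / pochhammer (2 * a + real k) n * (x\<^sup>2) ^ k))"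
  proof (rule ext)
    fix n
    have "summable (\<lambda>k. jc k / pochhammer (2 * a + real k) n * (x\<^sup>2) ^ k)"
    proof (rule summable_comparison_test'[OF summable_mult2[OF sj[of "x\<^sup>2"], of "1 / pochhammer (2 * a) n"]])
      fix k
      have "1 / pochhammer (2 * a + real k) n \<le> 1 / pochhammer (2 * a) n"
      proof (rule divide_left_mono)
        show "pochhammer (2 * a) n \<le> pochhammer (2 * a + real k) n"
          unfolding pochhammer_prod using a by (intro prod_mono) auto
      qed (use p p1 in \<open>auto intro: mult_pos_pos\<close>)
      from mult_left_mono[OF this, of "norm (jc k * (x\<^sup>2) ^ k)"]
      show "norm (jc k / pochhammer (2 * a + real k) n * (x\<^sup>2) ^ k) \<le> norm (jc k * (x\<^sup>2) ^ k) * (1 / pochhammer (2 * a) n)"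
        using p1[of k n] by (simp add: abs_mult)
    qed
    from suminf_mult[OF this, of "W n"]
    show "(\<Sum>k. f k n) = W n * (\<Sum>k. jc k / pochhammer (2 * a + real k) n * (x\<^sup>2) ^ k)"
      by (simp add: f_def mult_ac)
  qed
  finally show "(\<lambda>n. W n * (\<Sum>k. jc k / pochhammer (2 * a + real k) n * (x\<^sup>2) ^ k)) sums (K * \<Lambda>_series a (3 * a) x)" .
qed

text \<open>1/(2a+k)_n equals Beta(2a+k, n) / Gamma(n). So for n > 0 the term \<open>T n\<close> is
  a positive multiple of a Beta average of the square \<open>J\<close>, and it is strictly positive
  because \<open>J 0 = 1\<close>, whereas \<open>T 0\<close> is the square itself and may vanish.
  Strictness is decided by \<open>W 1\<close> = a(a-1)/4.\<close>

lemma \<Lambda>_series_3a_nonneg: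
  assumes a: "a \<ge> 1"
  shows "\<Lambda>_series a (3 * a) x \<ge> 0" and "a > 1 \<Longrightarrow> \<Lambda>_series a (3 * a) x > 0"
proof -
  define jc where "jc k = (-1/4) ^ k * pochhammer a k / (fact k * pochhammer (a + 1/2) k * pochhammer (2 * a) k)" for k
  define K where "K = Gamma (2 * a) * Gamma (a + 1/2) / (Gamma (3 * a / 2) * Gamma (3 * a / 2 + 1/2))"
  define W where "W n = pochhammer (a / 2) n * pochhammer ((a - 1) / 2) n / fact n" for n
  define T where "T n = (\<Sum>k. jc k / pochhammer (2 * a + real k) n * (x\<^sup>2) ^ k)" for n
  have S: "(\<lambda>n. W n * T n) sums (K * \<Lambda>_series a (3 * a) x)"
    unfolding jc_def K_def W_def T_def by (rule \<Lambda>_series_3a_expansion(1)[OF a])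
  have sj: "summable (\<lambda>k. norm (jc k * z ^ k))" for z
    unfolding jc_def by (rule \<Lambda>_series_3a_expansion(2)[OF a])
  have j0: "(\<Sum>k. jc k * z ^ k) \<ge> 0" if "z \<ge> 0" for z
    unfolding jc_def by (rule \<Lambda>_series_3a_expansion(3)[OF a that])
  have K: "K > 0" unfolding K_def using a
    by (intro divide_pos_pos mult_pos_pos Gamma_real_pos) auto
  have W0: "W n \<ge> 0" for n
    unfolding W_def pochhammer_prod
    using a by (intro divide_nonneg_nonneg mult_nonneg_nonneg prod_nonneg) auto
  have T0: "T 0 \<ge> 0" using j0[of "x\<^sup>2"] by (simp add: T_def)
  define J where "J z = (\<Sum>k. jc k * z ^ k)" for z
  have T: "has_bochner_integral lborel
      (\<lambda>t. indicator {0..1} t * (J (x\<^sup>2 * t) * (t powr (2 * a - 1) * (1 - t) powr (real n - 1)))) (Gamma n * T n)"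
    if n: "n > 0" for n
  proof -
    let ?w = "\<lambda>t. indicator {0..1} t * (t powr (2 * a - 1) * (1 - t) powr (real n - 1))"
    have pq: "2 * a > 0" "real n > 0" using a n by auto
    have "has_bochner_integral lborel (\<lambda>t. (\<Sum>k. jc k * (x\<^sup>2 * (indicator {0..1} t * t)) ^ k) * ?w t)
       (\<Sum>k. jc k * (x\<^sup>2) ^ k * (LINT t|lborel. (indicator {0..1} t * t) ^ k * ?w t))"
      using has_bochner_integral_Beta[OF pq]
      by (intro has_bochner_integral_power_series sj) (auto simp: indicator_def has_bochner_integral_iff)
    moreover have "(\<Sum>k. jc k * (x\<^sup>2) ^ k * (LINT t|lborel. (indicator {0..1} t * t) ^ k * ?w t)) = Gamma n * T n"
    proof -
      have "(LINT t|lborel. (indicator {0..1} t * t) ^ k * ?w t) = Gamma n / pochhammer (2 * a + real k) n" for k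
      proof -
        have "(LINT t|lborel. (indicator {0..1} t * t) ^ k * ?w t) = Beta (2 * a + real k) n"
          using has_bochner_integral_Beta_power[OF pq, of k] Beta_add_nat[OF pq, of k]
          by (simp add: has_bochner_integral_iff)
        also have "\<dots> = Gamma n / pochhammer (2 * a + real k) n"
        proof -
          have "Gamma (2 * a + real k) > 0" using a by (intro Gamma_real_pos) simp
          hence "Gamma (2 * a + real k) \<noteq> 0" by linarith
          moreover have "Gamma (2 * a + real k + real n) = Gamma (2 * a + real k) * pochhammer (2 * a + real k) n"
            using a by (intro Gamma_add_nat) simp
          ultimately show ?thesis
            unfolding Beta_def by (simp only: mult_divide_mult_cancel_left not_False_eq_True)
        qed
        finally show ?thesis .
      qed
      moreover have "summable (\<lambda>k. jc k / pochhammer (2 * a + real k) n * (x\<^sup>2) ^ k)"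
      proof (rule summable_comparison_test'[OF sj[of "x\<^sup>2"]])
        fix k
        have "1 \<le> pochhammer (2 * a + real k) n"
          unfolding pochhammer_prod using a by (intro prod_ge_1) auto
        hence "norm (jc k * (x\<^sup>2) ^ k) / pochhammer (2 * a + real k) n \<le> norm (jc k * (x\<^sup>2) ^ k) / 1"
          by (intro divide_left_mono) auto
        thus "norm (jc k / pochhammer (2 * a + real k) n * (x\<^sup>2) ^ k) \<le> norm (jc k * (x\<^sup>2) ^ k)"
          using \<open>1 \<le> pochhammer (2 * a + real k) n\<close> by (simp add: abs_mult)
      qed
      ultimately show ?thesis unfolding T_def by (subst suminf_mult[symmetric]) (simp_all add: mult_ac)
    qed
    moreover have "(\<lambda>t. (\<Sum>k. jc k * (x\<^sup>2 * (indicator {0..1} t * t)) ^ k) * ?w t) =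
      (\<lambda>t. indicator {0..1} t * (J (x\<^sup>2 * t) * (t powr (2 * a - 1) * (1 - t) powr (real n - 1))))"
      by (auto simp: fun_eq_iff indicator_def J_def)
    ultimately show ?thesis by (simp only:)
  qed
  have cJ: "isCont (\<lambda>t. J (x\<^sup>2 * t)) 0"
  proof -
    have "isCont J z" for z
      unfolding J_def by (rule isCont_powser_converges_everywhere[OF summable_norm_cancel[OF sj]])
    thus ?thesis by (intro isCont_o2[where g=J and f="\<lambda>t. x\<^sup>2 * t"]) (auto intro: continuous_intros)
  qed
  have J00: "J 0 = 1" unfolding J_def powser_zero by (simp add: jc_def)
  have Tpos: "T n > 0" if n: "n > 0" for n
  proof -
    have "Gamma n * T n > 0"
      by (rule weighted_integral_pos[OF T[OF n] _ cJ]) (use j0 J00 in \<open>auto simp: J_def\<close>)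
    moreover have "Gamma (real n) > 0" using n by (intro Gamma_real_pos) simp
    ultimately show ?thesis by (simp add: zero_less_mult_iff)
  qed
  have nn: "W n * T n \<ge> 0" for n
    using W0[of n] T0 Tpos[of n] by (cases "n = 0") auto
  have eq: "K * \<Lambda>_series a (3 * a) x = (\<Sum>n. W n * T n)" "summable (\<lambda>n. W n * T n)" using S by (auto simp: sums_iff)
  have "K * \<Lambda>_series a (3 * a) x \<ge> 0" unfolding eq(1) by (rule suminf_nonneg[OF eq(2) nn])
  thus "\<Lambda>_series a (3 * a) x \<ge> 0" using K by (simp add: zero_le_mult_iff)
  assume a1: "a > 1"
  have "W 1 > 0" using a1 by (simp add: W_def)
  hence "W 1 * T 1 > 0" using Tpos[of 1] by simp
  hence "K * \<Lambda>_series a (3 * a) x > 0" unfolding eq(1) by (rule suminf_pos2[OF eq(2) nn])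
  thus "\<Lambda>_series a (3 * a) x > 0" using K by (simp add: zero_less_mult_iff)
qed

lemma \<Lambda>_series_mixture:
  assumes "a > 0" "b \<ge> 2 * a" "b \<ge> 1" "q > 0"
  shows "has_bochner_integral lborel
     (\<lambda>t. indicator {0..1} t * (\<Lambda>_series a b (r * t) * (t powr (b - 1) * (1 - t) powr (q - 1))))
     (Beta b q * \<Lambda>_series a (b + q) r)"
  unfolding \<Lambda>_series_def
proof (rule Beta_mixture)
  have p: "pochhammer b k > 0" for k using assms by (intro pochhammer_pos) auto
  show "\<Lambda>_coeff a (b + q) k = \<Lambda>_coeff a b k * pochhammer b (2 * k) / pochhammer (b + q) (2 * k)" for k
    using p[of "2 * k"] by (simp add: \<Lambda>_coeff_def)
qed (use assms in \<open>auto intro: summable_\<Lambda>_coeff[unfolded real_norm_def]\<close>)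

text \<open>Raising b above 3a averages a nonnegative function with value 1 at 0, so the result is
  strictly positive even where the function for b = 3a has zeros.\<close>

lemma \<Lambda>_series_pos:
  assumes a: "a \<ge> 1" and b: "b > 3 * a \<or> (b = 3 * a \<and> a > 1)"
  shows "\<Lambda>_series a b x > 0"
proof (cases "b = 3 * a")
  case False
  define q where "q = b - 3 * a"
  have q: "q > 0" using b False by (auto simp: q_def)
  have "has_bochner_integral lborel
     (\<lambda>t. indicator {0..1} t * (\<Lambda>_series a (3 * a) (x * t) * (t powr (3 * a - 1) * (1 - t) powr (q - 1))))
     (Beta (3 * a) q * \<Lambda>_series a (3 * a + q) x)"
    using a q by (intro \<Lambda>_series_mixture) auto
  hence "Beta (3 * a) q * \<Lambda>_series a (3 * a + q) x > 0"
  proof (rule weighted_integral_pos)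
    show "isCont (\<lambda>t. \<Lambda>_series a (3 * a) (x * t)) 0"
      using a by (intro isCont_o2[where g="\<Lambda>_series a (3 * a)" and f="\<lambda>t. x * t"] isCont_\<Lambda>_series)
        (auto intro: continuous_intros)
  qed (auto simp: \<Lambda>_series_0 \<Lambda>_series_3a_nonneg[OF a])
  moreover have "Beta (3 * a) q > 0"
    unfolding Beta_def using a q by (intro divide_pos_pos mult_pos_pos Gamma_real_pos) auto
  ultimately show ?thesis by (simp add: q_def zero_less_mult_iff)
qed (use b \<Lambda>_series_3a_nonneg[OF a] in auto)

lemma \<Lambda>_eq_series: "\<Lambda> d \<alpha> = \<Lambda>_series ((real d + 1) / 2) (real d + \<alpha> + 1)"
  by (simp add: fun_eq_iff \<Lambda>_eq_suminf \<Lambda>_series_def)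

lemma \<Lambda>_pos:
  assumes "d > 0" "d \<ge> 2 \<Longrightarrow> \<alpha> \<ge> (real d + 1) / 2" "d = 1 \<Longrightarrow> \<alpha> \<ge> 2"
  shows "\<Lambda> d \<alpha> r > 0"
  unfolding \<Lambda>_eq_series
proof (rule \<Lambda>_series_pos)
  show "1 \<le> (real d + 1) / 2" using assms by simp
  \<comment> \<open>For d \<ge> 2 one has a > 1, and equality b = 3a is allowed; for d = 1 one has a
    = 1 and b = \<alpha>+2 \<ge> 4 > 3a.\<close>
  show "3 * ((real d + 1) / 2) < real d + \<alpha> + 1 \<or> real d + \<alpha> + 1 = 3 * ((real d + 1) / 2) \<and> 1 < (real d + 1) / 2"
    using assms by (cases "d = 1") (auto simp: field_simps)
qed

subsection \<open>Rotation of the integration path\<close>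

text \<open>Cauchy's theorem on rectangles over [a,b] whose height Y tends to infinity; the top side
  contributes at most (b-a) g(Y). Holomorphy is assumed in the open strip only, because the
  integrands below branch at its corners.\<close>

lemma contour_rotation_strip:
  fixes f :: "complex \<Rightarrow> complex" and g :: "real \<Rightarrow> real"
  assumes ab: "a < b"
    and cont: "continuous_on {z. a \<le> Re z \<and> Re z \<le> b \<and> 0 \<le> Im z} f"
    and hol: "\<And>z. a < Re z \<Longrightarrow> Re z < b \<Longrightarrow> 0 < Im z \<Longrightarrow> f field_differentiable at z"
    and bnd: "\<And>z. a \<le> Re z \<Longrightarrow> Re z \<le> b \<Longrightarrow> 0 \<le> Im z \<Longrightarrow> norm (f z) \<le> g (Im z)"
    and g0: "(g \<longlongrightarrow> 0) at_top" and gi: "set_integrable lborel {0..} g"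
  shows "set_integrable lborel {0..} (\<lambda>y. f (Complex a y))"
    and "set_integrable lborel {0..} (\<lambda>y. f (Complex b y))"
    and "(LINT t:{a..b}|lborel. f (of_real t)) =
      \<i> * ((LINT y:{0..}|lborel. f (Complex a y)) - (LINT y:{0..}|lborel. f (Complex b y)))"
proof -
  let ?S = "{z. a \<le> Re z \<and> Re z \<le> b \<and> 0 \<le> Im z}"
  have cC: "continuous_on {0..} (\<lambda>y. f (Complex c y))" if "a \<le> c" "c \<le> b" for c
    using that by (intro continuous_on_compose2[OF cont]) (auto simp: Complex_eq intro!: continuous_intros)
  have iC: "set_integrable lborel {0..} (\<lambda>y. f (Complex c y))" if c: "a \<le> c" "c \<le> b" for c
    unfolding set_integrable_def
  proof (rule Bochner_Integration.integrable_bound)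
    show "integrable lborel (\<lambda>y. indicator {0..} y *\<^sub>R g y)" using gi by (simp add: set_integrable_def)
    have "set_borel_measurable borel {0..} (\<lambda>y. f (Complex c y))"
      by (rule borel_measurable_continuous_on_indicator[OF _ cC[OF c], folded set_borel_measurable_def]) simp
    thus "(\<lambda>y. indicator {0..} y *\<^sub>R f (Complex c y)) \<in> borel_measurable lborel"
      by (simp add: set_borel_measurable_def)
    show "AE y in lborel. norm (indicator {0..} y *\<^sub>R f (Complex c y)) \<le> norm (indicator {0..} y *\<^sub>R g y)"
    proof (rule AE_I2)
      fix y :: real
      show "norm (indicator {0..} y *\<^sub>R f (Complex c y)) \<le> norm (indicator {0..} y *\<^sub>R g y)"
        using bnd[of "Complex c y"] c by (auto simp: indicator_def)
    qed
  qed
  show "set_integrable lborel {0..} (\<lambda>y. f (Complex a y))" "set_integrable lborel {0..} (\<lambda>y. f (Complex b y))"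
    using iC ab by auto
  let ?A = "of_real a :: complex" and ?B = "of_real b :: complex"
  have sq: "(LINT t:{a..b}|lborel. f (of_real t)) + \<i> * (LINT y:{0..Y}|lborel. f (Complex b y)) -
      \<i> * (LINT y:{0..Y}|lborel. f (Complex a y)) - contour_integral (linepath (Complex a Y) (Complex b Y)) f = 0"
    if Y: "Y > 0" for Y
  proof -
    let ?C = "Complex b Y" and ?D = "Complex a Y"
    have conv: "convex ?S"
    proof -
      have "?S = {z. Re z \<ge> a} \<inter> {z. Re z \<le> b} \<inter> {z. Im z \<ge> 0}" by auto
      thus ?thesis by (simp only:) (intro convex_Int convex_halfspace_Re_ge convex_halfspace_Re_le convex_halfspace_Im_ge)
    qed
    have intS: "a < Re z \<and> Re z < b \<and> 0 < Im z" if zi: "z \<in> interior ?S" for z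
    proof -
      obtain e where e: "e > 0" "ball z e \<subseteq> ?S" using zi unfolding mem_interior by blast
      have "z - of_real (e / 2) \<in> ball z e" "z + of_real (e / 2) \<in> ball z e" "z - \<i> * of_real (e / 2) \<in> ball z e"
        using e(1) by (auto simp: dist_norm norm_mult)
      hence "z - of_real (e / 2) \<in> ?S" "z + of_real (e / 2) \<in> ?S" "z - \<i> * of_real (e / 2) \<in> ?S"
        using e(2) by blast+
      thus ?thesis using e(1) by auto
    qed
    have seg: "closed_segment u v \<subseteq> ?S" if "u \<in> ?S" "v \<in> ?S" for u v
      using that conv by (rule closed_segment_subset)
    have inS: "?A \<in> ?S" "?B \<in> ?S" "?C \<in> ?S" "?D \<in> ?S" using ab Y by auto
    have cs: "continuous_on (closed_segment u v) f" if "u \<in> ?S" "v \<in> ?S" for u v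
      by (rule continuous_on_subset[OF cont seg[OF that]])
    have ci: "f contour_integrable_on (linepath u v)" if "u \<in> ?S" "v \<in> ?S" for u v
      by (rule contour_integrable_continuous_linepath[OF continuous_on_subset[OF cont seg[OF that]]])
    let ?\<gamma> = "linepath ?A ?B +++ linepath ?B ?C +++ linepath ?C ?D +++ linepath ?D ?A"
    have "(f has_contour_integral 0) ?\<gamma>"
    proof (rule Cauchy_theorem_convex[OF cont conv, of "{}"])
      show "f field_differentiable at z" if "z \<in> interior ?S - {}" for z
        using that intS hol by auto
      show "path_image ?\<gamma> \<subseteq> ?S"
        using seg inS by (simp add: path_image_join)
    qed auto
    hence "contour_integral ?\<gamma> f = 0" by (rule contour_integral_unique)
    hence "contour_integral (linepath ?A ?B) f + (contour_integral (linepath ?B ?C) f +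
       (contour_integral (linepath ?C ?D) f + contour_integral (linepath ?D ?A) f)) = 0"
      using ci inS by (simp add: contour_integrable_joinI)
    moreover have "contour_integral (linepath ?D ?A) f = - contour_integral (linepath ?A ?D) f"
      by (subst contour_integral_reverse_linepath[symmetric]) (rule cs[OF inS(4) inS(1)], simp)
    moreover have "contour_integral (linepath ?C ?D) f = - contour_integral (linepath ?D ?C) f"
      by (subst contour_integral_reverse_linepath[symmetric]) (rule cs[OF inS(3) inS(4)], simp)
    moreover have "contour_integral (linepath ?A ?B) f = (LINT t:{a..b}|lborel. f (of_real t))"
    proof -
      have "set_integrable lborel {a..b} (\<lambda>t. f (of_real t))"
        by (rule borel_integrable_atLeastAtMost', rule continuous_on_compose2[OF cont]) (auto intro!: continuous_intros)
      thus ?thesis using ab by (simp add: contour_integral_linepath_Reals_eq set_borel_integral_eq_integral(2))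
    qed
    moreover have "contour_integral (linepath (of_real c) (Complex c Y)) f = \<i> * (LINT y:{0..Y}|lborel. f (Complex c y))"
      if "a \<le> c" "c \<le> b" for c
    proof -
      have "set_integrable lborel {0..Y} (\<lambda>y. f (Complex c y))"
        by (rule borel_integrable_atLeastAtMost', rule continuous_on_subset[OF cC[OF that]]) auto
      thus ?thesis using Y
        by (subst contour_integral_linepath_same_Re[of _ c _ 0 Y]) (auto simp: set_borel_integral_eq_integral(2))
    qed
    ultimately show ?thesis using ab by (simp add: algebra_simps)
  qed
  have top: "((\<lambda>Y. contour_integral (linepath (Complex a Y) (Complex b Y)) f) \<longlongrightarrow> 0) at_top"
  proof (rule Lim_null_comparison)
    show "((\<lambda>Y. g Y * (b - a)) \<longlongrightarrow> 0) at_top" using tendsto_mult[OF g0 tendsto_const] by simp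
    show "\<forall>\<^sub>F Y in at_top. norm (contour_integral (linepath (Complex a Y) (Complex b Y)) f) \<le> g Y * (b - a)"
      using eventually_gt_at_top[of 0]
    proof eventually_elim
      case (elim Y)
      have seg: "z \<in> ?S \<and> Im z = Y" if "z \<in> closed_segment (Complex a Y) (Complex b Y)" for z
        using that ab elim closed_segment_same_Im[of "Complex a Y" "Complex b Y"] by (auto simp: closed_segment_eq_real_ivl)
      have "f contour_integrable_on linepath (Complex a Y) (Complex b Y)"
        by (rule contour_integrable_continuous_linepath[OF continuous_on_subset[OF cont]]) (use seg in auto)
      hence "norm (contour_integral (linepath (Complex a Y) (Complex b Y)) f) \<le> g Y * norm (Complex b Y - Complex a Y)"
      proof (rule contour_integral_bound_linepath)
        show "0 \<le> g Y" using order_trans[OF norm_ge_zero bnd[of "Complex a Y"]] elim ab by simp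
        show "norm (f z) \<le> g Y" if "z \<in> closed_segment (Complex a Y) (Complex b Y)" for z
          using bnd[of z] seg[OF that] by auto
      qed
      also have "norm (Complex b Y - Complex a Y) = b - a" using ab by (simp add: cmod_def)
      finally show ?case .
    qed
  qed
  have lim: "((\<lambda>Y. LINT y:{0..Y}|lborel. f (Complex c y)) \<longlongrightarrow> (LINT y:{0..}|lborel. f (Complex c y))) at_top"
    if "a \<le> c" "c \<le> b" for c
    by (rule tendsto_set_lebesgue_integral_at_top[OF _ iC[OF that]]) auto
  have "((\<lambda>Y. (LINT t:{a..b}|lborel. f (of_real t)) + \<i> * (LINT y:{0..Y}|lborel. f (Complex b y)) -
      \<i> * (LINT y:{0..Y}|lborel. f (Complex a y)) - contour_integral (linepath (Complex a Y) (Complex b Y)) f) \<longlongrightarrow>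
      (LINT t:{a..b}|lborel. f (of_real t)) + \<i> * (LINT y:{0..}|lborel. f (Complex b y)) -
      \<i> * (LINT y:{0..}|lborel. f (Complex a y)) - 0) at_top"
    using ab by (intro tendsto_intros lim top) auto
  moreover have "\<forall>\<^sub>F Y in at_top. (LINT t:{a..b}|lborel. f (of_real t)) + \<i> * (LINT y:{0..Y}|lborel. f (Complex b y)) -
      \<i> * (LINT y:{0..Y}|lborel. f (Complex a y)) - contour_integral (linepath (Complex a Y) (Complex b Y)) f = 0"
    using eventually_gt_at_top[of 0] by eventually_elim (rule sq)
  hence "((\<lambda>Y. (LINT t:{a..b}|lborel. f (of_real t)) + \<i> * (LINT y:{0..Y}|lborel. f (Complex b y)) -
      \<i> * (LINT y:{0..Y}|lborel. f (Complex a y)) - contour_integral (linepath (Complex a Y) (Complex b Y)) f) \<longlongrightarrow> 0) at_top"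
    by (rule tendsto_eventually)
  ultimately have "(LINT t:{a..b}|lborel. f (of_real t)) + \<i> * (LINT y:{0..}|lborel. f (Complex b y)) -
      \<i> * (LINT y:{0..}|lborel. f (Complex a y)) - 0 = 0"
    by (rule tendsto_unique[rotated]) simp
  thus "(LINT t:{a..b}|lborel. f (of_real t)) =
      \<i> * ((LINT y:{0..}|lborel. f (Complex a y)) - (LINT y:{0..}|lborel. f (Complex b y)))"
    by (simp add: algebra_simps)
qed

section \<open>Complex powers on the closed right half-plane\<close>

text \<open>The power with \<open>0^0 = 1\<close>, which makes it continuous at 0 for every exponent \<open>p \<ge> 0\<close>.\<close>
definition cpow :: "complex \<Rightarrow> real \<Rightarrow> complex" where
  "cpow z p = (if p = 0 then 1 else z powr of_real p)"

lemma continuous_on_cpow: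
  assumes "continuous_on A f" "\<And>z. z \<in> A \<Longrightarrow> Re (f z) \<ge> 0" "p \<ge> 0"
  shows "continuous_on A (\<lambda>z. cpow (f z) p)"
proof (cases "p = 0")
  case False
  thus ?thesis using assms unfolding cpow_def by (auto intro!: continuous_on_powr_complex continuous_intros)
qed (simp add: cpow_def)

lemma field_differentiable_cpow:
  assumes "f field_differentiable at z" "Re (f z) > 0"
  shows "(\<lambda>z. cpow (f z) p) field_differentiable at z"
proof -
  have "(\<lambda>w. w powr of_real p) field_differentiable at (f z)"
    using assms(2) has_field_derivative_powr[of "f z" "of_real p"]
    unfolding field_differentiable_def by (auto simp: complex_nonpos_Reals_iff)
  from field_differentiable_compose[OF assms(1) this] show ?thesis
    by (cases "p = 0") (auto simp: cpow_def o_def)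
qed

lemma norm_cpow_le:
  assumes "p \<ge> 0"
  shows "norm (cpow z p) \<le> (1 + norm z) powr p"
proof -
  have "1 + norm z > 0" by (rule add_pos_nonneg) auto
  thus ?thesis using assms by (auto simp: cpow_def norm_powr_real_powr' intro!: powr_mono2)
qed

lemma borel_measurable_cpow [measurable (raw)]:
  assumes [measurable]: "f \<in> borel_measurable M"
  shows "(\<lambda>x. cpow (f x) p) \<in> borel_measurable M"
  unfolding cpow_def powr_def by measurable

lemma cpow_of_real: "x > 0 \<Longrightarrow> cpow (of_real x) p = of_real (x powr p)"
  by (simp add: cpow_def powr_of_real)

text \<open>The source of all phases in the asymptotics: the two vertical directions have the
  arguments pi/2 and -pi/2.\<close>

lemma cpow_ii_times:
  assumes "y > 0"
  shows "cpow (\<i> * of_real y) p = of_real (y powr p) * cis (p * pi / 2)"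
    "cpow (- (\<i> * of_real y)) p = of_real (y powr p) * cis (- (p * pi / 2))"
proof -
  have L: "Ln (\<i> * of_real y) = of_real (ln y) + \<i> * of_real (pi / 2)"
    using assms Ln_times_of_real[of y \<i>] by (simp add: mult.commute Ln_of_real)
  have L': "Ln (- (\<i> * of_real y)) = of_real (ln y) - \<i> * of_real (pi / 2)"
    using assms Ln_times_of_real[of y "- \<i>"] by (simp add: mult.commute Ln_of_real)
  show "cpow (\<i> * of_real y) p = of_real (y powr p) * cis (p * pi / 2)"
    using assms by (simp add: cpow_def powr_def L cis_conv_exp exp_add[symmetric] algebra_simps exp_of_real[symmetric] del: exp_of_real)
  show "cpow (- (\<i> * of_real y)) p = of_real (y powr p) * cis (- (p * pi / 2))"
    using assms by (simp add: cpow_def powr_def L' cis_conv_exp exp_add[symmetric] algebra_simps exp_of_real[symmetric] del: exp_of_real)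
qed

lemma cpow_of_real_mult:
  assumes "x > 0" "z \<noteq> 0"
  shows "cpow (of_real x * z) p = of_real (x powr p) * cpow z p"
proof -
  have "Ln (of_real x * z) = of_real (ln x) + Ln z" using assms by (simp add: Ln_times_of_real Ln_of_real)
  thus ?thesis using assms
    by (simp add: cpow_def powr_def algebra_simps exp_add exp_of_real[symmetric] del: exp_of_real)
qed

section \<open>Exponential integrability and product bounds\<close>

lemma integrable_exp_powr:
  "integrable lborel (\<lambda>y::real. indicator {0..} y * (exp (- y) * (1 + y) powr M))"
proof -
  define N where "N = max M 0"
  have "(\<integral>\<^sup>+t. ennreal (indicator {0..} t * t powr (N + 1 - 1) / exp t) \<partial>lborel) = ennreal (Gamma (N + 1))"
    by (rule Gamma_conv_nn_integral_real[symmetric]) (simp add: N_def)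
  hence "has_bochner_integral lborel (\<lambda>t. indicator {0..} t * t powr N / exp t) (Gamma (N + 1))"
    by (intro has_bochner_integral_nn_integral) (auto simp: N_def intro!: less_imp_le[OF Gamma_real_pos])
  hence i: "integrable lborel (\<lambda>t. indicator {0..} t * t powr N / exp t)" by (auto simp: has_bochner_integral_iff)
  have "integrable lborel (\<lambda>y. exp 1 * (indicator {0..} (1 + 1 * y) * (1 + 1 * y) powr N / exp (1 + 1 * y)))"
    by (intro integrable_mult_right lborel_integrable_real_affine[OF i]) simp
  thus ?thesis
  proof (rule Bochner_Integration.integrable_bound)
    show "AE y in lborel. norm (indicator {0..} y * (exp (- y) * (1 + y) powr M)) \<le>
       norm (exp 1 * (indicator {0..} (1 + 1 * y) * (1 + 1 * y) powr N / exp (1 + 1 * y)))"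
    proof (rule AE_I2)
      fix y :: real
      show "norm (indicator {0..} y * (exp (- y) * (1 + y) powr M)) \<le>
         norm (exp 1 * (indicator {0..} (1 + 1 * y) * (1 + 1 * y) powr N / exp (1 + 1 * y)))"
      proof (cases "y \<ge> 0")
        case True
        have "(1 + y) powr M \<le> (1 + y) powr N" using True by (intro powr_mono) (auto simp: N_def)
        hence "exp (- y) * (1 + y) powr M \<le> exp (- y) * (1 + y) powr N" by (intro mult_left_mono) auto
        also have "\<dots> = exp 1 * ((1 + y) powr N / exp (1 + y))" by (simp add: exp_add exp_minus field_simps)
        finally show ?thesis using True by simp
      qed simp
    qed
  qed measurable
qed

lemma integrable_times_pair:
  fixes u v :: "real \<Rightarrow> real"
  assumes u: "integrable lborel u" and v: "integrable lborel v"
  shows "integrable (lborel \<Otimes>\<^sub>M lborel) (\<lambda>(x, y). u x * v y)"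
    and "(LINT p|(lborel \<Otimes>\<^sub>M lborel). (case p of (x, y) \<Rightarrow> u x * v y)) = (LINT x|lborel. u x) * (LINT y|lborel. v y)"
proof -
  have [measurable]: "u \<in> borel_measurable borel" "v \<in> borel_measurable borel" using u v by auto
  show i: "integrable (lborel \<Otimes>\<^sub>M lborel) (\<lambda>(x, y). u x * v y)"
  proof (rule lborel_pair.Fubini_integrable)
    show "integrable lborel (\<lambda>x. LINT y|lborel. norm (case (x, y) of (x, y) \<Rightarrow> u x * v y))"
      using u by (simp add: abs_mult)
    show "AE x in lborel. integrable lborel (\<lambda>y. case (x, y) of (x, y) \<Rightarrow> u x * v y)"
      using v by simp
  qed measurable
  show "(LINT p|(lborel \<Otimes>\<^sub>M lborel). (case p of (x, y) \<Rightarrow> u x * v y)) = (LINT x|lborel. u x) * (LINT y|lborel. v y)"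
    using lborel_pair.integral_fst[OF i] by simp
qed

text \<open>A product majorant serves twice: it justifies the Fubini steps, and its explicit
  integral bounds the error terms of the expansion.\<close>

lemma integrable_pair_bound:
  fixes F :: "real \<times> real \<Rightarrow> 'b::{banach,second_countable_topology}"
  assumes "F \<in> borel_measurable (borel \<Otimes>\<^sub>M borel)" and u: "integrable lborel u" and v: "integrable lborel v"
    and b: "\<And>x y. norm (F (x, y)) \<le> u x * v y"
  shows "integrable (lborel \<Otimes>\<^sub>M lborel) F"
    and "norm (LINT p|(lborel \<Otimes>\<^sub>M lborel). F p) \<le> (LINT x|lborel. u x) * (LINT y|lborel. v y)"
proof -
  have nn: "u x * v y \<ge> 0" for x y using order_trans[OF norm_ge_zero b] .
  show i: "integrable (lborel \<Otimes>\<^sub>M lborel) F"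
  proof (rule Bochner_Integration.integrable_bound[OF integrable_times_pair(1)[OF u v]])
    show "AE p in lborel \<Otimes>\<^sub>M lborel. norm (F p) \<le> norm (case p of (x, y) \<Rightarrow> u x * v y)"
      using b nn by (intro AE_I2) (auto simp: abs_of_nonneg)
  qed (use assms(1) in simp)
  have "norm (LINT p|(lborel \<Otimes>\<^sub>M lborel). F p) \<le> (LINT p|(lborel \<Otimes>\<^sub>M lborel). norm (F p))"
    by (rule integral_norm_bound)
  also have "\<dots> \<le> (LINT p|(lborel \<Otimes>\<^sub>M lborel). (case p of (x, y) \<Rightarrow> u x * v y))"
    using i b by (intro integral_mono integrable_times_pair(1)[OF u v] integrable_norm) auto
  finally show "norm (LINT p|(lborel \<Otimes>\<^sub>M lborel). F p) \<le> (LINT x|lborel. u x) * (LINT y|lborel. v y)"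
    by (simp add: integrable_times_pair(2)[OF u v])
qed

section \<open>Poisson's integral for \<Omega> and its rotation\<close>

text \<open>\<open>M0\<close> is the integral of (1-u^2)^p, a Beta value under u = 2t-1. The
  derivative of u^(2k+1) (1-u^2)^(p+1) has integral 0 over [-1,1], which gives the recursion
  (2k+2p+3) m_{k+1} = (2k+1) m_k for the moments.\<close>

lemma even_moments_power_one_minus_square:
  fixes p :: real
  assumes p: "p \<ge> 0"
  defines "w \<equiv> \<lambda>u::real. indicator {-1..1} u * (1 - u\<^sup>2) powr p"
    and "M0 \<equiv> 2 * 4 powr p * (Gamma (p + 1))\<^sup>2 / Gamma (2 * p + 2)"
  shows "has_bochner_integral lborel (\<lambda>u. w u * u ^ (2 * k)) (M0 * pochhammer (1/2) k / pochhammer (p + 3/2) k)"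
proof (induction k)
  case 0
  have "has_bochner_integral lborel (\<lambda>u. 4 powr p * (indicator {0..1} (1/2 + (1/2) *\<^sub>R u) *
      ((1/2 + (1/2) *\<^sub>R u) powr (p + 1 - 1) * (1 - (1/2 + (1/2) *\<^sub>R u)) powr (p + 1 - 1)))) (4 powr p * (Beta (p + 1) (p + 1) / (1/2) ^ DIM(real)))"
    using p by (intro has_bochner_integral_mult_right has_bochner_integral_affine[OF has_bochner_integral_Beta]) auto
  also have "4 powr p * (Beta (p + 1) (p + 1) / (1/2) ^ DIM(real)) = M0"
    by (simp add: M0_def Beta_def power2_eq_square algebra_simps)
  also have "(\<lambda>u. 4 powr p * (indicator {0..1} (1/2 + (1/2) *\<^sub>R u) *
      ((1/2 + (1/2) *\<^sub>R u) powr (p + 1 - 1) * (1 - (1/2 + (1/2) *\<^sub>R u)) powr (p + 1 - 1)))) = w"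
  proof (rule ext)
    fix u :: real
    show "4 powr p * (indicator {0..1} (1/2 + (1/2) *\<^sub>R u) *
      ((1/2 + (1/2) *\<^sub>R u) powr (p + 1 - 1) * (1 - (1/2 + (1/2) *\<^sub>R u)) powr (p + 1 - 1))) = w u"
    proof (cases "u \<in> {-1..1}")
      case True
      hence "4 powr p * ((1/2 + u/2) powr p * (1 - (1/2 + u/2)) powr p) = (4 * ((1/2 + u/2) * (1 - (1/2 + u/2)))) powr p"
      proof -
        have e: "(4 * (A * B)) powr p = 4 powr p * (A powr p * B powr p)" if "A \<ge> 0" "B \<ge> 0" for A B :: real
          using that by (simp add: powr_mult)
        show ?thesis using True by (subst e) auto
      qed
      also have "4 * ((1/2 + u/2) * (1 - (1/2 + u/2))) = 1 - u\<^sup>2"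
        by (simp add: field_simps power2_eq_square)
      finally show ?thesis using True by (auto simp: w_def indicator_def)
    qed (auto simp: w_def indicator_def)
  qed
  finally show ?case by simp
next
  case (Suc k)
  let ?m = "M0 * pochhammer (1/2) k / pochhammer (p + 3/2) k"
  have [measurable]: "w \<in> borel_measurable borel" unfolding w_def by measurable
  have i: "integrable lborel (\<lambda>u. w u * u ^ (2 * Suc k))"
  proof (rule Bochner_Integration.integrable_bound)
    show "integrable lborel (\<lambda>u. w u * u ^ (2 * k))" using Suc by (auto simp: has_bochner_integral_iff)
    show "AE u in lborel. norm (w u * u ^ (2 * Suc k)) \<le> norm (w u * u ^ (2 * k))"
    proof (rule AE_I2)
      fix u :: real
      show "norm (w u * u ^ (2 * Suc k)) \<le> norm (w u * u ^ (2 * k))"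
      proof (cases "u \<in> {-1..1}")
        case True
        hence "\<bar>u\<bar> ^ (2 * Suc k) \<le> \<bar>u\<bar> ^ (2 * k)" by (intro power_decreasing) auto
        thus ?thesis by (simp only: real_norm_def abs_mult power_abs) (intro mult_left_mono, auto)
      qed (simp add: w_def)
    qed
  qed measurable
  have "((\<lambda>u. (2*k+1) * (u ^ (2*k) * (1 - u\<^sup>2) powr p) - (2*k+2*p+3) * (u ^ (2 * Suc k) * (1 - u\<^sup>2) powr p)) has_integral
     (1 ^ (2*k+1) * (1 - 1\<^sup>2) powr (p + 1) - (-1) ^ (2*k+1) * (1 - (-1)\<^sup>2) powr (p + 1))) {-1..1::real}"
  proof (rule fundamental_theorem_of_calculus_interior)
    have "continuous_on {-1..1} (\<lambda>u::real. (1 - u\<^sup>2) powr (p + 1))"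
      using p by (intro continuous_on_powr' continuous_intros) (auto simp: abs_square_le_1 abs_le_iff)
    thus "continuous_on {-1..1} (\<lambda>u::real. u ^ (2*k+1) * (1 - u\<^sup>2) powr (p + 1))"
      by (intro continuous_on_mult continuous_on_power continuous_on_id)
    fix u :: real assume u: "u \<in> {-1<..<1}"
    hence pos: "1 - u\<^sup>2 > 0" by (simp add: abs_square_less_1 abs_less_iff)
    have "((\<lambda>u. u ^ (2*k+1) * (1 - u\<^sup>2) powr (p + 1)) has_real_derivative
       (2*k+1) * u ^ (2*k) * (1 - u\<^sup>2) powr (p + 1) + u ^ (2*k+1) * ((p + 1) * (1 - u\<^sup>2) powr p * (- 2 * u))) (at u)"
    proof -
      have d1: "((\<lambda>u. u ^ (2*k+1)) has_real_derivative (2*k+1) * u ^ (2*k)) (at u)"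
        using DERIV_pow[of "2*k+1" u UNIV] by (simp add: mult.commute)
      have d2: "((\<lambda>u. (1 - u\<^sup>2) powr (p + 1)) has_real_derivative (p + 1) * (1 - u\<^sup>2) powr p * (- 2 * u)) (at u)"
        using pos by (auto intro!: derivative_eq_intros)
      from DERIV_mult[OF d1 d2] show ?thesis by (simp only: mult.commute add.commute)
    qed
    moreover have "(1 - u\<^sup>2) powr (p + 1) = (1 - u\<^sup>2) powr p * (1 - u\<^sup>2)" using pos by (simp add: powr_add)
    moreover have "(2*k+1) * u ^ (2*k) * ((1 - u\<^sup>2) powr p * (1 - u\<^sup>2)) + u ^ (2*k+1) * ((p + 1) * (1 - u\<^sup>2) powr p * (- 2 * u)) =
       (2*k+1) * (u ^ (2*k) * (1 - u\<^sup>2) powr p) - (2*k+2*p+3) * (u ^ (2 * Suc k) * (1 - u\<^sup>2) powr p)"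
      by (simp add: algebra_simps power2_eq_square)
    ultimately have "((\<lambda>u. u ^ (2*k+1) * (1 - u\<^sup>2) powr (p + 1)) has_real_derivative
       ((2*k+1) * (u ^ (2*k) * (1 - u\<^sup>2) powr p) - (2*k+2*p+3) * (u ^ (2 * Suc k) * (1 - u\<^sup>2) powr p))) (at u)"
      by (simp only:)
    thus "((\<lambda>u. u ^ (2*k+1) * (1 - u\<^sup>2) powr (p + 1)) has_vector_derivative
       ((2*k+1) * (u ^ (2*k) * (1 - u\<^sup>2) powr p) - (2*k+2*p+3) * (u ^ (2 * Suc k) * (1 - u\<^sup>2) powr p))) (at u)"
      by (simp add: has_real_derivative_iff_has_vector_derivative)
  qed simp
  hence h1: "((\<lambda>u. (2*k+1) * (u ^ (2*k) * (1 - u\<^sup>2) powr p) - (2*k+2*p+3) * (u ^ (2 * Suc k) * (1 - u\<^sup>2) powr p)) has_integral 0) {-1..1::real}"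
    by simp
  let ?m' = "LINT u|lborel. w u * u ^ (2 * Suc k)"
  have hl: "((\<lambda>u. u ^ n * (1 - u\<^sup>2) powr p) has_integral I) {-1..1::real}"
    if "has_bochner_integral lborel (\<lambda>u. w u * u ^ n) I" for n I
  proof -
    have e: "(\<lambda>u. w u * u ^ n) = (\<lambda>u. indicator {-1..1} u *\<^sub>R (u ^ n * (1 - u\<^sup>2) powr p))"
      by (simp add: w_def fun_eq_iff)
    have h: "has_bochner_integral lborel (\<lambda>u. indicator {-1..1} u *\<^sub>R (u ^ n * (1 - u\<^sup>2) powr p)) I"
      using that unfolding e .
    have s: "set_integrable lborel {-1..1} (\<lambda>u. u ^ n * (1 - u\<^sup>2) powr p)"
        "(LINT u:{-1..1}|lborel. u ^ n * (1 - u\<^sup>2) powr p) = I"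
      unfolding set_integrable_def set_lebesgue_integral_def
      by (rule h[unfolded has_bochner_integral_iff, THEN conjunct1], rule h[unfolded has_bochner_integral_iff, THEN conjunct2])
    show ?thesis using set_borel_integral_eq_integral[OF s(1)] s(2) by (simp add: has_integral_iff)
  qed
  have "((\<lambda>u. (2*k+1) * (u ^ (2*k) * (1 - u\<^sup>2) powr p) - (2*k+2*p+3) * (u ^ (2 * Suc k) * (1 - u\<^sup>2) powr p)) has_integral
      ((2*k+1) * ?m - (2*k+2*p+3) * ?m')) {-1..1::real}"
    by (intro has_integral_diff has_integral_mult_right hl Suc has_bochner_integral_integrable[OF i])
  from has_integral_unique[OF this h1] have eq: "(2*k+2*p+3) * ?m' = (2*k+1) * ?m" by simp
  have "2*k+2*p+3 \<noteq> 0" using p by linarith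
  hence "?m' = (2*k+2*p+3) * ?m' / (2*k+2*p+3)" by (rule nonzero_mult_div_cancel_left[symmetric])
  hence "?m' = (2*k+1) * ?m / (2*k+2*p+3)" by (simp only: eq)
  moreover have "1/2 + real k = (2*k+1) / 2" "p + 3/2 + real k = (2*k+2*p+3) / 2" by (simp_all add: field_simps)
  ultimately have "?m' = M0 * pochhammer (1/2) (Suc k) / pochhammer (p + 3/2) (Suc k)"
    by (simp only: pochhammer_Suc) (simp add: mult_ac)
  with i show ?case by (simp add: has_bochner_integral_iff)
qed

text \<open>Since (2k)! = 4^k k! (1/2)_k, the moments turn the cosine series into the coefficients
  of \<Omega> with index p+1/2.\<close>

lemma Poisson_integral_\<Omega>:
  fixes p :: real
  assumes p: "p \<ge> 0"
  defines "M0 \<equiv> 2 * 4 powr p * (Gamma (p + 1))\<^sup>2 / Gamma (2 * p + 2)"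
  shows "has_bochner_integral lborel (\<lambda>u. indicator {-1..1} u * (1 - u\<^sup>2) powr p * cos (s * u)) (M0 * \<Omega> (p + 1/2) s)"
proof -
  let ?w = "\<lambda>u::real. indicator {-1..1} u * (1 - u\<^sup>2) powr p"
  define m where "m k = s ^ (2 * k) * (M0 * pochhammer (1/2) k / pochhammer (p + 3/2) k)" for k
  have h: "has_bochner_integral lborel (\<lambda>u. ?w u * (s * u) ^ (2 * k)) (m k)" for k
    using has_bochner_integral_mult_right[OF even_moments_power_one_minus_square[OF p, of k], of "s ^ (2 * k)"]
    by (simp add: m_def M0_def power_mult_distrib mult_ac)
  have f: "fact (2 * k) = (4 ^ k * fact k * pochhammer (1/2) k :: real)" for k
  proof -
    have "real (2 ^ (2 * k)) = 4 ^ k" "2 * (1/2) = (1::real)" "1/2 + 1/2 = (1::real)"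
      by (simp_all add: power_mult)
    thus ?thesis using pochhammer_double[of "1/2::real" k] by (simp only: pochhammer_fact mult_ac)
  qed
  have pp: "pochhammer (1/2::real) k > 0" "pochhammer (p + 3/2) k > 0" for k using p by (auto intro!: pochhammer_pos)
  have e3: "(s ^ k)\<^sup>2 = (s\<^sup>2) ^ k" for k by (simp flip: power_mult add: mult.commute)
  have e0: "p + 1/2 + 1 = p + 3/2" by simp
  have M0: "M0 > 0" unfolding M0_def using p by (intro divide_pos_pos mult_pos_pos zero_less_power Gamma_real_pos) auto
  have e1: "(- 1) ^ k * m k / fact (2 * k) = M0 * (\<Omega>_coeff (p + 1/2) k * (s\<^sup>2) ^ k)" for k
    unfolding m_def f \<Omega>_coeff_def e0 using pp[of k]
    by (simp add: power_divide power_minus[of "1/4"] power_mult mult_ac e3)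
  have e2: "m k / fact (2 * k) = M0 * norm (\<Omega>_coeff (p + 1/2) k * (s\<^sup>2) ^ k)" for k
    unfolding m_def f \<Omega>_coeff_def e0 using pp[of k]
    by (simp add: power_divide abs_mult power_abs power_mult mult_ac e3)
  have "summable (\<lambda>k. m k / fact (2 * k))"
    unfolding e2 using p by (intro summable_mult summable_\<Omega>_coeff) simp
  hence "has_bochner_integral lborel (\<lambda>u. ?w u * cos (s * u)) (\<Sum>k. (- 1) ^ k * m k / fact (2 * k))"
    by (intro has_bochner_integral_cos_moments h) auto
  also have "(\<Sum>k. (- 1) ^ k * m k / fact (2 * k)) = M0 * \<Omega> (p + 1/2) s"
    unfolding e1 using p
    by (subst suminf_mult[OF summable_norm_cancel[OF summable_\<Omega>_coeff]]) (auto simp: \<Omega>_eq_suminf)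
  finally show ?thesis .
qed

lemma Re_set_integral:
  assumes "set_integrable M A f"
  shows "Re (LINT x:A|M. f x) = (LINT x:A|M. Re (f x))"
    and "set_integrable M A (\<lambda>x. Re (f x))"
proof -
  have i: "integrable M (\<lambda>x. indicator A x *\<^sub>R f x)" using assms by (simp add: set_integrable_def)
  show "Re (LINT x:A|M. f x) = (LINT x:A|M. Re (f x))"
    unfolding set_lebesgue_integral_def using integral_Re[OF i] by simp
  show "set_integrable M A (\<lambda>x. Re (f x))"
    unfolding set_integrable_def using integrable_Re[OF i] by simp
qed

text \<open>The path from \<open>-t\<close> to \<open>t\<close> in Poisson's integral is moved to the two vertical rays above its end points, whose contributions are conjugate.\<close>
lemma \<Omega>_rotated:
  fixes p t :: real
  assumes p: "p \<ge> 0" and t: "t > 0"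
  defines "M0 \<equiv> 2 * 4 powr p * (Gamma (p + 1))\<^sup>2 / Gamma (2 * p + 2)"
  shows "M0 * (t powr (2 * p + 1) * \<Omega> (p + 1/2) t) =
    2 * Re (- \<i> * exp (\<i> * of_real t) * (LINT y:{0..}|lborel. exp (- of_real y) * cpow (- (\<i> * of_real y)) p * cpow (2 * of_real t + \<i> * of_real y) p))"
proof -
  \<comment> \<open>On the segment this is (t^2-u^2)^p exp(iu), whose real part is the integrand of
    Poisson's integral stretched by t; the exponential decays in the upper half-plane.\<close>
  define f where "f z = cpow (of_real t - z) p * cpow (of_real t + z) p * exp (\<i> * z)" for z
  define g where "g Y = (1 + 2 * t) powr (2 * p) * (exp (- Y) * (1 + Y) powr (2 * p))" for Y :: real
  have cont: "continuous_on {z. - t \<le> Re z \<and> Re z \<le> t \<and> 0 \<le> Im z} f"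
    unfolding f_def using p by (intro continuous_on_mult continuous_on_cpow continuous_intros) auto
  have hol: "f field_differentiable at z" if "- t < Re z" "Re z < t" "0 < Im z" for z
    unfolding f_def[abs_def] using that
    by (intro field_differentiable_mult field_differentiable_cpow derivative_intros field_differentiable_within_exp field_differentiable_compose[of _ _ exp, unfolded o_def])
       (auto intro!: derivative_intros field_differentiable_within_exp)
  have bnd: "norm (f z) \<le> g (Im z)" if z: "- t \<le> Re z" "Re z \<le> t" "0 \<le> Im z" for z
  proof -
    have n: "norm (of_real t - z) \<le> 2 * t + Im z" "norm (of_real t + z) \<le> 2 * t + Im z"
      using cmod_le[of "of_real t - z"] cmod_le[of "of_real t + z"] z by auto
    have "norm (cpow w p) \<le> ((1 + 2 * t) * (1 + Im z)) powr p" if "norm w \<le> 2 * t + Im z" for w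
    proof -
      have "norm (cpow w p) \<le> (1 + norm w) powr p" by (rule norm_cpow_le[OF p])
      also have "\<dots> \<le> ((1 + 2 * t) * (1 + Im z)) powr p"
      proof (rule powr_mono2[OF p])
        have "2 * t * Im z \<ge> 0" using t z by simp
        thus "1 + norm w \<le> (1 + 2 * t) * (1 + Im z)" using that by (simp add: algebra_simps)
      qed (simp add: add_nonneg_nonneg)
      finally show ?thesis .
    qed
    hence "norm (cpow (of_real t - z) p) * norm (cpow (of_real t + z) p) \<le>
        ((1 + 2 * t) * (1 + Im z)) powr p * ((1 + 2 * t) * (1 + Im z)) powr p"
      using n by (intro mult_mono) auto
    also have "\<dots> = ((1 + 2 * t) * (1 + Im z)) powr (2 * p)" unfolding mult_2[of p] by (rule powr_add[symmetric])
    also have "\<dots> = (1 + 2 * t) powr (2 * p) * (1 + Im z) powr (2 * p)" using t z by (simp add: powr_mult)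
    finally show ?thesis
      using mult_right_mono[of _ _ "exp (- Im z)"] by (simp add: f_def g_def norm_mult mult_ac)
  qed
  have gi: "set_integrable lborel {0..} g"
    using integrable_mult_right[OF integrable_exp_powr[of "2 * p"], of "(1 + 2 * t) powr (2 * p)"]
    by (simp add: set_integrable_def g_def mult_ac)
  have g0: "(g \<longlongrightarrow> 0) at_top"
    unfolding g_def using p by real_asymp
  have rot: "(LINT u:{-t..t}|lborel. f (of_real u)) =
      \<i> * ((LINT y:{0..}|lborel. f (Complex (-t) y)) - (LINT y:{0..}|lborel. f (Complex t y)))"
    and si: "set_integrable lborel {0..} (\<lambda>y. f (Complex t y))"
    using contour_rotation_strip[OF _ cont hol bnd g0 gi] t by auto
  \<comment> \<open>Reflection in the imaginary axis maps the strip to itself and \<open>f\<close>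
    to its conjugate. For y > 0 both bases avoid the branch cut, and the corner y = 0 is a null
    set.\<close>
  have fc: "f (Complex (-t) y) = cnj (f (Complex t y))" if "y > 0" for y
  proof -
    have cc: "cpow (cnj z) p = cnj (cpow z p)" if "Re z > 0 \<or> Im z \<noteq> 0" for z
      using that by (auto simp: cpow_def powr_def cnj_Ln exp_cnj complex_nonpos_Reals_iff complex_eq_iff[of z 0])
    have "of_real t - Complex (-t) y = cnj (of_real t + Complex t y)" "of_real t + Complex (-t) y = cnj (of_real t - Complex t y)"
      by (auto simp: complex_eq_iff)
    moreover have "exp (\<i> * Complex (-t) y) = cnj (exp (\<i> * Complex t y))" by (auto simp: complex_eq_iff Re_exp Im_exp)
    moreover have "cpow (cnj (of_real t + Complex t y)) p = cnj (cpow (of_real t + Complex t y) p)"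
      "cpow (cnj (of_real t - Complex t y)) p = cnj (cpow (of_real t - Complex t y) p)"
      by (rule cc; use that in simp)+
    ultimately show ?thesis unfolding f_def by (simp only: complex_cnj_mult mult_ac)
  qed
  have "(LINT y:{0..}|lborel. f (Complex (-t) y)) = (LINT y:{0..}|lborel. cnj (f (Complex t y)))"
    unfolding set_lebesgue_integral_def
  proof (rule integral_cong_AE)
    have "set_integrable lborel {0..} (\<lambda>y. f (Complex (-t) y))" using contour_rotation_strip(1)[OF _ cont hol bnd g0 gi] t by auto
    thus "(\<lambda>y. indicator {0..} y *\<^sub>R f (Complex (-t) y)) \<in> borel_measurable lborel" by (auto simp: set_integrable_def)
    show "(\<lambda>y. indicator {0..} y *\<^sub>R cnj (f (Complex t y))) \<in> borel_measurable lborel"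
      using borel_measurable_integrable[OF integrable_cnj[OF si[unfolded set_integrable_def]]] by simp
    show "AE y in lborel. indicator {0..} y *\<^sub>R f (Complex (-t) y) = indicator {0..} y *\<^sub>R cnj (f (Complex t y))"
      using AE_lborel_singleton[of "0::real"] by eventually_elim (auto simp: indicator_def fc)
  qed
  also have "\<dots> = cnj (LINT y:{0..}|lborel. f (Complex t y))"
    unfolding set_lebesgue_integral_def
    using integral_bounded_linear[OF bounded_linear_cnj si[unfolded set_integrable_def]] by simp
  finally have R: "Re (LINT u:{-t..t}|lborel. f (of_real u)) = 2 * Re (- \<i> * (LINT y:{0..}|lborel. f (Complex t y)))"
    unfolding rot by simp
  have "(LINT y:{0..}|lborel. f (Complex t y)) = (LINT y:{0..}|lborel. exp (\<i> * of_real t) * (exp (- of_real y) * cpow (- (\<i> * of_real y)) p * cpow (2 * of_real t + \<i> * of_real y) p))"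
  proof (rule set_lebesgue_integral_cong)
    show "\<forall>y. y \<in> {0..} \<longrightarrow> f (Complex t y) = exp (\<i> * of_real t) * (exp (- of_real y) * cpow (- (\<i> * of_real y)) p * cpow (2 * of_real t + \<i> * of_real y) p)"
      by (auto simp: f_def Complex_eq exp_add[symmetric] algebra_simps)
  qed simp
  also have "\<dots> = exp (\<i> * of_real t) * (LINT y:{0..}|lborel. exp (- of_real y) * cpow (- (\<i> * of_real y)) p * cpow (2 * of_real t + \<i> * of_real y) p)"
    by (rule set_integral_mult_right)
  finally have F: "(LINT y:{0..}|lborel. f (Complex t y)) = exp (\<i> * of_real t) * (LINT y:{0..}|lborel. exp (- of_real y) * cpow (- (\<i> * of_real y)) p * cpow (2 * of_real t + \<i> * of_real y) p)" .
  have fi: "set_integrable lborel {-t..t} (\<lambda>u. f (of_real u))"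
    by (rule borel_integrable_atLeastAtMost', rule continuous_on_compose2[OF cont]) (auto intro!: continuous_intros)
  have P: "has_bochner_integral lborel (\<lambda>u. t powr (2 * p) * (indicator {-1..1} (0 + (1/t) *\<^sub>R u) * (1 - (0 + (1/t) *\<^sub>R u)\<^sup>2) powr p * cos (t * (0 + (1/t) *\<^sub>R u))))
      (t powr (2 * p) * (M0 * \<Omega> (p + 1/2) t / (1/t) ^ DIM(real)))"
    unfolding M0_def using t by (intro has_bochner_integral_mult_right has_bochner_integral_affine[OF Poisson_integral_\<Omega>[OF p]]) simp
  have "Re (LINT u:{-t..t}|lborel. f (of_real u)) = (LINT u:{-t..t}|lborel. Re (f (of_real u)))"
    by (rule Re_set_integral[OF fi])
  also have "\<dots> = (LINT u|lborel. t powr (2 * p) * (indicator {-1..1} (0 + (1/t) *\<^sub>R u) * (1 - (0 + (1/t) *\<^sub>R u)\<^sup>2) powr p * cos (t * (0 + (1/t) *\<^sub>R u))))"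
    unfolding set_lebesgue_integral_def
  proof (rule integral_cong_AE)
    show "(\<lambda>u. indicator {-t..t} u *\<^sub>R Re (f (of_real u))) \<in> borel_measurable lborel"
      using Re_set_integral(2)[OF fi] by (auto simp: set_integrable_def)
    show "AE u in lborel. indicator {-t..t} u *\<^sub>R Re (f (of_real u)) =
       t powr (2 * p) * (indicator {-1..1} (0 + (1/t) *\<^sub>R u) * (1 - (0 + (1/t) *\<^sub>R u)\<^sup>2) powr p * cos (t * (0 + (1/t) *\<^sub>R u)))"
      using AE_lborel_singleton[of t] AE_lborel_singleton[of "- t"]
    proof eventually_elim
      case (elim u)
      show ?case
      proof (cases "u \<in> {-t..t}")
        case True
        hence u: "t - u > 0" "t + u > 0" using elim by auto
        have "f (of_real u) = of_real ((t - u) powr p) * of_real ((t + u) powr p) * exp (\<i> * of_real u)"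
          unfolding f_def using u cpow_of_real[OF u(1), of p] cpow_of_real[OF u(2), of p] by simp
        hence "Re (f (of_real u)) = (t - u) powr p * (t + u) powr p * cos u"
          by (simp add: Re_exp flip: of_real_mult)
        also have "(t - u) powr p * (t + u) powr p = (t\<^sup>2 * (1 - (u / t)\<^sup>2)) powr p"
        proof -
          have "(t - u) * (t + u) = t\<^sup>2 * (1 - (u / t)\<^sup>2)" using t by (simp add: field_simps power2_eq_square)
          thus ?thesis using u by (simp add: powr_mult[symmetric])
        qed
        also have "\<dots> = t powr (2 * p) * (1 - (u / t)\<^sup>2) powr p"
        proof -
          have "\<bar>u / t\<bar> \<le> 1" using True t by (simp add: abs_le_iff field_simps)
          hence "(u / t)\<^sup>2 \<le> 1" by (simp only: abs_square_le_1)
          moreover have "t\<^sup>2 powr p = t powr (2 * p)" using t by (simp add: powr_powr flip: powr_numeral)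
          ultimately show ?thesis by (simp add: powr_mult)
        qed
        finally show ?thesis using True t by (simp add: indicator_def field_simps)
      next
        case False
        hence "\<not> (1/t) * u \<in> {-1..1}" using t by (auto simp: field_simps)
        hence i1: "indicator {-1..1} (0 + (1/t) *\<^sub>R u) = (0::real)" by (auto simp: indicator_def)
        have i2: "indicator {-t..t} u = (0::real)" using False by simp
        show ?thesis unfolding i1 i2 by simp
      qed
    qed
  qed measurable
  also have "\<dots> = M0 * (t powr (2 * p + 1) * \<Omega> (p + 1/2) t)"
    using P t by (simp add: has_bochner_integral_iff powr_add field_simps)
  finally show ?thesis using R F by (simp add: mult.assoc)
qed

subsection \<open>Asymptotic expansion\<close>

text \<open>f(y) f(v) is symmetric and the diagonal is a null set, so the half-plane y < v carries
  half of the squared integral.\<close>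

lemma nn_integral_symmetric_half:
  fixes f :: "real \<Rightarrow> ennreal"
  assumes [measurable]: "f \<in> borel_measurable borel"
  shows "2 * (\<integral>\<^sup>+y. (\<integral>\<^sup>+v. f y * f v * indicator {y<..} v \<partial>lborel) \<partial>lborel) = (\<integral>\<^sup>+y. f y \<partial>lborel) * (\<integral>\<^sup>+y. f y \<partial>lborel)"
proof -
  let ?I = "\<integral>\<^sup>+y. (\<integral>\<^sup>+v. f y * f v * indicator {y<..} v \<partial>lborel) \<partial>lborel"
  have ind: "indicator {y<..} v = (if y < v then 1 else 0 :: ennreal)" for y v :: real by (simp add: indicator_def)
  have sw: "?I = (\<integral>\<^sup>+v. (\<integral>\<^sup>+y. f y * f v * indicator {y<..} v \<partial>lborel) \<partial>lborel)"
    unfolding ind by (rule lborel_pair.Fubini') measurable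
  have "2 * ?I = ?I + ?I" by (rule mult_2)
  also have "\<dots> = ?I + (\<integral>\<^sup>+v. (\<integral>\<^sup>+y. f y * f v * indicator {y<..} v \<partial>lborel) \<partial>lborel)"
    unfolding sw[symmetric] ..
  also have "\<dots> = (\<integral>\<^sup>+y. (\<integral>\<^sup>+v. f y * f v * indicator {y<..} v \<partial>lborel) + (\<integral>\<^sup>+v. f v * f y * indicator {v<..} y \<partial>lborel) \<partial>lborel)"
    unfolding ind by (rule nn_integral_add[symmetric]) measurable
  also have "\<dots> = (\<integral>\<^sup>+y. f y * (\<integral>\<^sup>+v. f v \<partial>lborel) \<partial>lborel)"
  proof (rule nn_integral_cong)
    fix y :: real
    have "(\<integral>\<^sup>+v. f y * f v * indicator {y<..} v \<partial>lborel) + (\<integral>\<^sup>+v. f v * f y * indicator {v<..} y \<partial>lborel) =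
      (\<integral>\<^sup>+v. f y * f v * indicator {y<..} v + f v * f y * indicator {v<..} y \<partial>lborel)"
      unfolding ind by (rule nn_integral_add[symmetric]) measurable
    also have "\<dots> = (\<integral>\<^sup>+v. f y * f v \<partial>lborel)"
      by (rule nn_integral_cong_AE, use AE_lborel_singleton[of y] in eventually_elim)
         (auto simp: indicator_def mult.commute)
    also have "\<dots> = f y * (\<integral>\<^sup>+v. f v \<partial>lborel)" by (rule nn_integral_cmult) measurable
    finally show "(\<integral>\<^sup>+v. f y * f v * indicator {y<..} v \<partial>lborel) + (\<integral>\<^sup>+v. f v * f y * indicator {v<..} y \<partial>lborel) = f y * (\<integral>\<^sup>+v. f v \<partial>lborel)" .
  qed
  also have "\<dots> = (\<integral>\<^sup>+y. f y \<partial>lborel) * (\<integral>\<^sup>+y. f y \<partial>lborel)" by (rule nn_integral_multc) measurable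
  finally show ?thesis .
qed

lemma nn_integral_Gamma_scaled:
  assumes p: "p \<ge> 0"
  shows "(\<integral>\<^sup>+v. ennreal (indicator {0..} v * (v powr p * exp (- v / 2))) \<partial>lborel) = ennreal (2 powr (p + 1) * Gamma (p + 1))"
proof -
  have "(\<integral>\<^sup>+v. ennreal (indicator {0..} v * (v powr p * exp (- v / 2))) \<partial>lborel) =
    ennreal \<bar>2\<bar> * (\<integral>\<^sup>+v. ennreal (indicator {0..} (0 + 2 * v) * ((0 + 2 * v) powr p * exp (- (0 + 2 * v) / 2))) \<partial>lborel)"
    by (rule nn_integral_real_affine) auto
  also have "(\<integral>\<^sup>+v. ennreal (indicator {0..} (0 + 2 * v) * ((0 + 2 * v) powr p * exp (- (0 + 2 * v) / 2))) \<partial>lborel) =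
     (\<integral>\<^sup>+v. ennreal (2 powr p) * ennreal (indicator {0..} v * v powr (p + 1 - 1) / exp v) \<partial>lborel)"
    by (intro nn_integral_cong) (auto simp: indicator_def powr_mult exp_minus field_simps zero_le_mult_iff simp flip: ennreal_mult)
  also have "\<dots> = ennreal (2 powr p) * ennreal (Gamma (p + 1))"
    using p by (subst nn_integral_cmult) (auto simp: Gamma_conv_nn_integral_real)
  also have "ennreal \<bar>2\<bar> * (ennreal (2 powr p) * ennreal (Gamma (p + 1))) = ennreal (\<bar>2\<bar> * (2 powr p * Gamma (p + 1)))"
  proof -
    have "Gamma (p + 1) > 0" using p by (intro Gamma_real_pos) simp
    thus ?thesis by (subst ennreal_mult[symmetric], simp, simp, subst ennreal_mult[symmetric]) simp_all
  qed
  finally show ?thesis by (simp add: powr_add mult_ac)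
qed

text \<open>The substitution v = y+2\<eta> splits exp(-y-\<eta>) into exp(-y/2) exp(-v/2), and the
  integrand becomes f(y) f(v) on v > y. One factor 1/2 comes from d\<eta>, another from symmetry;
  together they reduce the square of 2^(p+1) Gamma(p+1) to the stated value, the leading coefficient
  of the algebraic term.\<close>

lemma has_bochner_integral_exp_triangle:
  fixes p :: real
  assumes p: "p \<ge> 0"
  shows "has_bochner_integral (lborel \<Otimes>\<^sub>M lborel)
    (\<lambda>(y, \<eta>). indicator {0..} y * (indicator {0..} \<eta> * (exp (- y - \<eta>) * (y powr p * (2 * \<eta> + y) powr p)))) (4 powr p * (Gamma (p + 1))\<^sup>2)"
    (is "has_bochner_integral _ ?F _")
proof (rule has_bochner_integral_nn_integral)
  let ?P = "lborel \<Otimes>\<^sub>M lborel :: (real \<times> real) measure"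
  show "?F \<in> borel_measurable ?P" by measurable
  show "AE x in ?P. 0 \<le> ?F x" by (intro AE_I2) (auto simp: indicator_def)
  show "0 \<le> 4 powr p * (Gamma (p + 1))\<^sup>2" by simp
  define f where "f v = ennreal (indicator {0..} v * (v powr p * exp (- v / 2)))" for v :: real
  have [measurable]: "f \<in> borel_measurable borel" unfolding f_def by measurable
  have G: "Gamma (p + 1) > 0" using p by (intro Gamma_real_pos) simp
  have inner: "(\<integral>\<^sup>+\<eta>. ennreal (?F (y, \<eta>)) \<partial>lborel) = ennreal (1/2) * (\<integral>\<^sup>+v. f y * f v * indicator {y<..} v \<partial>lborel)" for y
  proof -
    have "(\<integral>\<^sup>+v. f y * f v * indicator {y<..} v \<partial>lborel) = ennreal \<bar>2\<bar> * (\<integral>\<^sup>+\<eta>. f y * f (y + 2 * \<eta>) * indicator {y<..} (y + 2 * \<eta>) \<partial>lborel)"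
      by (rule nn_integral_real_affine) auto
    also have "(\<integral>\<^sup>+\<eta>. f y * f (y + 2 * \<eta>) * indicator {y<..} (y + 2 * \<eta>) \<partial>lborel) = (\<integral>\<^sup>+\<eta>. ennreal (?F (y, \<eta>)) \<partial>lborel)"
    proof (rule nn_integral_cong_AE, use AE_lborel_singleton[of "0::real"] in eventually_elim)
      fix \<eta> :: real assume e: "\<eta> \<noteq> 0"
      have ex: "exp (- y / 2) * exp (- (y + 2 * \<eta>) / 2) = exp (- y - \<eta>)" by (simp flip: exp_add add: field_simps)
      show "f y * f (y + 2 * \<eta>) * indicator {y<..} (y + 2 * \<eta>) = ennreal (?F (y, \<eta>))"
      proof (cases "y \<ge> 0 \<and> \<eta> > 0")
        case True
        hence "f y * f (y + 2 * \<eta>) * indicator {y<..} (y + 2 * \<eta>) =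
           ennreal ((y powr p * exp (- y / 2)) * ((y + 2 * \<eta>) powr p * exp (- (y + 2 * \<eta>) / 2)))"
          by (simp add: f_def ennreal_mult)
        also have "(y powr p * exp (- y / 2)) * ((y + 2 * \<eta>) powr p * exp (- (y + 2 * \<eta>) / 2)) =
           (exp (- y / 2) * exp (- (y + 2 * \<eta>) / 2)) * (y powr p * (2 * \<eta> + y) powr p)"
          by (simp only: mult_ac add.commute)
        also have "\<dots> = ?F (y, \<eta>)" unfolding ex using True by simp
        finally show ?thesis .
      next
        case False
        thus ?thesis using e by (auto simp: f_def indicator_def)
      qed
    qed
    finally have "(\<integral>\<^sup>+v. f y * f v * indicator {y<..} v \<partial>lborel) = ennreal 2 * (\<integral>\<^sup>+\<eta>. ennreal (?F (y, \<eta>)) \<partial>lborel)" by simp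
    hence "ennreal (1/2) * (\<integral>\<^sup>+v. f y * f v * indicator {y<..} v \<partial>lborel) = (ennreal (1/2) * ennreal 2) * (\<integral>\<^sup>+\<eta>. ennreal (?F (y, \<eta>)) \<partial>lborel)"
      by (simp only: mult.assoc)
    also have "ennreal (1/2) * ennreal 2 = 1" by (simp only: ennreal_mult''[symmetric]) simp
    finally show ?thesis by simp
  qed
  have "(\<integral>\<^sup>+x. ennreal (?F x) \<partial>?P) = (\<integral>\<^sup>+y. (\<integral>\<^sup>+\<eta>. ennreal (?F (y, \<eta>)) \<partial>lborel) \<partial>lborel)"
    by (rule lborel.nn_integral_fst[symmetric]) measurable
  also have "\<dots> = (\<integral>\<^sup>+y. ennreal (1/2) * (\<integral>\<^sup>+v. f y * f v * indicator {y<..} v \<partial>lborel) \<partial>lborel)"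
    unfolding inner ..
  also have "\<dots> = ennreal (1/2) * (\<integral>\<^sup>+y. (\<integral>\<^sup>+v. f y * f v * indicator {y<..} v \<partial>lborel) \<partial>lborel)"
  proof (rule nn_integral_cmult)
    have ind: "indicator {y<..} v = (if y < v then 1 else 0 :: ennreal)" for y v :: real by (simp add: indicator_def)
    show "(\<lambda>y. \<integral>\<^sup>+v. f y * f v * indicator {y<..} v \<partial>lborel) \<in> borel_measurable lborel"
      unfolding ind by measurable
  qed
  also have "\<dots> = ennreal (1/4) * (2 * (\<integral>\<^sup>+y. (\<integral>\<^sup>+v. f y * f v * indicator {y<..} v \<partial>lborel) \<partial>lborel))"
  proof -
    have "ennreal (1/4) * 2 = ennreal (1/2)" by (simp only: ennreal_numeral[symmetric] ennreal_mult''[symmetric]) simp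
    thus ?thesis by (simp only: mult.assoc[symmetric])
  qed
  also have "\<dots> = ennreal (1/4) * (ennreal (2 powr (p + 1) * Gamma (p + 1)) * ennreal (2 powr (p + 1) * Gamma (p + 1)))"
    unfolding nn_integral_symmetric_half[OF \<open>f \<in> borel_measurable borel\<close>] unfolding f_def nn_integral_Gamma_scaled[OF p] ..
  also have "\<dots> = ennreal (1/4 * ((2 powr (p + 1) * Gamma (p + 1)) * (2 powr (p + 1) * Gamma (p + 1))))"
    using G by (simp only: ennreal_mult[symmetric] mult_nonneg_nonneg powr_ge_zero less_imp_le)
  also have "1/4 * ((2 powr (p + 1) * Gamma (p + 1)) * (2 powr (p + 1) * Gamma (p + 1))) = 4 powr p * (Gamma (p + 1))\<^sup>2"
  proof -
    have "4 powr p = (2 powr p * 2 powr p :: real)" using powr_mult[of 2 2 p] by simp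
    thus ?thesis by (simp add: powr_add power2_eq_square)
  qed
  finally show "(\<integral>\<^sup>+x. ennreal (?F x) \<partial>?P) = ennreal (4 powr p * (Gamma (p + 1))\<^sup>2)" .
qed

section \<open>Complex powers near 1\<close>

lemma one_plus_powr_minus_1:
  fixes v c :: real
  assumes "v \<ge> 0" "c \<ge> 0"
  shows "\<bar>(1 + v) powr c - 1\<bar> \<le> c * v * (1 + v) powr c"
proof -
  have "1 - exp (- (c * ln (1 + v))) \<le> c * ln (1 + v)" using exp_ge_add_one_self[of "- (c * ln (1 + v))"] by simp
  also have "\<dots> \<le> c * v" using assms by (intro mult_left_mono ln_add_one_self_le_self) auto
  finally have "(1 + v) powr c * (1 - exp (- (c * ln (1 + v)))) \<le> (1 + v) powr c * (c * v)" by (intro mult_left_mono) auto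
  moreover have "(1 + v) powr c * exp (- (c * ln (1 + v))) = 1" using assms by (simp add: powr_def flip: exp_add)
  moreover have "(1 + v) powr c \<ge> 1" using assms by (intro ge_one_powr_ge_zero) auto
  ultimately show ?thesis by (simp add: algebra_simps)
qed

lemma cpow_one_plus_ii:
  fixes u :: real
  shows "cpow (1 + \<i> * of_real u) b = of_real ((1 + u\<^sup>2) powr (b / 2)) * cis (b * arctan u)"
proof -
  have pos: "1 + u\<^sup>2 > 0" by (simp add: add_pos_nonneg)
  have "1 + \<i> * of_real u = of_real (sqrt (1 + u\<^sup>2)) * cis (arctan u)"
    using pos by (auto simp: complex_eq_iff cos_arctan sin_arctan)
  hence L: "Ln (1 + \<i> * of_real u) = of_real (ln (sqrt (1 + u\<^sup>2))) + \<i> * of_real (arctan u)"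
    using pos arctan_lbound[of u] arctan_ubound[of u] pi_gt_zero
    by (intro Ln_unique) (simp_all add: exp_add cis_conv_exp exp_of_real del: pi_gt_zero)
  have nz: "1 + \<i> * of_real u \<noteq> 0" by (simp add: complex_eq_iff)
  have "(1 + u\<^sup>2) powr (b / 2) = exp (b * ln (sqrt (1 + u\<^sup>2)))"
    using pos by (simp add: powr_def ln_sqrt)
  thus ?thesis
    using nz by (simp add: cpow_def powr_def L cis_conv_exp algebra_simps exp_add exp_of_real[symmetric] del: exp_of_real)
qed

text \<open>In the polar form (1+u^2)^(b/2) cis(b arctan u) the modulus and the cosine differ from 1
  only to second order in u; the first-order part is imaginary. Real parts therefore gain one power
  of u over the norm.\<close>

lemma cpow_one_plus_ii_bounds:
  fixes u b :: real
  assumes b: "b \<ge> 0" and u: "u \<ge> 0"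
  shows "\<bar>Re (cpow (1 + \<i> * of_real u) b) - 1\<bar> \<le> (b + b\<^sup>2) * u\<^sup>2 * (1 + u) powr b"
    and "\<bar>Re (cpow (1 - \<i> * of_real u) b) - 1\<bar> \<le> (b + b\<^sup>2) * u\<^sup>2 * (1 + u) powr b"
    and "norm (cpow (1 + \<i> * of_real u) b - 1) \<le> (b + b\<^sup>2 + b) * u * (1 + u) powr (b + 1)"
proof -
  define R where "R = (1 + u\<^sup>2) powr (b / 2)"
  have at: "\<bar>arctan u\<bar> \<le> u" using u arctan_le_self[of u] by simp
  have R: "R \<ge> 0" "\<bar>R - 1\<bar> \<le> b / 2 * u\<^sup>2 * R" "R \<le> (1 + u) powr b"
  proof -
    show "R \<ge> 0" by (simp add: R_def)
    show "\<bar>R - 1\<bar> \<le> b / 2 * u\<^sup>2 * R" unfolding R_def using b by (intro one_plus_powr_minus_1) auto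
    have "1 + u\<^sup>2 \<le> (1 + u)\<^sup>2" using u by (simp add: power2_eq_square algebra_simps)
    hence "R \<le> ((1 + u)\<^sup>2) powr (b / 2)" unfolding R_def using b by (intro powr_mono2) auto
    also have "((1 + u)\<^sup>2) powr (b / 2) = (1 + u) powr b" using u by (simp add: powr_powr flip: powr_numeral)
    finally show "R \<le> (1 + u) powr b" .
  qed
  have c1: "\<bar>R * cos (b * arctan u) - 1\<bar> \<le> (b + b\<^sup>2) * u\<^sup>2 * (1 + u) powr b"
  proof -
    have "1 - cos (b * arctan u) \<le> (b * arctan u)\<^sup>2 / 2" 
    proof -
      have "\<bar>sin (b * arctan u / 2)\<bar> \<le> \<bar>b * arctan u / 2\<bar>" by (rule abs_sin_x_le_abs_x)
      from power_mono[OF this, of 2] have "(sin (b * arctan u / 2))\<^sup>2 \<le> (b * arctan u)\<^sup>2 / 4"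
        by (simp add: power_divide)
      thus ?thesis using cos_double_sin[of "b * arctan u / 2"] by simp
    qed
    also have "\<dots> \<le> b\<^sup>2 * u\<^sup>2 / 2"
      using power_mono[OF at, of 2] by (simp add: power_mult_distrib mult_left_mono)
    finally have 1: "\<bar>1 - cos (b * arctan u)\<bar> \<le> b\<^sup>2 * u\<^sup>2 / 2" using cos_le_one[of "b * arctan u"] by linarith
    have "R * cos (b * arctan u) - 1 = (R - 1) - R * (1 - cos (b * arctan u))" by (simp add: algebra_simps)
    also have "\<bar>\<dots>\<bar> \<le> \<bar>R - 1\<bar> + R * \<bar>1 - cos (b * arctan u)\<bar>" 
      using R(1) abs_triangle_ineq4[of "R - 1" "R * (1 - cos (b * arctan u))"] by (simp only: abs_mult abs_of_nonneg)
    also have "\<dots> \<le> b / 2 * u\<^sup>2 * R + R * (b\<^sup>2 * u\<^sup>2 / 2)" using R 1 by (intro add_mono mult_left_mono) auto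
    also have "\<dots> = ((b + b\<^sup>2) * u\<^sup>2 / 2) * R" by (simp add: algebra_simps)
    also have "\<dots> \<le> ((b + b\<^sup>2) * u\<^sup>2) * (1 + u) powr b"
      using b R by (intro mult_mono) (auto intro!: mult_nonneg_nonneg)
    finally show ?thesis .
  qed
  show "\<bar>Re (cpow (1 + \<i> * of_real u) b) - 1\<bar> \<le> (b + b\<^sup>2) * u\<^sup>2 * (1 + u) powr b"
    using c1 by (simp add: cpow_one_plus_ii R_def)
  show "\<bar>Re (cpow (1 - \<i> * of_real u) b) - 1\<bar> \<le> (b + b\<^sup>2) * u\<^sup>2 * (1 + u) powr b"
    using c1 cpow_one_plus_ii[of "- u" b] by (simp add: R_def arctan_minus)
  have "norm (cpow (1 + \<i> * of_real u) b - 1) \<le> \<bar>R * cos (b * arctan u) - 1\<bar> + \<bar>R * sin (b * arctan u)\<bar>"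
    unfolding cpow_one_plus_ii R_def[symmetric] using cmod_le[of "of_real R * cis (b * arctan u) - 1"] by simp
  also have "\<bar>R * sin (b * arctan u)\<bar> \<le> (1 + u) powr b * (b * u)"
  proof -
    have "\<bar>sin (b * arctan u)\<bar> \<le> \<bar>b * arctan u\<bar>" by (rule abs_sin_x_le_abs_x)
    also have "\<dots> \<le> b * u" using b at by (simp add: abs_mult mult_left_mono)
    finally show ?thesis unfolding abs_mult using R by (intro mult_mono) auto
  qed
  also have "\<bar>R * cos (b * arctan u) - 1\<bar> \<le> (b + b\<^sup>2) * u\<^sup>2 * (1 + u) powr b" by (rule c1)
  also have "(b + b\<^sup>2) * u\<^sup>2 * (1 + u) powr b + (1 + u) powr b * (b * u) \<le>
      (b + b\<^sup>2) * (u * (1 + u)) * (1 + u) powr b + (1 + u) powr b * (b * (u * (1 + u)))"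
    using b u by (intro add_mono mult_right_mono mult_left_mono) (auto simp: power2_eq_square algebra_simps)
  also have "\<dots> = (b + b\<^sup>2 + b) * u * (1 + u) powr (b + 1)" using u by (simp add: powr_add algebra_simps)
  finally show "norm (cpow (1 + \<i> * of_real u) b - 1) \<le> (b + b\<^sup>2 + b) * u * (1 + u) powr (b + 1)" by simp
qed

section \<open>Exact formula for \<Lambda> by two plane integrals, and its expansion\<close>

lemma AE_pair_nonzero: "AE q in (lborel \<Otimes>\<^sub>M lborel :: (real \<times> real) measure). fst q \<noteq> 0 \<and> snd q \<noteq> 0"
proof (rule lborel_pair.AE_pair_measure)
  show "AE x in lborel. AE y in lborel. fst (x, y) \<noteq> (0::real) \<and> snd (x, y) \<noteq> (0::real)"
    using AE_lborel_singleton[of "0::real"]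
  proof eventually_elim
    case (elim x)
    show ?case using AE_lborel_singleton[of "0::real"] by eventually_elim (use elim in auto)
  qed
qed measurable

text \<open>To be used with p = (d-1)/2 and \<beta> = \<alpha>-1. It is the Beta mixture with
  parameters 2p+2 and \<beta>+1, stretched to [0,x]: in (2p+2)_{2k} = 4^k (p+1)_k (p+3/2)_k the last
  factor cancels the lower symbol of \<Omega> and (p+1)_k stays as the numerator.\<close>

lemma \<Lambda>_series_fractional_integral:
  fixes p \<beta> x :: real
  assumes p: "p \<ge> 0" and \<beta>: "\<beta> > 0" and x: "x > 0"
  shows "has_bochner_integral lborel (\<lambda>t. indicator {0..x} t * ((x - t) powr \<beta> * (t powr (2 * p + 1) * \<Omega> (p + 1/2) t)))
    (x powr (2 * p + 2 + \<beta>) * (Beta (2 * p + 2) (\<beta> + 1) * \<Lambda>_series (p + 1) (2 * p + 3 + \<beta>) x))"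
proof -
  have c': "\<Lambda>_coeff (p + 1) (2 * p + 3 + \<beta>) k = \<Omega>_coeff (p + 1/2) k * pochhammer (2 * p + 2) (2 * k) / pochhammer (2 * p + 2 + (\<beta> + 1)) (2 * k)" for k
  proof -
    have n: "real (2 ^ (2 * k)) = 4 ^ k" "2 * (p + 1) = 2 * p + 2" "p + 1 + 1/2 = p + 3/2" "p + 1/2 + 1 = p + 3/2"
      "2 * p + 2 + (\<beta> + 1) = 2 * p + 3 + \<beta>" by (simp_all add: power_mult)
    have "pochhammer (2 * p + 2) (2 * k) = 4 ^ k * pochhammer (p + 1) k * pochhammer (p + 3/2) k"
      using pochhammer_double[of "p + 1" k] by (simp only: n)
    moreover have "pochhammer (p + 3/2) k > 0" using p by (intro pochhammer_pos) simp
    ultimately show ?thesis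
      unfolding \<Lambda>_coeff_def \<Omega>_coeff_def n by (simp add: power_divide power_minus[of "1/4"])
  qed
  have so: "summable (\<lambda>k. norm (\<Omega>_coeff (p + 1/2) k * z ^ k))" for z
    using p by (intro summable_\<Omega>_coeff) simp
  have B: "has_bochner_integral lborel
     (\<lambda>t. indicator {0..1} t * (\<Omega> (p + 1/2) (x * t) * (t powr (2 * p + 1) * (1 - t) powr \<beta>)))
     (Beta (2 * p + 2) (\<beta> + 1) * \<Lambda>_series (p + 1) (2 * p + 3 + \<beta>) x)"
    using Beta_mixture[OF so _ _ c', of x] p \<beta> by (simp add: \<Lambda>_series_def \<Omega>_eq_suminf add.commute[of "2 * p" 1])
  have "has_bochner_integral lborel
     (\<lambda>t. x powr (2 * p + 1 + \<beta>) * (indicator {0..1} (0 + (1/x) *\<^sub>R t) * (\<Omega> (p + 1/2) (x * (0 + (1/x) *\<^sub>R t)) * ((0 + (1/x) *\<^sub>R t) powr (2 * p + 1) * (1 - (0 + (1/x) *\<^sub>R t)) powr \<beta>))))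
     (x powr (2 * p + 1 + \<beta>) * (Beta (2 * p + 2) (\<beta> + 1) * \<Lambda>_series (p + 1) (2 * p + 3 + \<beta>) x / (1/x) ^ DIM(real)))"
    using x by (intro has_bochner_integral_mult_right has_bochner_integral_affine[OF B]) simp
  also have "x powr (2 * p + 1 + \<beta>) * (Beta (2 * p + 2) (\<beta> + 1) * \<Lambda>_series (p + 1) (2 * p + 3 + \<beta>) x / (1/x) ^ DIM(real)) =
     x powr (2 * p + 2 + \<beta>) * (Beta (2 * p + 2) (\<beta> + 1) * \<Lambda>_series (p + 1) (2 * p + 3 + \<beta>) x)"
  proof -
    have "x powr (2 * p + 2 + \<beta>) = x powr (2 * p + 1 + \<beta>) * x" using x by (simp add: powr_mult_base add_ac mult.commute[of _ x])
    thus ?thesis by simp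
  qed
  also have "(\<lambda>t. x powr (2 * p + 1 + \<beta>) * (indicator {0..1} (0 + (1/x) *\<^sub>R t) * (\<Omega> (p + 1/2) (x * (0 + (1/x) *\<^sub>R t)) * ((0 + (1/x) *\<^sub>R t) powr (2 * p + 1) * (1 - (0 + (1/x) *\<^sub>R t)) powr \<beta>)))) =
    (\<lambda>t. indicator {0..x} t * ((x - t) powr \<beta> * (t powr (2 * p + 1) * \<Omega> (p + 1/2) t)))"
  proof (rule ext)
    fix t
    show "x powr (2 * p + 1 + \<beta>) * (indicator {0..1} (0 + (1/x) *\<^sub>R t) * (\<Omega> (p + 1/2) (x * (0 + (1/x) *\<^sub>R t)) * ((0 + (1/x) *\<^sub>R t) powr (2 * p + 1) * (1 - (0 + (1/x) *\<^sub>R t)) powr \<beta>))) =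
      indicator {0..x} t * ((x - t) powr \<beta> * (t powr (2 * p + 1) * \<Omega> (p + 1/2) t))"
    proof (cases "t \<in> {0..x}")
      case True
      have "x powr \<beta> * (1 - t / x) powr \<beta> = (x - t) powr \<beta>"
      proof -
        have "x * (1 - t / x) = x - t" "1 - t / x \<ge> 0" using x True by (auto simp: field_simps)
        thus ?thesis using x by (metis powr_mult less_imp_le)
      qed
      moreover have "x powr (2 * p + 1) * (t / x) powr (2 * p + 1) = t powr (2 * p + 1)"
        using x True by (simp add: powr_divide)
      moreover have "indicator {0..1} (t / x) = (1::real)" using x True by (auto simp: indicator_def)
      moreover have "x powr (2 * p + 1 + \<beta>) * (indicator {0..1} (t / x) * (\<Omega> (p + 1/2) t * ((t / x) powr (2 * p + 1) * (1 - t / x) powr \<beta>))) =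
         indicator {0..1} (t / x) * ((x powr \<beta> * (1 - t / x) powr \<beta>) * ((x powr (2 * p + 1) * (t / x) powr (2 * p + 1)) * \<Omega> (p + 1/2) t))"
        unfolding powr_add[of x "2 * p + 1" \<beta>] by (simp only: mult_ac)
      ultimately show ?thesis using True x by simp
    next
      case False
      hence "indicator {0..1} (t / x) = (0::real)" using x by (auto simp: indicator_def field_simps)
      thus ?thesis using False by simp
    qed
  qed
  finally show ?thesis .
qed

text \<open>Inserting the previous two formulas into one another, the path of the outer variable \<open>t \<in> [0, x]\<close> is moved as well:
  the ray above 0 gives the algebraic term and the ray above \<open>x\<close> the oscillating one.\<close>
lemma \<Lambda>_series_rotated:
  fixes p \<beta> x :: real
  assumes p: "p \<ge> 0" and \<beta>: "\<beta> > 0" and x: "x > 0"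
  defines "F1 \<equiv> \<lambda>(y, \<eta>). of_real (indicator {0..} y * (indicator {0..} \<eta> * (exp (- y - \<eta>) * (y powr p * (2 * \<eta> + y) powr p)))) * cpow (of_real x - \<i> * of_real \<eta>) \<beta>"
    and "F2 \<equiv> \<lambda>(y, \<eta>). of_real (indicator {0..} y * (indicator {0..} \<eta> * (exp (- y - \<eta>) * (y powr p * \<eta> powr \<beta>)))) * cpow (2 * of_real x + \<i> * of_real (2 * \<eta> + y)) p"
  shows "4 powr p * (Gamma (p + 1))\<^sup>2 * Gamma (\<beta> + 1) / Gamma (2 * p + 3 + \<beta>) * (x powr (2 * p + 2 + \<beta>) * \<Lambda>_series (p + 1) (2 * p + 3 + \<beta>) x) =
    Re (LINT q|(lborel \<Otimes>\<^sub>M lborel). F1 q) - Re (exp (\<i> * of_real x) * cis (- ((p + \<beta>) * pi / 2)) * (LINT q|(lborel \<Otimes>\<^sub>M lborel). F2 q))"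
proof -
  let ?P = "lborel \<Otimes>\<^sub>M lborel :: (real \<times> real) measure"
  define M0 where "M0 = 2 * 4 powr p * (Gamma (p + 1))\<^sup>2 / Gamma (2 * p + 2)"
  have G: "Gamma (2 * p + 2) > 0" using p by (intro Gamma_real_pos) simp
  define E where "E y = of_real (indicator {0..} y) * (exp (- of_real y) * cpow (- (\<i> * of_real y)) p)" for y :: real
  have [measurable]: "E \<in> borel_measurable borel" unfolding E_def by measurable
  have nE: "norm (E y) \<le> indicator {0..} y * (exp (- y) * (1 + y) powr p)" for y
    using norm_cpow_le[OF p, of "- (\<i> * of_real y)"] by (auto simp: E_def indicator_def norm_mult intro!: mult_left_mono)
  have np: "norm (cpow w r) \<le> (A * B) powr r" if "r \<ge> 0" "1 + norm w \<le> A * B" for w r A B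
    using norm_cpow_le[OF that(1), of w] powr_mono2[OF that(1) _ that(2)] by (simp add: add_nonneg_nonneg)
  \<comment> \<open>The outer integrand in t times the inner integrand in y from the rotated formula
    for \<Omega>; \<open>E y\<close> collects the factors that depend on y alone.\<close>
  define h where "h = (\<lambda>(t, y). of_real (indicator {0..x} t * (x - t) powr \<beta>) * exp (\<i> * of_real t) * (E y * cpow (2 * of_real t + \<i> * of_real y) p))"
  have [measurable]: "h \<in> borel_measurable (borel \<Otimes>\<^sub>M borel)" unfolding h_def case_prod_unfold by measurable
  have hint: "integrable ?P h"
  proof (rule integrable_pair_bound(1))
    show "integrable lborel (\<lambda>t. indicator {0..x} t * (x powr \<beta> * (1 + 2 * x) powr p))"
      by (intro integrable_mult_left integrable_real_indicator) (auto simp: emeasure_lborel_Icc_eq)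
    show "integrable lborel (\<lambda>y::real. indicator {0..} y * (exp (- y) * (1 + y) powr (2 * p)))" by (rule integrable_exp_powr)
    fix t y
    show "norm (h (t, y)) \<le> indicator {0..x} t * (x powr \<beta> * (1 + 2 * x) powr p) * (indicator {0..} y * (exp (- y) * (1 + y) powr (2 * p)))"
    proof (cases "t \<in> {0..x} \<and> y \<ge> 0")
      case False
      thus ?thesis by (auto simp: h_def E_def)
    next
      case True
      have "norm (2 * of_real t + \<i> * of_real y) \<le> 2 * t + y"
        using cmod_le[of "2 * of_real t + \<i> * of_real y"] True by simp
      moreover have "1 + (2 * t + y) \<le> (1 + 2 * x) * (1 + y)"
      proof -
        have "0 \<le> 2 * x * y" using True x by simp
        moreover have "(1 + 2 * x) * (1 + y) = 1 + 2 * x + y + 2 * x * y" by (simp add: algebra_simps)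
        moreover have "t \<le> x" using True by simp
        ultimately show ?thesis by linarith
      qed
      ultimately have c: "norm (cpow (2 * of_real t + \<i> * of_real y) p) \<le> ((1 + 2 * x) * (1 + y)) powr p"
        by (intro np p) linarith
      have "norm (h (t, y)) = (x - t) powr \<beta> * (norm (E y) * norm (cpow (2 * of_real t + \<i> * of_real y) p))"
        using True by (simp add: h_def norm_mult)
      also have "\<dots> \<le> x powr \<beta> * ((exp (- y) * (1 + y) powr p) * ((1 + 2 * x) * (1 + y)) powr p)"
        using True \<beta> nE[of y] c by (intro mult_mono powr_mono2) auto
      also have "\<dots> = x powr \<beta> * (1 + 2 * x) powr p * (exp (- y) * ((1 + y) powr p * (1 + y) powr p))"
        using True x by (simp add: powr_mult mult_ac)
      also have "(1 + y) powr p * (1 + y) powr p = (1 + y) powr (2 * p)" unfolding mult_2[of p] by (rule powr_add[symmetric])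
      finally show ?thesis using True by simp
    qed
  qed measurable
  define Z where "Z = (LINT q|?P. h q)"
  have Z1: "M0 * (x powr (2 * p + 2 + \<beta>) * (Beta (2 * p + 2) (\<beta> + 1) * \<Lambda>_series (p + 1) (2 * p + 3 + \<beta>) x)) = 2 * Re (- \<i> * Z)"
  proof -
    have inner: "(LINT y|lborel. h (t, y)) = of_real (indicator {0..x} t * (x - t) powr \<beta>) * exp (\<i> * of_real t) *
        (LINT y:{0..}|lborel. exp (- of_real y) * cpow (- (\<i> * of_real y)) p * cpow (2 * of_real t + \<i> * of_real y) p)" for t
      unfolding set_lebesgue_integral_def h_def prod.case E_def integral_mult_right_zero[symmetric]
      by (intro Bochner_Integration.integral_cong) (auto simp: indicator_def mult_ac)
    have fi: "integrable lborel (\<lambda>t. LINT y|lborel. h (t, y))" by (rule lborel_pair.integrable_fst'[OF hint])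
    have "Z = (LINT t|lborel. LINT y|lborel. h (t, y))" unfolding Z_def by (rule lborel_pair.integral_fst'[OF hint, symmetric])
    hence "2 * Re (- \<i> * Z) = (LINT t|lborel. 2 * Re (- \<i> * (LINT y|lborel. h (t, y))))"
      using integral_Re[of lborel "\<lambda>t. - \<i> * (LINT y|lborel. h (t, y))"] fi by simp
    also have "\<dots> = (LINT t|lborel. M0 * (indicator {0..x} t * ((x - t) powr \<beta> * (t powr (2 * p + 1) * \<Omega> (p + 1/2) t))))"
    proof (rule integral_cong_AE)
      show "(\<lambda>t. 2 * Re (- \<i> * (LINT y|lborel. h (t, y)))) \<in> borel_measurable lborel" using borel_measurable_integrable[OF fi] by measurable
      show "(\<lambda>t. M0 * (indicator {0..x} t * ((x - t) powr \<beta> * (t powr (2 * p + 1) * \<Omega> (p + 1/2) t)))) \<in> borel_measurable lborel"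
      proof -
        have "p + 1/2 > -1" using p by simp
        note [measurable] = borel_measurable_\<Omega>[OF this]
        show ?thesis by measurable
      qed
      show "AE t in lborel. 2 * Re (- \<i> * (LINT y|lborel. h (t, y))) = M0 * (indicator {0..x} t * ((x - t) powr \<beta> * (t powr (2 * p + 1) * \<Omega> (p + 1/2) t)))"
        using AE_lborel_singleton[of "0::real"]
      proof eventually_elim
        case (elim t)
        show ?case
        proof (cases "t \<in> {0..x}")
          case True
          hence t: "t > 0" using elim by auto
          define Y where "Y = (LINT y:{0..}|lborel. exp (- of_real y) * cpow (- (\<i> * of_real y)) p * cpow (2 * of_real t + \<i> * of_real y) p)"
          have "M0 * (t powr (2 * p + 1) * \<Omega> (p + 1/2) t) = 2 * Re (- \<i> * exp (\<i> * of_real t) * Y)"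
            unfolding M0_def Y_def by (rule \<Omega>_rotated[OF p t])
          moreover have "2 * Re (- \<i> * (LINT y|lborel. h (t, y))) = (x - t) powr \<beta> * (2 * Re (- \<i> * exp (\<i> * of_real t) * Y))"
          proof -
            have "- \<i> * (LINT y|lborel. h (t, y)) = of_real ((x - t) powr \<beta>) * (- \<i> * exp (\<i> * of_real t) * Y)"
              unfolding inner Y_def[symmetric] using True by simp
            moreover have "Re (of_real r * w) = r * Re w" for r w by simp
            ultimately show ?thesis by (simp only: mult.left_commute)
          qed
          ultimately show ?thesis using True by (simp add: mult_ac)
        next
          case False
          thus ?thesis by (simp add: inner)
        qed
      qed
    qed
    also have "\<dots> = M0 * (x powr (2 * p + 2 + \<beta>) * (Beta (2 * p + 2) (\<beta> + 1) * \<Lambda>_series (p + 1) (2 * p + 3 + \<beta>) x))"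
      using \<Lambda>_series_fractional_integral[OF p \<beta> x] by (simp add: has_bochner_integral_iff)
    finally show ?thesis by simp
  qed
  \<comment> \<open>For fixed y, the part depending on t continued to complex z. The factor
    (2z+iy)^p branches at -iy/2, which for y \<ge> 0 lies below the strip or at its corner 0; the
    other factor branches at the corner x.\<close>
  define g where "g y z = cpow (of_real x - z) \<beta> * exp (\<i> * z) * cpow (2 * z + \<i> * of_real y) p" for y :: real and z
  define ga where "ga = (\<lambda>(y, \<eta>). of_real (indicator {0..} \<eta>) * (E y * g y (Complex 0 \<eta>)))"
  define gb where "gb = (\<lambda>(y, \<eta>). of_real (indicator {0..} \<eta>) * (E y * g y (Complex x \<eta>)))"
  have gbound: "norm (g y z) \<le> (1 + x) powr \<beta> * (2 * (1 + x)) powr p * (1 + y) powr p * (exp (- Im z) * (1 + Im z) powr (\<beta> + p))"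
    if y: "y \<ge> 0" and z: "0 \<le> Re z" "Re z \<le> x" "0 \<le> Im z" for y z
  proof -
    have n1: "1 + norm (of_real x - z) \<le> (1 + x) * (1 + Im z)"
    proof -
      have "norm (of_real x - z) \<le> \<bar>x - Re z\<bar> + \<bar>Im z\<bar>" using cmod_le[of "of_real x - z"] by simp
      moreover have "(1 + x) * (1 + Im z) = 1 + x + Im z + x * Im z" by (simp add: algebra_simps)
      moreover have "0 \<le> x * Im z" using x z by simp
      ultimately show ?thesis using z by linarith
    qed
    have n2: "1 + norm (2 * z + \<i> * of_real y) \<le> (2 * (1 + x)) * ((1 + Im z) * (1 + y))"
    proof -
      have "norm (2 * z + \<i> * of_real y) \<le> \<bar>2 * Re z\<bar> + \<bar>2 * Im z + y\<bar>" using cmod_le[of "2 * z + \<i> * of_real y"] by simp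
      moreover have "(2 * (1 + x)) * ((1 + Im z) * (1 + y)) =
        2 + 2 * x + 2 * Im z + 2 * y + 2 * (x * Im z) + 2 * (x * y) + 2 * (Im z * y) + 2 * (x * (Im z * y))"
        by (simp add: algebra_simps)
      moreover have "0 \<le> x * Im z" "0 \<le> x * y" "0 \<le> Im z * y" "0 \<le> x * (Im z * y)" using x y z by auto
      ultimately show ?thesis using z y by linarith
    qed
    have "norm (g y z) = norm (cpow (of_real x - z) \<beta>) * exp (- Im z) * norm (cpow (2 * z + \<i> * of_real y) p)"
      by (simp add: g_def norm_mult)
    also have "\<dots> \<le> ((1 + x) * (1 + Im z)) powr \<beta> * exp (- Im z) * ((2 * (1 + x)) * ((1 + Im z) * (1 + y))) powr p"
      using \<beta> p by (intro mult_mono np n1 n2) auto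
    also have "\<dots> = (1 + x) powr \<beta> * (2 * (1 + x)) powr p * (1 + y) powr p * (exp (- Im z) * ((1 + Im z) powr \<beta> * (1 + Im z) powr p))"
      using x y z by (simp add: powr_mult mult_ac)
    also have "(1 + Im z) powr \<beta> * (1 + Im z) powr p = (1 + Im z) powr (\<beta> + p)" by (rule powr_add[symmetric])
    finally show ?thesis .
  qed
  let ?C = "(1 + x) powr \<beta> * (2 * (1 + x)) powr p"
  have gint: "integrable ?P (\<lambda>(y, \<eta>). of_real (indicator {0..} \<eta>) * (E y * g y (Complex c \<eta>)))" if c: "0 \<le> c" "c \<le> x" for c
  proof (rule integrable_pair_bound(1))
    show "(\<lambda>(y, \<eta>). of_real (indicator {0..} \<eta>) * (E y * g y (Complex c \<eta>))) \<in> borel_measurable (borel \<Otimes>\<^sub>M borel)"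
      unfolding g_def case_prod_unfold Complex_eq by measurable
    show "integrable lborel (\<lambda>y::real. ?C * (indicator {0..} y * (exp (- y) * (1 + y) powr (2 * p))))"
      by (intro integrable_mult_right integrable_exp_powr)
    show "integrable lborel (\<lambda>\<eta>::real. indicator {0..} \<eta> * (exp (- \<eta>) * (1 + \<eta>) powr (\<beta> + p)))" by (rule integrable_exp_powr)
    fix y \<eta> :: real
    show "norm (case (y, \<eta>) of (y, \<eta>) \<Rightarrow> of_real (indicator {0..} \<eta>) * (E y * g y (Complex c \<eta>))) \<le>
      ?C * (indicator {0..} y * (exp (- y) * (1 + y) powr (2 * p))) * (indicator {0..} \<eta> * (exp (- \<eta>) * (1 + \<eta>) powr (\<beta> + p)))"
    proof (cases "y \<ge> 0 \<and> \<eta> \<ge> 0")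
      case False
      thus ?thesis by (auto simp: E_def)
    next
      case True
      have "norm (E y) * norm (g y (Complex c \<eta>)) \<le> (exp (- y) * (1 + y) powr p) * (?C * (1 + y) powr p * (exp (- \<eta>) * (1 + \<eta>) powr (\<beta> + p)))"
        using True nE[of y] gbound[of y "Complex c \<eta>"] c by (intro mult_mono) auto
      also have "\<dots> = ?C * (exp (- y) * ((1 + y) powr p * (1 + y) powr p)) * (exp (- \<eta>) * (1 + \<eta>) powr (\<beta> + p))"
        by (simp only: mult_ac)
      also have "(1 + y) powr p * (1 + y) powr p = (1 + y) powr (2 * p)" unfolding mult_2[of p] by (rule powr_add[symmetric])
      finally show ?thesis using True by (simp add: norm_mult)
    qed
  qed
  have gaint: "integrable ?P ga" "integrable ?P gb" unfolding ga_def gb_def using gint[of 0] gint[of x] x by auto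
  have rot: "(LINT t|lborel. h (t, y)) = \<i> * ((LINT \<eta>|lborel. ga (y, \<eta>)) - (LINT \<eta>|lborel. gb (y, \<eta>)))" for y
  proof (cases "y \<ge> 0")
    case False
    thus ?thesis by (simp add: h_def ga_def gb_def E_def)
  next
    case y: True
    define G where "G Y = ?C * (1 + y) powr p * (exp (- Y) * (1 + Y) powr (\<beta> + p))" for Y :: real
    have cont: "continuous_on {z. 0 \<le> Re z \<and> Re z \<le> x \<and> 0 \<le> Im z} (g y)"
      unfolding g_def[abs_def] using p \<beta> y by (intro continuous_on_mult continuous_on_cpow continuous_intros) auto
    have hol: "g y field_differentiable at z" if "0 < Re z" "Re z < x" "0 < Im z" for z
      unfolding g_def[abs_def] using that
      by (intro field_differentiable_mult field_differentiable_cpow derivative_intros field_differentiable_within_exp field_differentiable_compose[of _ _ exp, unfolded o_def])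
         (auto intro!: derivative_intros field_differentiable_within_exp)
    have bnd: "norm (g y z) \<le> G (Im z)" if "0 \<le> Re z" "Re z \<le> x" "0 \<le> Im z" for z
      unfolding G_def by (rule gbound[OF y that])
    have Gi: "set_integrable lborel {0..} G"
      using integrable_mult_right[OF integrable_exp_powr[of "\<beta> + p"], of "?C * (1 + y) powr p"]
      by (simp add: set_integrable_def G_def mult_ac)
    have G0: "(G \<longlongrightarrow> 0) at_top" unfolding G_def using p \<beta> by real_asymp
    have R: "(LINT t:{0..x}|lborel. g y (of_real t)) = \<i> * ((LINT \<eta>:{0..}|lborel. g y (Complex 0 \<eta>)) - (LINT \<eta>:{0..}|lborel. g y (Complex x \<eta>)))"
      by (rule contour_rotation_strip(3)[OF x cont hol bnd G0 Gi])
    have "(LINT t|lborel. h (t, y)) = E y * (LINT t:{0..x}|lborel. g y (of_real t))"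
      unfolding set_lebesgue_integral_def integral_mult_right_zero[symmetric]
    proof (rule integral_cong_AE)
      show "(\<lambda>t. h (t, y)) \<in> borel_measurable lborel" by measurable
      show "(\<lambda>t. E y * (indicator {0..x} t *\<^sub>R g y (of_real t))) \<in> borel_measurable lborel" unfolding g_def by measurable
      show "AE t in lborel. h (t, y) = E y * (indicator {0..x} t *\<^sub>R g y (of_real t))"
        using AE_lborel_singleton[of x]
      proof eventually_elim
        case (elim t)
        show ?case
        proof (cases "t \<in> {0..x}")
          case True
          hence "cpow (of_real x - of_real t) \<beta> = of_real ((x - t) powr \<beta>)" using elim cpow_of_real[of "x - t" \<beta>] by simp
          thus ?thesis using True by (simp add: h_def g_def mult_ac)
        qed (simp add: h_def)
      qed
    qed
    also have "\<dots> = \<i> * (E y * (LINT \<eta>:{0..}|lborel. g y (Complex 0 \<eta>)) - E y * (LINT \<eta>:{0..}|lborel. g y (Complex x \<eta>)))"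
      unfolding R by (simp add: algebra_simps)
    finally have *: "(LINT t|lborel. h (t, y)) = \<i> * (E y * (LINT \<eta>:{0..}|lborel. g y (Complex 0 \<eta>)) - E y * (LINT \<eta>:{0..}|lborel. g y (Complex x \<eta>)))" .
    have Ec: "E y * (LINT \<eta>:{0..}|lborel. g y (Complex c \<eta>)) = (LINT \<eta>|lborel. of_real (indicator {0..} \<eta>) * (E y * g y (Complex c \<eta>)))" for c
      unfolding set_lebesgue_integral_def integral_mult_right_zero[symmetric]
      by (intro Bochner_Integration.integral_cong) (auto simp: indicator_def)
    show ?thesis unfolding * Ec ga_def gb_def prod.case ..
  qed
  have Z2: "- \<i> * Z = (LINT q|?P. ga q) - (LINT q|?P. gb q)"
  proof -
    have "Z = (LINT y|lborel. LINT t|lborel. h (t, y))"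
      unfolding Z_def using lborel_pair.integral_snd[of "\<lambda>t y. h (t, y)"] hint by simp
    also have "\<dots> = (LINT y|lborel. \<i> * ((LINT \<eta>|lborel. ga (y, \<eta>)) - (LINT \<eta>|lborel. gb (y, \<eta>))))" unfolding rot ..
    also have "\<dots> = \<i> * ((LINT y|lborel. LINT \<eta>|lborel. ga (y, \<eta>)) - (LINT y|lborel. LINT \<eta>|lborel. gb (y, \<eta>)))"
      using lborel_pair.integrable_fst'[OF gaint(1)] lborel_pair.integrable_fst'[OF gaint(2)] by simp
    also have "\<dots> = \<i> * ((LINT q|?P. ga q) - (LINT q|?P. gb q))"
      by (simp add: lborel_pair.integral_fst'[OF gaint(1)] lborel_pair.integral_fst'[OF gaint(2)])
    finally show ?thesis by simp
  qed
  have [measurable]: "F1 \<in> borel_measurable ?P" "F2 \<in> borel_measurable ?P"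
    unfolding F1_def F2_def case_prod_unfold by measurable
  have ex: "exp (- of_real y) * exp (\<i> * Complex c \<eta>) = of_real (exp (- y - \<eta>)) * exp (\<i> * of_real c)" for y c \<eta> :: real
    by (simp add: Complex_eq exp_add[symmetric] exp_of_real[symmetric] algebra_simps del: exp_of_real)
  have cis0: "cis (- (r * pi / 2)) * cis (r * pi / 2) = 1" for r by (simp add: cis_mult)
  \<comment> \<open>On the ray above 0 the phases of (-iy)^p and (i(2\<eta>+y))^p cancel, which
    leaves a nonnegative weight times (x-i\<eta>)^\<beta>.\<close>
  have A: "(LINT q|?P. ga q) = (LINT q|?P. F1 q)"
  proof (rule integral_cong_AE)
    show "AE q in ?P. ga q = F1 q" using AE_pair_nonzero
    proof eventually_elim
      case (elim q)
      obtain y \<eta> where q: "q = (y, \<eta>)" by force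
      show ?case
      proof (cases "y > 0 \<and> \<eta> > 0")
        case True
        have c2: "cpow (2 * Complex 0 \<eta> + \<i> * of_real y) p = of_real ((2 * \<eta> + y) powr p) * cis (p * pi / 2)"
          using cpow_ii_times(1)[of "2 * \<eta> + y" p] True by (simp add: Complex_eq algebra_simps)
        have c3: "of_real x - Complex 0 \<eta> = of_real x - \<i> * of_real \<eta>" by (simp add: Complex_eq)
        have "ga q = (exp (- of_real y) * exp (\<i> * Complex 0 \<eta>)) * of_real (y powr p * (2 * \<eta> + y) powr p) * (cis (- (p * pi / 2)) * cis (p * pi / 2)) * cpow (of_real x - \<i> * of_real \<eta>) \<beta>"
          using True unfolding ga_def q prod.case E_def g_def c2 c3 cpow_ii_times(2)[OF conjunct1[OF True]] by (simp add: mult_ac)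
        also have "\<dots> = F1 q" unfolding ex cis0 using True by (simp add: F1_def q mult_ac)
        finally show ?thesis .
      next
        case False
        thus ?thesis using elim by (auto simp: ga_def F1_def q E_def indicator_def)
      qed
    qed
  qed (use borel_measurable_integrable[OF gaint(1)] in measurable)
  \<comment> \<open>On the ray above x the phases of (-iy)^p and (-i\<eta>)^\<beta> combine to
    exp(-i (p+\<beta>) pi/2).\<close>
  have B: "(LINT q|?P. gb q) = (LINT q|?P. exp (\<i> * of_real x) * cis (- ((p + \<beta>) * pi / 2)) * F2 q)"
  proof (rule integral_cong_AE)
    show "AE q in ?P. gb q = exp (\<i> * of_real x) * cis (- ((p + \<beta>) * pi / 2)) * F2 q" using AE_pair_nonzero
    proof eventually_elim
      case (elim q)
      obtain y \<eta> where q: "q = (y, \<eta>)" by force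
      show ?case
      proof (cases "y > 0 \<and> \<eta> > 0")
        case True
        have c2: "2 * Complex x \<eta> + \<i> * of_real y = 2 * of_real x + \<i> * of_real (2 * \<eta> + y)" by (simp add: Complex_eq algebra_simps)
        have c3: "of_real x - Complex x \<eta> = - (\<i> * of_real \<eta>)" by (simp add: Complex_eq)
        have c4: "cis (- (p * pi / 2)) * cis (- (\<beta> * pi / 2)) = cis (- ((p + \<beta>) * pi / 2))" by (simp add: cis_mult algebra_simps add_divide_distrib)
        have "gb q = (exp (- of_real y) * exp (\<i> * Complex x \<eta>)) * of_real (y powr p * \<eta> powr \<beta>) * (cis (- (p * pi / 2)) * cis (- (\<beta> * pi / 2))) * cpow (2 * of_real x + \<i> * of_real (2 * \<eta> + y)) p"
          using True unfolding gb_def q prod.case E_def g_def c2 c3 cpow_ii_times(2)[OF conjunct1[OF True]] cpow_ii_times(2)[OF conjunct2[OF True]] by (simp add: mult_ac)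
        also have "\<dots> = exp (\<i> * of_real x) * cis (- ((p + \<beta>) * pi / 2)) * F2 q" unfolding ex c4 using True by (simp add: F2_def q mult_ac)
        finally show ?thesis .
      next
        case False
        thus ?thesis using elim by (auto simp: gb_def F2_def q E_def indicator_def)
      qed
    qed
  qed (use borel_measurable_integrable[OF gaint(2)] in measurable)
  have "M0 / 2 * Beta (2 * p + 2) (\<beta> + 1) = 4 powr p * (Gamma (p + 1))\<^sup>2 * Gamma (\<beta> + 1) / Gamma (2 * p + 3 + \<beta>)"
    using G by (simp add: M0_def Beta_def add_ac)
  moreover have "M0 / 2 * Beta (2 * p + 2) (\<beta> + 1) * (x powr (2 * p + 2 + \<beta>) * \<Lambda>_series (p + 1) (2 * p + 3 + \<beta>) x) = Re (- \<i> * Z)"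
    using Z1 by (simp add: mult_ac)
  ultimately show ?thesis unfolding Z2 A B integral_mult_right_zero by simp
qed

text \<open>In the exact integrals (x-i\<eta>)^\<beta> is replaced by x^\<beta> and
  (2x+i(2\<eta>+y))^p by (2x)^p. The first replacement happens under a real part and costs a
  relative error of order x^-2, the second one of order x^-1. The exponential weights absorb the
  polynomial growth in y and \<eta>, uniformly for x \<ge> 1.\<close>

lemma \<Lambda>_series_expansion_aux:
  fixes p \<beta> :: real
  assumes p: "p \<ge> 0" and \<beta>: "\<beta> > 0"
  shows "\<exists>K\<ge>0. \<forall>x\<ge>1. \<bar>4 powr p * (Gamma (p + 1))\<^sup>2 * Gamma (\<beta> + 1) / Gamma (2 * p + 3 + \<beta>) * (x powr (2 * p + 2 + \<beta>) * \<Lambda>_series (p + 1) (2 * p + 3 + \<beta>) x)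
     - (4 powr p * (Gamma (p + 1))\<^sup>2 * x powr \<beta> + (2 * x) powr p * (Gamma (p + 1) * Gamma (\<beta> + 1)) * cos (x - (p + \<beta> + 2) * pi / 2))\<bar>
     \<le> K * (x powr (\<beta> - 2) + x powr (p - 1))"
proof -
  let ?P = "lborel \<Otimes>\<^sub>M lborel :: (real \<times> real) measure"
  define u where "u M y = indicator {0..} y * (exp (- y) * (1 + y) powr M)" for M y :: real
  have ui: "integrable lborel (u M)" for M unfolding u_def by (rule integrable_exp_powr)
  have u0: "u M y \<ge> 0" for M y by (auto simp: u_def indicator_def)
  define J where "J M = (LINT y|lborel. u M y)" for M
  have J0: "J M \<ge> 0" for M unfolding J_def by (intro Bochner_Integration.integral_nonneg u0)
  define w1 where "w1 = (\<lambda>(y, \<eta>). indicator {0..} y * (indicator {0..} \<eta> * (exp (- y - \<eta>) * (y powr p * (2 * \<eta> + y) powr p))))"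
  define w2 where "w2 = (\<lambda>(y, \<eta>). indicator {0..} y * (indicator {0..} \<eta> * (exp (- y - \<eta>) * (y powr p * \<eta> powr \<beta>))))"
  have [measurable]: "w1 \<in> borel_measurable (borel \<Otimes>\<^sub>M borel)" "w2 \<in> borel_measurable (borel \<Otimes>\<^sub>M borel)"
    unfolding w1_def w2_def case_prod_unfold by measurable
  have lin: "2 * \<eta> + y \<le> 2 * (1 + \<eta>) * (1 + y)" "1 + (2 * \<eta> + y) \<le> 2 * (1 + \<eta>) * (1 + y)" if "y \<ge> 0" "\<eta> \<ge> 0" for y \<eta> :: real
  proof -
    have "0 \<le> \<eta> * y" using that by simp
    thus "2 * \<eta> + y \<le> 2 * (1 + \<eta>) * (1 + y)" "1 + (2 * \<eta> + y) \<le> 2 * (1 + \<eta>) * (1 + y)"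
      using that by (auto simp: algebra_simps)
  qed
  have pm: "(2 * A * B) powr r = 2 powr r * A powr r * B powr r" if "A \<ge> 0" "B \<ge> 0" for A B r :: real
    using that by (simp add: powr_mult)
  have w1b: "0 \<le> w1 (y, \<eta>)" "w1 (y, \<eta>) \<le> 2 powr p * u (2 * p) y * u p \<eta>" for y \<eta>
  proof -
    show "0 \<le> w1 (y, \<eta>)" by (auto simp: w1_def indicator_def)
    show "w1 (y, \<eta>) \<le> 2 powr p * u (2 * p) y * u p \<eta>"
    proof (cases "y \<ge> 0 \<and> \<eta> \<ge> 0")
      case True
      have "w1 (y, \<eta>) = exp (- y - \<eta>) * (y powr p * (2 * \<eta> + y) powr p)" using True by (simp add: w1_def)
      also have "\<dots> \<le> exp (- y - \<eta>) * ((1 + y) powr p * (2 * (1 + \<eta>) * (1 + y)) powr p)"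
        using True p lin[of y \<eta>] by (intro mult_left_mono mult_mono powr_mono2) auto
      also have "(2 * (1 + \<eta>) * (1 + y)) powr p = 2 powr p * (1 + \<eta>) powr p * (1 + y) powr p" using True by (intro pm) auto
      also have "exp (- y - \<eta>) = exp (- y) * exp (- \<eta>)" by (simp flip: exp_add)
      also have "exp (- y) * exp (- \<eta>) * ((1 + y) powr p * (2 powr p * (1 + \<eta>) powr p * (1 + y) powr p)) =
        2 powr p * (exp (- y) * ((1 + y) powr p * (1 + y) powr p)) * (exp (- \<eta>) * (1 + \<eta>) powr p)" by (simp only: mult_ac)
      also have "(1 + y) powr p * (1 + y) powr p = (1 + y) powr (2 * p)" unfolding mult_2[of p] by (rule powr_add[symmetric])
      finally show ?thesis using True by (simp add: u_def)
    qed (auto simp: w1_def u_def)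
  qed
  have w2b: "0 \<le> w2 (y, \<eta>)" "w2 (y, \<eta>) \<le> u p y * u \<beta> \<eta>" for y \<eta>
  proof -
    show "0 \<le> w2 (y, \<eta>)" by (auto simp: w2_def indicator_def)
    show "w2 (y, \<eta>) \<le> u p y * u \<beta> \<eta>"
    proof (cases "y \<ge> 0 \<and> \<eta> \<ge> 0")
      case True
      have "w2 (y, \<eta>) = exp (- y - \<eta>) * (y powr p * \<eta> powr \<beta>)" using True by (simp add: w2_def)
      also have "\<dots> \<le> exp (- y - \<eta>) * ((1 + y) powr p * (1 + \<eta>) powr \<beta>)"
        using True p \<beta> by (intro mult_left_mono mult_mono powr_mono2) auto
      also have "exp (- y - \<eta>) = exp (- y) * exp (- \<eta>)" by (simp flip: exp_add)
      finally show ?thesis using True by (simp add: u_def mult_ac)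
    qed (auto simp: w2_def u_def)
  qed
  have uu: "u M y * (1 + y) powr M' = u (M + M') y" for M M' y by (simp add: u_def powr_add)
  have i1: "has_bochner_integral ?P w1 (4 powr p * (Gamma (p + 1))\<^sup>2)"
    unfolding w1_def by (rule has_bochner_integral_exp_triangle[OF p])
  have i2: "has_bochner_integral ?P w2 (Gamma (p + 1) * Gamma (\<beta> + 1))"
  proof -
    have g: "has_bochner_integral lborel (\<lambda>t. indicator {0..} t * t powr (s + 1 - 1) / exp t) (Gamma (s + 1))" if "s \<ge> 0" for s :: real
    proof (rule has_bochner_integral_nn_integral)
      show "(\<integral>\<^sup>+t. ennreal (indicator {0..} t * t powr (s + 1 - 1) / exp t) \<partial>lborel) = ennreal (Gamma (s + 1))"
        by (rule Gamma_conv_nn_integral_real[symmetric]) (use that in simp)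
      show "0 \<le> Gamma (s + 1)" by (rule less_imp_le[OF Gamma_real_pos]) (use that in simp)
    qed auto
    have gi: "integrable lborel (\<lambda>t. indicator {0..} t * t powr (p + 1 - 1) / exp t)" "integrable lborel (\<lambda>t. indicator {0..} t * t powr (\<beta> + 1 - 1) / exp t)"
      using g[OF p] g[of \<beta>] \<beta> by (auto simp: has_bochner_integral_iff)
    have e: "w2 = (\<lambda>(y, \<eta>). (indicator {0..} y * y powr (p + 1 - 1) / exp y) * (indicator {0..} \<eta> * \<eta> powr (\<beta> + 1 - 1) / exp \<eta>))"
      by (auto simp: w2_def fun_eq_iff exp_diff exp_minus field_simps)
    show ?thesis unfolding e has_bochner_integral_iff
      using integrable_times_pair[OF gi] g[OF p] g[of \<beta>] \<beta> by (simp add: has_bochner_integral_iff)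
  qed
  \<comment> \<open>\<open>K1\<close> and \<open>K2\<close> are read off from the product bounds
    \<open>d1\<close> and \<open>d2\<close> below, with the powers of x removed.\<close>
  define K1 where "K1 = (\<beta> + \<beta>\<^sup>2) * 2 powr p * (J (2 * p) * J (p + (2 + \<beta>)))"
  define K2 where "K2 = 2 powr p * (p + p\<^sup>2 + p) * 2 powr (p + 2) * (J (p + (p + 2)) * J (\<beta> + (p + 2)))"
  have K: "K1 \<ge> 0" "K2 \<ge> 0" unfolding K1_def K2_def using J0 p \<beta> by (auto intro!: mult_nonneg_nonneg)
  show ?thesis
  proof (intro exI[of _ "K1 + K2"] conjI allI impI)
    show "0 \<le> K1 + K2" using K by simp
    fix x :: real assume x: "x \<ge> 1"
    define F1 where "F1 = (\<lambda>(y, \<eta>). of_real (w1 (y, \<eta>)) * cpow (of_real x - \<i> * of_real \<eta>) \<beta>)"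
    define F2 where "F2 = (\<lambda>(y, \<eta>). of_real (w2 (y, \<eta>)) * cpow (2 * of_real x + \<i> * of_real (2 * \<eta> + y)) p)"
    have [measurable]: "F1 \<in> borel_measurable (borel \<Otimes>\<^sub>M borel)" "F2 \<in> borel_measurable (borel \<Otimes>\<^sub>M borel)"
      unfolding F1_def F2_def case_prod_unfold by measurable
    have exact: "4 powr p * (Gamma (p + 1))\<^sup>2 * Gamma (\<beta> + 1) / Gamma (2 * p + 3 + \<beta>) * (x powr (2 * p + 2 + \<beta>) * \<Lambda>_series (p + 1) (2 * p + 3 + \<beta>) x) =
      Re (LINT q|?P. F1 q) - Re (exp (\<i> * of_real x) * cis (- ((p + \<beta>) * pi / 2)) * (LINT q|?P. F2 q))"
      using \<Lambda>_series_rotated[OF p \<beta>, of x] x unfolding F1_def F2_def w1_def w2_def prod.case by simp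
    have c1: "cpow (of_real x - \<i> * of_real \<eta>) \<beta> = of_real (x powr \<beta>) * cpow (1 - \<i> * of_real (\<eta> / x)) \<beta>" for \<eta>
    proof -
      have e: "of_real x - \<i> * of_real \<eta> = of_real x * (1 - \<i> * of_real (\<eta> / x))" using x by (simp add: field_simps)
      have nz: "1 - \<i> * of_real (\<eta> / x) \<noteq> 0" by (simp add: complex_eq_iff)
      show ?thesis unfolding e by (rule cpow_of_real_mult[OF _ nz]) (use x in simp)
    qed
    have c2: "cpow (2 * of_real x + \<i> * of_real w) p = of_real ((2 * x) powr p) * cpow (1 + \<i> * of_real (w / (2 * x))) p" for w
    proof -
      have e: "2 * of_real x + \<i> * of_real w = of_real (2 * x) * (1 + \<i> * of_real (w / (2 * x)))" using x by (simp add: field_simps)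
      have nz: "1 + \<i> * of_real (w / (2 * x)) \<noteq> 0" by (simp add: complex_eq_iff)
      show ?thesis unfolding e by (rule cpow_of_real_mult[OF _ nz]) (use x in simp)
    qed
    have d1: "\<bar>Re (F1 (y, \<eta>)) - x powr \<beta> * w1 (y, \<eta>)\<bar> \<le> (x powr (\<beta> - 2) * (\<beta> + \<beta>\<^sup>2) * 2 powr p * u (2 * p) y) * u (p + (2 + \<beta>)) \<eta>" for y \<eta>
    proof (cases "\<eta> \<ge> 0")
      case False
      thus ?thesis by (simp add: F1_def w1_def u_def)
    next
      case True
      have "Re (F1 (y, \<eta>)) - x powr \<beta> * w1 (y, \<eta>) = x powr \<beta> * w1 (y, \<eta>) * (Re (cpow (1 - \<i> * of_real (\<eta> / x)) \<beta>) - 1)"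
        unfolding F1_def prod.case c1 by (simp add: algebra_simps)
      hence "\<bar>Re (F1 (y, \<eta>)) - x powr \<beta> * w1 (y, \<eta>)\<bar> = x powr \<beta> * w1 (y, \<eta>) * \<bar>Re (cpow (1 - \<i> * of_real (\<eta> / x)) \<beta>) - 1\<bar>"
        using w1b[of y \<eta>] by (simp add: abs_mult)
      also have "\<dots> \<le> x powr \<beta> * (2 powr p * u (2 * p) y * u p \<eta>) * ((\<beta> + \<beta>\<^sup>2) * (x powr (- 2) * (1 + \<eta>) powr (2 + \<beta>)))"
      proof (intro mult_mono)
        have "\<bar>Re (cpow (1 - \<i> * of_real (\<eta> / x)) \<beta>) - 1\<bar> \<le> (\<beta> + \<beta>\<^sup>2) * (\<eta> / x)\<^sup>2 * (1 + \<eta> / x) powr \<beta>"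
          using True x \<beta> by (intro cpow_one_plus_ii_bounds) auto
        also have "\<dots> \<le> (\<beta> + \<beta>\<^sup>2) * (x powr (- 2) * (1 + \<eta>) powr 2) * (1 + \<eta>) powr \<beta>"
        proof (intro mult_mono powr_mono2)
          have "(\<eta> / x)\<^sup>2 = x powr (- 2) * \<eta>\<^sup>2" using x by (simp add: power_divide powr_minus powr_numeral field_simps)
          also have "\<dots> \<le> x powr (- 2) * (1 + \<eta>) powr 2" using True by (intro mult_left_mono) (auto simp: powr_numeral intro!: power_mono)
          finally show "(\<eta> / x)\<^sup>2 \<le> x powr (- 2) * (1 + \<eta>) powr 2" .
          have "\<eta> * 1 \<le> \<eta> * x" using True x by (intro mult_left_mono) auto
          thus "1 + \<eta> / x \<le> 1 + \<eta>" using x by (simp add: divide_le_eq)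
        qed (use True x \<beta> in auto)
        finally show "\<bar>Re (cpow (1 - \<i> * of_real (\<eta> / x)) \<beta>) - 1\<bar> \<le> (\<beta> + \<beta>\<^sup>2) * (x powr (- 2) * (1 + \<eta>) powr (2 + \<beta>))"
          by (simp only: powr_add mult.assoc)
      qed (use w1b[of y \<eta>] u0 in auto)
      also have "\<dots> = ((x powr \<beta> * x powr (- 2)) * (\<beta> + \<beta>\<^sup>2) * 2 powr p * u (2 * p) y) * (u p \<eta> * (1 + \<eta>) powr (2 + \<beta>))" by (simp only: mult_ac)
      also have "x powr \<beta> * x powr (- 2) = x powr (\<beta> - 2)" by (simp flip: powr_add)
      finally show ?thesis unfolding uu .
    qed
    have d2: "norm (F2 (y, \<eta>) - of_real ((2 * x) powr p * w2 (y, \<eta>))) \<le> (x powr (p - 1) * (2 powr p * (p + p\<^sup>2 + p) * 2 powr (p + 2)) * u (p + (p + 2)) y) * u (\<beta> + (p + 2)) \<eta>" for y \<eta>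
    proof (cases "y \<ge> 0 \<and> \<eta> \<ge> 0")
      case False
      thus ?thesis by (auto simp: F2_def w2_def u_def)
    next
      case True
      let ?w = "2 * \<eta> + y"
      have "F2 (y, \<eta>) - of_real ((2 * x) powr p * w2 (y, \<eta>)) = of_real ((2 * x) powr p * w2 (y, \<eta>)) * (cpow (1 + \<i> * of_real (?w / (2 * x))) p - 1)"
        unfolding F2_def prod.case c2 by (simp add: algebra_simps)
      hence "norm (F2 (y, \<eta>) - of_real ((2 * x) powr p * w2 (y, \<eta>))) = (2 * x) powr p * w2 (y, \<eta>) * norm (cpow (1 + \<i> * of_real (?w / (2 * x))) p - 1)"
        using w2b[of y \<eta>] by (simp only: norm_mult norm_of_real) (simp add: abs_mult)
      also have "\<dots> \<le> (2 powr p * x powr p) * (u p y * u \<beta> \<eta>) * ((p + p\<^sup>2 + p) * (x powr (- 1) * (2 powr (p + 2) * ((1 + \<eta>) powr (p + 2) * (1 + y) powr (p + 2)))))"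
      proof (intro mult_mono)
        have w0: "0 \<le> ?w" using True by simp
        have wx: "?w / (2 * x) \<le> x powr (- 1) * ?w" "1 + ?w / (2 * x) \<le> 1 + ?w"
        proof -
          have "?w / (2 * x) \<le> ?w / x" using x w0 by (intro divide_left_mono) auto
          thus "?w / (2 * x) \<le> x powr (- 1) * ?w" using x by (simp add: powr_minus field_simps)
          have "?w / (2 * x) \<le> ?w / 1" using x w0 by (intro divide_left_mono) auto
          thus "1 + ?w / (2 * x) \<le> 1 + ?w" by simp
        qed
        have "norm (cpow (1 + \<i> * of_real (?w / (2 * x))) p - 1) \<le> (p + p\<^sup>2 + p) * (?w / (2 * x)) * (1 + ?w / (2 * x)) powr (p + 1)"
          using w0 x p by (intro cpow_one_plus_ii_bounds) auto
        also have "\<dots> \<le> (p + p\<^sup>2 + p) * (x powr (- 1) * (2 * (1 + \<eta>) * (1 + y))) * (2 * (1 + \<eta>) * (1 + y)) powr (p + 1)"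
        proof (intro mult_mono powr_mono2)
          show "?w / (2 * x) \<le> x powr (- 1) * (2 * (1 + \<eta>) * (1 + y))"
            using wx(1) mult_left_mono[OF lin(1)[of y \<eta>], of "x powr (- 1)"] True by auto
          show "1 + ?w / (2 * x) \<le> 2 * (1 + \<eta>) * (1 + y)" using wx(2) lin(2)[of y \<eta>] True by auto
        qed (use True w0 x p in auto)
        also have "(p + p\<^sup>2 + p) * (x powr (- 1) * (2 * (1 + \<eta>) * (1 + y))) * (2 * (1 + \<eta>) * (1 + y)) powr (p + 1) =
          (p + p\<^sup>2 + p) * (x powr (- 1) * (2 * (1 + \<eta>) * (1 + y)) powr (p + 2))"
        proof -
          have "(2 * (1 + \<eta>) * (1 + y)) powr (p + 2) = (2 * (1 + \<eta>) * (1 + y)) * (2 * (1 + \<eta>) * (1 + y)) powr (p + 1)"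
            using True by (subst powr_mult_base) (auto simp: add_ac)
          thus ?thesis by (simp only: mult.assoc)
        qed
        also have "(2 * (1 + \<eta>) * (1 + y)) powr (p + 2) = 2 powr (p + 2) * ((1 + \<eta>) powr (p + 2) * (1 + y) powr (p + 2))"
          using True by (subst pm) (auto simp: mult.assoc)
        finally show "norm (cpow (1 + \<i> * of_real (?w / (2 * x))) p - 1) \<le> (p + p\<^sup>2 + p) * (x powr (- 1) * (2 powr (p + 2) * ((1 + \<eta>) powr (p + 2) * (1 + y) powr (p + 2))))" .
        show "(2 * x) powr p \<le> 2 powr p * x powr p" using x by (simp add: powr_mult)
      qed (use w2b[of y \<eta>] u0 in auto)
      also have "\<dots> = ((x powr p * x powr (- 1)) * (2 powr p * (p + p\<^sup>2 + p) * 2 powr (p + 2)) * (u p y * (1 + y) powr (p + 2))) * (u \<beta> \<eta> * (1 + \<eta>) powr (p + 2))"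
        by (simp only: mult_ac)
      also have "x powr p * x powr (- 1) = x powr (p - 1)" unfolding powr_add[symmetric] by simp
      finally show ?thesis unfolding uu .
    qed
    have F1i: "integrable ?P F1"
    proof (rule integrable_pair_bound(1))
      show "integrable lborel (\<lambda>y. (1 + x) powr \<beta> * 2 powr p * u (2 * p) y)" by (intro integrable_mult_right ui)
      show "integrable lborel (u (p + \<beta>))" by (rule ui)
      fix y \<eta> :: real
      show "norm (F1 (y, \<eta>)) \<le> (1 + x) powr \<beta> * 2 powr p * u (2 * p) y * u (p + \<beta>) \<eta>"
      proof (cases "\<eta> \<ge> 0")
        case False
        thus ?thesis by (simp add: F1_def w1_def u_def)
      next
        case True
        have "norm (cpow (of_real x - \<i> * of_real \<eta>) \<beta>) \<le> (1 + norm (of_real x - \<i> * of_real \<eta>)) powr \<beta>" using \<beta> by (intro norm_cpow_le) simp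
        also have "\<dots> \<le> ((1 + x) * (1 + \<eta>)) powr \<beta>"
        proof (rule powr_mono2)
          have "0 \<le> x * \<eta>" using True x by simp
          moreover have "norm (of_real x - \<i> * of_real \<eta>) \<le> x + \<eta>" using cmod_le[of "of_real x - \<i> * of_real \<eta>"] True x by simp
          moreover have "(1 + x) * (1 + \<eta>) = 1 + x + \<eta> + x * \<eta>" by (simp add: algebra_simps)
          ultimately show "1 + norm (of_real x - \<i> * of_real \<eta>) \<le> (1 + x) * (1 + \<eta>)" by linarith
        qed (use \<beta> in \<open>auto intro: add_nonneg_nonneg\<close>)
        also have "\<dots> = (1 + x) powr \<beta> * (1 + \<eta>) powr \<beta>" using True x by (simp add: powr_mult)
        finally have "norm (F1 (y, \<eta>)) \<le> (2 powr p * u (2 * p) y * u p \<eta>) * ((1 + x) powr \<beta> * (1 + \<eta>) powr \<beta>)"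
          using w1b[of y \<eta>] u0 unfolding F1_def prod.case norm_mult by (intro mult_mono) auto
        also have "\<dots> = (1 + x) powr \<beta> * 2 powr p * u (2 * p) y * (u p \<eta> * (1 + \<eta>) powr \<beta>)" by (simp only: mult_ac)
        finally show ?thesis unfolding uu .
      qed
    qed measurable
    have e1: "\<bar>Re (LINT q|?P. F1 q) - x powr \<beta> * (4 powr p * (Gamma (p + 1))\<^sup>2)\<bar> \<le> x powr (\<beta> - 2) * K1"
    proof -
      have "Re (LINT q|?P. F1 q) - x powr \<beta> * (4 powr p * (Gamma (p + 1))\<^sup>2) = (LINT q|?P. Re (F1 q) - x powr \<beta> * w1 q)"
        using i1 integrable_Re[OF F1i] integral_Re[OF F1i] by (simp add: has_bochner_integral_iff)
      moreover have "norm (LINT q|?P. Re (F1 q) - x powr \<beta> * w1 q) \<le> (LINT y|lborel. x powr (\<beta> - 2) * (\<beta> + \<beta>\<^sup>2) * 2 powr p * u (2 * p) y) * (LINT \<eta>|lborel. u (p + (2 + \<beta>)) \<eta>)"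
        using d1 by (intro integrable_pair_bound(2) integrable_mult_right ui) (simp_all, measurable)
      ultimately show ?thesis by (simp add: K1_def J_def mult_ac)
    qed
    have F2d: "integrable ?P (\<lambda>q. F2 q - of_real ((2 * x) powr p * w2 q))"
      "norm (LINT q|?P. F2 q - of_real ((2 * x) powr p * w2 q)) \<le> (LINT y|lborel. x powr (p - 1) * (2 powr p * (p + p\<^sup>2 + p) * 2 powr (p + 2)) * u (p + (p + 2)) y) * (LINT \<eta>|lborel. u (\<beta> + (p + 2)) \<eta>)"
      using d2 by (intro integrable_pair_bound[where u="\<lambda>y. x powr (p - 1) * (2 powr p * (p + p\<^sup>2 + p) * 2 powr (p + 2)) * u (p + (p + 2)) y" and v="u (\<beta> + (p + 2))"] integrable_mult_right ui; simp; measurable)+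
    have w2i: "integrable ?P (\<lambda>q. complex_of_real ((2 * x) powr p * w2 q))" using i2 by (auto simp: has_bochner_integral_iff)
    have w2v: "(LINT q|?P. complex_of_real ((2 * x) powr p * w2 q)) = of_real ((2 * x) powr p * (Gamma (p + 1) * Gamma (\<beta> + 1)))"
      using i2 by (simp add: has_bochner_integral_iff)
    have F2e: "(LINT q|?P. F2 q) = of_real ((2 * x) powr p * (Gamma (p + 1) * Gamma (\<beta> + 1))) + (LINT q|?P. F2 q - of_real ((2 * x) powr p * w2 q))"
      using Bochner_Integration.integral_add[OF w2i F2d(1)] unfolding w2v by simp
    define D where "D = (LINT q|?P. F2 q - of_real ((2 * x) powr p * w2 q))"
    have D: "norm D \<le> x powr (p - 1) * K2" using F2d(2) unfolding D_def K2_def J_def by (simp add: mult_ac)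
    have ph: "exp (\<i> * of_real x) * cis (- ((p + \<beta>) * pi / 2)) = cis (x - (p + \<beta>) * pi / 2)"
      by (simp add: cis_conv_exp exp_add[symmetric] algebra_simps)
    \<comment> \<open>The minus sign in front of the oscillating integral is absorbed as a phase
      shift by pi, which explains the summand 2 in p+\<beta>+2.\<close>
    have cs: "cos (x - (p + \<beta> + 2) * pi / 2) = - cos (x - (p + \<beta>) * pi / 2)"
    proof -
      have e: "x - (p + \<beta> + 2) * pi / 2 = (x - (p + \<beta>) * pi / 2) - pi" by (simp add: algebra_simps add_divide_distrib)
      show ?thesis unfolding e by (rule cos_minus_pi)
    qed
    have R2: "Re (exp (\<i> * of_real x) * cis (- ((p + \<beta>) * pi / 2)) * (LINT q|?P. F2 q)) =
      - ((2 * x) powr p * (Gamma (p + 1) * Gamma (\<beta> + 1)) * cos (x - (p + \<beta> + 2) * pi / 2)) + Re (cis (x - (p + \<beta>) * pi / 2) * D)"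
      unfolding ph F2e D_def[symmetric] cs by (simp add: distrib_left)
    have "\<bar>Re (cis (x - (p + \<beta>) * pi / 2) * D)\<bar> \<le> norm D" using abs_Re_le_cmod[of "cis (x - (p + \<beta>) * pi / 2) * D"] by (simp add: norm_mult)
    hence "\<bar>(Re (LINT q|?P. F1 q) - Re (exp (\<i> * of_real x) * cis (- ((p + \<beta>) * pi / 2)) * (LINT q|?P. F2 q)))
      - (4 powr p * (Gamma (p + 1))\<^sup>2 * x powr \<beta> + (2 * x) powr p * (Gamma (p + 1) * Gamma (\<beta> + 1)) * cos (x - (p + \<beta> + 2) * pi / 2))\<bar>
      \<le> x powr (\<beta> - 2) * K1 + x powr (p - 1) * K2"
      unfolding R2 using e1 D by (simp only: mult.commute[of "x powr \<beta>"])
    also have "\<dots> \<le> (K1 + K2) * (x powr (\<beta> - 2) + x powr (p - 1))"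
    proof -
      have "0 \<le> x powr (p - 1) * K1" "0 \<le> x powr (\<beta> - 2) * K2" using K by auto
      thus ?thesis by (simp add: algebra_simps)
    qed
    finally show "\<bar>4 powr p * (Gamma (p + 1))\<^sup>2 * Gamma (\<beta> + 1) / Gamma (2 * p + 3 + \<beta>) * (x powr (2 * p + 2 + \<beta>) * \<Lambda>_series (p + 1) (2 * p + 3 + \<beta>) x)
     - (4 powr p * (Gamma (p + 1))\<^sup>2 * x powr \<beta> + (2 * x) powr p * (Gamma (p + 1) * Gamma (\<beta> + 1)) * cos (x - (p + \<beta> + 2) * pi / 2))\<bar>
     \<le> (K1 + K2) * (x powr (\<beta> - 2) + x powr (p - 1))"
      unfolding exact .
  qed
qed

lemma \<Lambda>_series_expansion:
  fixes p \<beta> :: real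
  assumes p: "p \<ge> 0" and \<beta>: "\<beta> > 0"
  shows "\<exists>K\<ge>0. \<forall>x\<ge>1. \<bar>\<Lambda>_series (p + 1) (2 * p + 3 + \<beta>) x -
      (Gamma (2 * p + 3 + \<beta>) / Gamma (\<beta> + 1) * x powr (- (2 * p + 2)) +
       Gamma (2 * p + 3 + \<beta>) / (2 powr p * Gamma (p + 1)) * x powr (- (p + 2 + \<beta>)) * cos (x - (p + \<beta> + 2) * pi / 2))\<bar>
     \<le> K * (x powr (- (2 * p + 4)) + x powr (- (p + 3 + \<beta>)))"
proof -
  obtain K where K: "K \<ge> 0" and b: "\<And>x. x \<ge> 1 \<Longrightarrow> \<bar>4 powr p * (Gamma (p + 1))\<^sup>2 * Gamma (\<beta> + 1) / Gamma (2 * p + 3 + \<beta>) * (x powr (2 * p + 2 + \<beta>) * \<Lambda>_series (p + 1) (2 * p + 3 + \<beta>) x)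
     - (4 powr p * (Gamma (p + 1))\<^sup>2 * x powr \<beta> + (2 * x) powr p * (Gamma (p + 1) * Gamma (\<beta> + 1)) * cos (x - (p + \<beta> + 2) * pi / 2))\<bar>
     \<le> K * (x powr (\<beta> - 2) + x powr (p - 1))"
    using \<Lambda>_series_expansion_aux[OF p \<beta>] by blast
  define N where "N = 4 powr p * (Gamma (p + 1))\<^sup>2 * Gamma (\<beta> + 1) / Gamma (2 * p + 3 + \<beta>)"
  have G: "Gamma (p + 1) > 0" "Gamma (\<beta> + 1) > 0" "Gamma (2 * p + 3 + \<beta>) > 0" using p \<beta> by (auto intro!: Gamma_real_pos)
  have N: "N > 0" unfolding N_def using G by simp
  show ?thesis
  proof (intro exI[of _ "K / N"] conjI allI impI)
    show "0 \<le> K / N" using K N by simp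
    fix x :: real assume x: "x \<ge> 1"
    define L where "L = \<Lambda>_series (p + 1) (2 * p + 3 + \<beta>) x"
    define c where "c = cos (x - (p + \<beta> + 2) * pi / 2)"
    define y where "y = x powr (- (2 * p + 2 + \<beta>))"
    have y0: "y > 0" "y * x powr (2 * p + 2 + \<beta>) = 1" using x by (auto simp: y_def simp flip: powr_add)
    have pw: "y * x powr \<beta> = x powr (- (2 * p + 2))" "y * x powr p = x powr (- (p + 2 + \<beta>))"
      "y * x powr (\<beta> - 2) = x powr (- (2 * p + 4))" "y * x powr (p - 1) = x powr (- (p + 3 + \<beta>))"
      by (simp_all add: y_def algebra_simps flip: powr_add)
    have four: "4 powr p = (2 powr p * 2 powr p :: real)" using powr_mult[of 2 2 p] by simp
    have k1: "y / N * (N * (x powr (2 * p + 2 + \<beta>) * L)) = L" using N y0(2) by (simp add: field_simps)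
    have k2: "y / N * (4 powr p * (Gamma (p + 1))\<^sup>2 * x powr \<beta>) = Gamma (2 * p + 3 + \<beta>) / Gamma (\<beta> + 1) * x powr (- (2 * p + 2))"
      unfolding pw[symmetric] using G by (simp add: N_def field_simps)
    have k3: "y / N * ((2 * x) powr p * (Gamma (p + 1) * Gamma (\<beta> + 1)) * c) = Gamma (2 * p + 3 + \<beta>) / (2 powr p * Gamma (p + 1)) * x powr (- (p + 2 + \<beta>)) * c"
      unfolding pw[symmetric] using G x by (simp add: N_def four powr_mult power2_eq_square field_simps)
    have "y / N * \<bar>N * (x powr (2 * p + 2 + \<beta>) * L) - (4 powr p * (Gamma (p + 1))\<^sup>2 * x powr \<beta> + (2 * x) powr p * (Gamma (p + 1) * Gamma (\<beta> + 1)) * c)\<bar>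
       \<le> y / N * (K * (x powr (\<beta> - 2) + x powr (p - 1)))"
      using b[OF x] y0 N unfolding N_def[symmetric] L_def[symmetric] c_def[symmetric] by (intro mult_left_mono) auto
    moreover have "y / N * \<bar>z\<bar> = \<bar>y / N * z\<bar>" for z using y0 N by (simp add: abs_mult)
    moreover have "y / N * (K * (x powr (\<beta> - 2) + x powr (p - 1))) = K / N * (x powr (- (2 * p + 4)) + x powr (- (p + 3 + \<beta>)))"
      unfolding pw[symmetric] by (simp add: algebra_simps)
    ultimately show "\<bar>\<Lambda>_series (p + 1) (2 * p + 3 + \<beta>) x -
      (Gamma (2 * p + 3 + \<beta>) / Gamma (\<beta> + 1) * x powr (- (2 * p + 2)) +
       Gamma (2 * p + 3 + \<beta>) / (2 powr p * Gamma (p + 1)) * x powr (- (p + 2 + \<beta>)) * cos (x - (p + \<beta> + 2) * pi / 2))\<bar>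
     \<le> K / N * (x powr (- (2 * p + 4)) + x powr (- (p + 3 + \<beta>)))"
      unfolding L_def[symmetric] c_def[symmetric] k2[symmetric] k3[symmetric]
      by (simp only: right_diff_distrib distrib_left k1)
  qed
qed

subsection \<open>The function \<open>\<Lambda>\<close>\<close>

lemma Gamma_legendre_duplication_real:
  fixes z :: real
  assumes "z > 0"
  shows "Gamma z * Gamma (z + 1/2) = 2 powr (1 - 2 * z) * sqrt pi * Gamma (2 * z)"
proof -
  have nz: "complex_of_real x \<notin> \<int>\<^sub>\<le>\<^sub>0" if "x > 0" for x
    using that by (auto elim!: nonpos_Ints_cases simp: complex_eq_iff)
  have e: "complex_of_real (z + 1/2) = of_real z + 1/2" "complex_of_real (2 * z) = 2 * of_real z" by simp_all
  have "complex_of_real z \<notin> \<int>\<^sub>\<le>\<^sub>0" "complex_of_real z + 1/2 \<notin> \<int>\<^sub>\<le>\<^sub>0"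
    using nz[of z] nz[of "z + 1/2"] assms unfolding e by auto
  from Gamma_legendre_duplication[OF this]
  have "Gamma (complex_of_real z) * Gamma (complex_of_real (z + 1/2)) =
     exp ((1 - 2 * of_real z) * of_real (ln 2)) * of_real (sqrt pi) * Gamma (complex_of_real (2 * z))"
    unfolding e .
  hence "complex_of_real (Gamma z * Gamma (z + 1/2)) = complex_of_real (2 powr (1 - 2 * z) * sqrt pi * Gamma (2 * z))"
    unfolding Gamma_complex_of_real by (simp add: powr_def exp_of_real[symmetric] del: exp_of_real)
  thus ?thesis by (rule of_real_eq_iff[THEN iffD1])
qed

text \<open>The Beta mixture with parameters d and \<alpha>+1. In (d)_{2k} = 4^k (d/2)_k ((d+1)/2)_k
  the factor (d/2)_k cancels the lower symbol of \<Omega>, and ((d+1)/2)_k is the numerator of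
  \<Lambda>.\<close>

lemma \<Lambda>_integral_representation:
  assumes d: "d > 0" and \<alpha>: "\<alpha> > 0"
  shows "has_bochner_integral lborel
     (\<lambda>t. indicator {0..} t * (\<Omega> (real d / 2 - 1) (r * t) * pos_part (1 - t) powr \<alpha> * t ^ (d - 1)))
     (Beta (\<alpha> + 1) (real d) * \<Lambda> d \<alpha> r)"
proof -
  have c': "\<Lambda>_coeff ((real d + 1) / 2) (real d + \<alpha> + 1) k =
     \<Omega>_coeff (real d / 2 - 1) k * pochhammer (real d) (2 * k) / pochhammer (real d + (\<alpha> + 1)) (2 * k)" for k
  proof -
    have n: "real (2 ^ (2 * k)) = 4 ^ k" "2 * (real d / 2) = real d" "real d / 2 + 1/2 = (real d + 1) / 2" "real d / 2 - 1 + 1 = real d / 2"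
      "real d + (\<alpha> + 1) = real d + \<alpha> + 1" by (simp_all add: power_mult add_divide_distrib)
    have "pochhammer (real d) (2 * k) = 4 ^ k * pochhammer (real d / 2) k * pochhammer ((real d + 1) / 2) k"
      using pochhammer_double[of "real d / 2" k] by (simp only: n)
    moreover have "pochhammer (real d / 2) k > 0" using d by (intro pochhammer_pos) simp
    ultimately show ?thesis
      unfolding \<Lambda>_coeff_def \<Omega>_coeff_def n by (simp add: power_divide power_minus[of "1/4"])
  qed
  have \<nu>: "real d / 2 - 1 > -1" using d by simp
  have "has_bochner_integral lborel
     (\<lambda>t. indicator {0..1} t * (\<Omega> (real d / 2 - 1) (r * t) * (t powr (real d - 1) * (1 - t) powr (\<alpha> + 1 - 1))))
     (Beta (real d) (\<alpha> + 1) * \<Lambda> d \<alpha> r)"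
    using Beta_mixture[OF summable_\<Omega>_coeff[OF \<nu>] _ _ c', of r] d \<alpha> by (simp add: \<Lambda>_eq_suminf \<Omega>_eq_suminf[OF \<nu>])
  also have "?this \<longleftrightarrow> has_bochner_integral lborel
     (\<lambda>t. indicator {0..} t * (\<Omega> (real d / 2 - 1) (r * t) * pos_part (1 - t) powr \<alpha> * t ^ (d - 1)))
     (Beta (real d) (\<alpha> + 1) * \<Lambda> d \<alpha> r)"
  proof (rule has_bochner_integral_cong_AE)
    note [measurable] = borel_measurable_\<Omega>[OF \<nu>]
    show "(\<lambda>t. indicator {0..1} t * (\<Omega> (real d / 2 - 1) (r * t) * (t powr (real d - 1) * (1 - t) powr (\<alpha> + 1 - 1)))) \<in> borel_measurable lborel"
      "(\<lambda>t. indicator {0..} t * (\<Omega> (real d / 2 - 1) (r * t) * pos_part (1 - t) powr \<alpha> * t ^ (d - 1))) \<in> borel_measurable lborel"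
      unfolding pos_part_def by measurable
    show "AE t in lborel. indicator {0..1} t * (\<Omega> (real d / 2 - 1) (r * t) * (t powr (real d - 1) * (1 - t) powr (\<alpha> + 1 - 1))) =
       indicator {0..} t * (\<Omega> (real d / 2 - 1) (r * t) * pos_part (1 - t) powr \<alpha> * t ^ (d - 1))"
      using AE_lborel_singleton[of "0::real"]
    proof eventually_elim
      case (elim t)
      have "t powr (real d - 1) = t ^ (d - 1)" if "t > 0"
        using that d by (simp add: powr_realpow[symmetric] of_nat_diff)
      thus ?case using elim by (auto simp: indicator_def pos_part_def)
    qed
  qed
  finally show ?thesis by (simp add: Beta_commute)
qed

lemma isCont_\<Lambda>:
  assumes "d > 0" "\<alpha> > 0"
  shows "isCont (\<Lambda> d \<alpha>) r"
  unfolding \<Lambda>_eq_series using assms by (intro isCont_\<Lambda>_series) auto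

lemma \<Lambda>_0: "\<Lambda> d \<alpha> 0 = 1"
  by (simp add: \<Lambda>_eq_series \<Lambda>_series_0)

text \<open>By |\<Omega>| \<le> 1 the integrand of the representation is largest at r = 0. That
  bound was obtained from integrals over a Euclidean space, and the type variable supplies such a
  space of dimension d.\<close>

lemma \<Lambda>_le_1:
  assumes "d = DIM('a::euclidean_space)" "\<alpha> > 0"
  shows "\<Lambda> d \<alpha> r \<le> 1"
proof -
  have d: "d > 0" using assms by simp
  have h: "has_bochner_integral lborel
     (\<lambda>t. indicator {0..} t * (\<Omega> (real d / 2 - 1) (r * t) * pos_part (1 - t) powr \<alpha> * t ^ (d - 1)))
     (Beta (\<alpha> + 1) (real d) * \<Lambda> d \<alpha> r)" for r by (rule \<Lambda>_integral_representation[OF d assms(2)])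
  have "(LINT t|lborel. indicator {0..} t * (\<Omega> (real d / 2 - 1) (r * t) * pos_part (1 - t) powr \<alpha> * t ^ (d - 1))) \<le>
     (LINT t|lborel. indicator {0..} t * (\<Omega> (real d / 2 - 1) (0 * t) * pos_part (1 - t) powr \<alpha> * t ^ (d - 1)))"
  proof (rule integral_mono)
    fix t :: real
    have "\<Omega> (real d / 2 - 1) (r * t) \<le> 1" using abs_\<Omega>_le_1[where 'a='a, of "r * t"] assms(1) by simp
    moreover have "\<Omega> (real d / 2 - 1) (0 * t) = 1" using d by (simp add: \<Omega>_0)
    ultimately have *: "\<Omega> (real d / 2 - 1) (r * t) \<le> \<Omega> (real d / 2 - 1) (0 * t)" by simp
    show "indicator {0..} t * (\<Omega> (real d / 2 - 1) (r * t) * pos_part (1 - t) powr \<alpha> * t ^ (d - 1)) \<le>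
        indicator {0..} t * (\<Omega> (real d / 2 - 1) (0 * t) * pos_part (1 - t) powr \<alpha> * t ^ (d - 1))"
    proof (cases "t \<ge> 0")
      case True
      thus ?thesis by (intro mult_left_mono mult_right_mono *) auto
    qed simp
  qed (rule has_bochner_integral_iff[THEN iffD1, OF h, THEN conjunct1])+
  hence "Beta (\<alpha> + 1) (real d) * \<Lambda> d \<alpha> r \<le> Beta (\<alpha> + 1) (real d) * \<Lambda> d \<alpha> 0"
    unfolding has_bochner_integral_integral_eq[OF h] .
  moreover have "Beta (\<alpha> + 1) (real d) > 0"
    unfolding Beta_def using assms d by (intro divide_pos_pos mult_pos_pos Gamma_real_pos) auto
  ultimately show ?thesis by (simp add: \<Lambda>_0)
qed

section \<open>Asymptotics and two-sided bounds\<close>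

lemma \<Lambda>_expansion:
  fixes d :: nat and \<alpha> :: real
  assumes d: "d > 0" and \<alpha>: "\<alpha> > 1"
  defines "c1 \<equiv> Gamma (real d + \<alpha> + 1) / Gamma \<alpha>"
    and "c2 \<equiv> Gamma (real d + \<alpha> + 1) / (2 powr ((real d - 1) / 2) * Gamma ((real d + 1) / 2))"
  obtains K where "K \<ge> 0" "\<And>x. x \<ge> 1 \<Longrightarrow> \<bar>\<Lambda> d \<alpha> x - (c1 * x powr (- real d - 1) +
       c2 * x powr (- ((real d + 2 * \<alpha> + 1) / 2)) * cos (x - (real d + 2 * \<alpha> + 1) * pi / 4))\<bar>
     \<le> K * (x powr (- real d - 3) + x powr (- ((real d + 2 * \<alpha> + 3) / 2)))"
proof -
  let ?p = "(real d - 1) / 2" and ?b = "\<alpha> - 1"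
  have e: "?p + 1 = (real d + 1) / 2" "2 * ?p + 3 + ?b = real d + \<alpha> + 1" "?b + 1 = \<alpha>"
    "- (2 * ?p + 2) = - real d - 1" "- (?p + 2 + ?b) = - ((real d + 2 * \<alpha> + 1) / 2)"
    "- (2 * ?p + 4) = - real d - 3" "- (?p + 3 + ?b) = - ((real d + 2 * \<alpha> + 3) / 2)"
    "(?p + ?b + 2) * pi / 2 = (real d + 2 * \<alpha> + 1) * pi / 4"
    by (simp_all add: field_simps)
  have pb: "?p \<ge> 0" "?b > 0" using d \<alpha> by auto
  show ?thesis
    using \<Lambda>_series_expansion[OF pb] that unfolding e c1_def c2_def \<Lambda>_eq_series by blast
qed

text \<open>The expansion bounds a single error \<open>R\<close> by K times \<open>S\<close>, a sum
  of two powers, but two brackets need an error of their own. Each receives the share of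
  \<open>R\<close> proportional to its power in \<open>S\<close>, so both shares inherit the factor
  K.\<close>

lemma \<Lambda>_two_term_asymptotics:
  fixes d :: nat and \<alpha> :: real
  assumes d: "d > 0" and \<alpha>: "\<alpha> > 1"
  shows "\<exists>\<epsilon>\<^sub>1 \<epsilon>\<^sub>2 :: real \<Rightarrow> real.
         \<epsilon>\<^sub>1 \<in> O[at_top](\<lambda>r. r powr (- 2)) \<and> \<epsilon>\<^sub>2 \<in> O[at_top](\<lambda>r. r powr (- 1)) \<and>
         (\<forall>\<^sub>F r in at_top.
            \<Lambda> d \<alpha> r =
              Gamma (real d + \<alpha> + 1) / Gamma \<alpha> * r powr (- real d - 1) * (1 + \<epsilon>\<^sub>1 r) +
              Gamma (real d + \<alpha> + 1) / (2 powr ((real d - 1) / 2) * Gamma ((real d + 1) / 2)) *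
                r powr (- ((real d + 2 * \<alpha> + 1) / 2)) *
                (cos (r - (real d + 2 * \<alpha> + 1) * pi / 4) + \<epsilon>\<^sub>2 r))"
proof -
  define c1 where "c1 = Gamma (real d + \<alpha> + 1) / Gamma \<alpha>"
  define c2 where "c2 = Gamma (real d + \<alpha> + 1) / (2 powr ((real d - 1) / 2) * Gamma ((real d + 1) / 2))"
  define \<theta> where "\<theta> = (real d + 2 * \<alpha> + 1) * pi / 4"
  define a1 where "a1 = - real d - 1"
  define a2 where "a2 = - ((real d + 2 * \<alpha> + 1) / 2)"
  have a: "- real d - 3 = a1 - 2" "- ((real d + 2 * \<alpha> + 3) / 2) = a2 - 1" by (auto simp: a1_def a2_def field_simps)
  obtain K where K: "K \<ge> 0" "\<And>x. x \<ge> 1 \<Longrightarrow> \<bar>\<Lambda> d \<alpha> x - (c1 * x powr a1 + c2 * x powr a2 * cos (x - \<theta>))\<bar>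
     \<le> K * (x powr (a1 - 2) + x powr (a2 - 1))"
    using \<Lambda>_expansion[OF d \<alpha>] unfolding a c1_def[symmetric] c2_def[symmetric] a1_def[symmetric] a2_def[symmetric] \<theta>_def[symmetric] by blast
  have c: "c1 > 0" "c2 > 0" unfolding c1_def c2_def using d \<alpha> by (auto intro!: divide_pos_pos mult_pos_pos Gamma_real_pos)
  define R where "R x = \<Lambda> d \<alpha> x - (c1 * x powr a1 + c2 * x powr a2 * cos (x - \<theta>))" for x
  define S where "S x = x powr (a1 - 2) + x powr (a2 - 1)" for x
  define e1 where "e1 x = R x / S x * x powr (a1 - 2) / (c1 * x powr a1)" for x
  define e2 where "e2 x = R x / S x * x powr (a2 - 1) / (c2 * x powr a2)" for x
  have S: "S x > 0" if "x \<ge> 1" for x using that by (simp add: S_def add_pos_pos)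
  have RS: "\<bar>R x / S x\<bar> \<le> K" if "x \<ge> 1" for x
    using K(2)[OF that] S[OF that] by (simp add: R_def[symmetric] S_def[symmetric] divide_le_eq)
  have q1: "x powr (a1 - 2) / x powr a1 = x powr (- 2)" "x powr (a2 - 1) / x powr a2 = x powr (- 1)" if "x \<ge> 1" for x
    unfolding powr_diff[symmetric] by (rule arg_cong[of _ _ "(powr) x"], simp)+
  have b1: "\<bar>e1 x\<bar> \<le> K / c1 * x powr (- 2)" "\<bar>e2 x\<bar> \<le> K / c2 * x powr (- 1)" if "x \<ge> 1" for x
  proof -
    have "e1 x = R x / S x * (1 / c1) * (x powr (a1 - 2) / x powr a1)" by (simp add: e1_def)
    hence "\<bar>e1 x\<bar> = \<bar>R x / S x\<bar> * (1 / c1) * x powr (- 2)" unfolding q1[OF that] using c by (simp add: abs_mult)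
    also have "\<dots> \<le> K * (1 / c1) * x powr (- 2)" using RS[OF that] c by (intro mult_right_mono) auto
    finally show "\<bar>e1 x\<bar> \<le> K / c1 * x powr (- 2)" by simp
    have "e2 x = R x / S x * (1 / c2) * (x powr (a2 - 1) / x powr a2)" by (simp add: e2_def)
    hence "\<bar>e2 x\<bar> = \<bar>R x / S x\<bar> * (1 / c2) * x powr (- 1)" unfolding q1[OF that] using c by (simp add: abs_mult)
    also have "\<dots> \<le> K * (1 / c2) * x powr (- 1)" using RS[OF that] c by (intro mult_right_mono) auto
    finally show "\<bar>e2 x\<bar> \<le> K / c2 * x powr (- 1)" by simp
  qed
  have "e1 \<in> O[at_top](\<lambda>r. r powr (- 2))"
    by (rule bigoI[of _ "K / c1"], use eventually_ge_at_top[of 1] in eventually_elim) (use b1 in simp)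
  moreover have "e2 \<in> O[at_top](\<lambda>r. r powr (- 1))"
    by (rule bigoI[of _ "K / c2"], use eventually_ge_at_top[of 1] in eventually_elim) (use b1(2) in simp)
  moreover have "\<forall>\<^sub>F r in at_top. \<Lambda> d \<alpha> r = c1 * r powr a1 * (1 + e1 r) + c2 * r powr a2 * (cos (r - \<theta>) + e2 r)"
    using eventually_ge_at_top[of 1]
  proof eventually_elim
    case (elim x)
    have p: "x powr a1 > 0" "x powr a2 > 0" using elim by auto
    have "c1 * x powr a1 * e1 x = R x / S x * x powr (a1 - 2)" "c2 * x powr a2 * e2 x = R x / S x * x powr (a2 - 1)"
      using p c unfolding e1_def e2_def by auto
    hence "c1 * x powr a1 * e1 x + c2 * x powr a2 * e2 x = R x / S x * S x"
      by (simp only: S_def distrib_left)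
    also have "\<dots> = R x" using S[OF elim] by simp
    finally show ?case by (simp add: R_def algebra_simps)
  qed
  ultimately show ?thesis
    unfolding c1_def[symmetric] c2_def[symmetric] a1_def[symmetric] a2_def[symmetric] \<theta>_def[symmetric]
    by blast
qed

text \<open>On a bounded interval this follows from continuity and positivity. Far out the expansion
  decides: the oscillating term has relative size x^s with s = (d+1)/2 - \<alpha> \<le> 0, and has
  to stay below the algebraic one even when s = 0.\<close>

lemma \<Lambda>_comparable:
  fixes d :: nat and \<alpha> :: real
  assumes d: "d > 0" "d \<ge> 2 \<Longrightarrow> \<alpha> \<ge> (real d + 1) / 2" "d = 1 \<Longrightarrow> \<alpha> \<ge> 2"
  shows "comparable_on {0..} (\<Lambda> d \<alpha>) (\<lambda>r. (1 + r) powr (- real d - 1))"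
proof -
  have \<alpha>: "\<alpha> > 1" using assms by (cases "d = 1") auto
  have \<alpha>2: "\<alpha> \<ge> (real d + 1) / 2" using assms by (cases "d = 1") auto
  define c1 where "c1 = Gamma (real d + \<alpha> + 1) / Gamma \<alpha>"
  define c2 where "c2 = Gamma (real d + \<alpha> + 1) / (2 powr ((real d - 1) / 2) * Gamma ((real d + 1) / 2))"
  define \<theta> where "\<theta> = (real d + 2 * \<alpha> + 1) * pi / 4"
  define a1 where "a1 = - real d - 1"
  define s where "s = (real d + 1) / 2 - \<alpha>"
  have s: "s \<le> 0" using \<alpha>2 by (simp add: s_def)
  have a: "- real d - 3 = a1 - 2" "- ((real d + 2 * \<alpha> + 1) / 2) = a1 + s" "- ((real d + 2 * \<alpha> + 3) / 2) = a1 + s - 1" by (auto simp: a1_def s_def field_simps)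
  obtain K where K: "K \<ge> 0" "\<And>x. x \<ge> 1 \<Longrightarrow> \<bar>\<Lambda> d \<alpha> x - (c1 * x powr a1 + c2 * x powr (a1 + s) * cos (x - \<theta>))\<bar>
     \<le> K * (x powr (a1 - 2) + x powr (a1 + s - 1))"
    using \<Lambda>_expansion[OF d(1) \<alpha>] unfolding a c1_def[symmetric] c2_def[symmetric] a1_def[symmetric] \<theta>_def[symmetric] by blast
  have G: "Gamma (real d + \<alpha> + 1) > 0" "Gamma \<alpha> > 0" "Gamma ((real d + 1) / 2) > 0" using d \<alpha> by (auto intro!: Gamma_real_pos)
  have c: "c1 > 0" "c2 > 0" unfolding c1_def c2_def using G by (auto intro!: divide_pos_pos mult_pos_pos)
  have near: "\<bar>\<Lambda> d \<alpha> x * x powr (- a1) - c1\<bar> \<le> c2 * x powr s + K * (x powr (- 2) + x powr (s - 1))" if x: "x \<ge> 1" for x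
  proof -
    have p: "x powr (- a1) * x powr a1 = 1" "x powr (- a1) * x powr (a1 + s) = x powr s"
      "x powr (- a1) * x powr (a1 - 2) = x powr (- 2)" "x powr (- a1) * x powr (a1 + s - 1) = x powr (s - 1)"
      using x by (auto simp flip: powr_add)
    have "x powr (- a1) * \<bar>\<Lambda> d \<alpha> x - (c1 * x powr a1 + c2 * x powr (a1 + s) * cos (x - \<theta>))\<bar> \<le> x powr (- a1) * (K * (x powr (a1 - 2) + x powr (a1 + s - 1)))"
      by (intro mult_left_mono K x) auto
    also have "\<dots> = K * (x powr (- 2) + x powr (s - 1))" unfolding p(3)[symmetric] p(4)[symmetric] by (simp only: algebra_simps)
    also have "x powr (- a1) * \<bar>\<Lambda> d \<alpha> x - (c1 * x powr a1 + c2 * x powr (a1 + s) * cos (x - \<theta>))\<bar> =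
       \<bar>x powr (- a1) * (\<Lambda> d \<alpha> x - (c1 * x powr a1 + c2 * x powr (a1 + s) * cos (x - \<theta>)))\<bar>" by (simp add: abs_mult)
    also have "x powr (- a1) * (\<Lambda> d \<alpha> x - (c1 * x powr a1 + c2 * x powr (a1 + s) * cos (x - \<theta>))) =
       \<Lambda> d \<alpha> x * x powr (- a1) - c1 * (x powr (- a1) * x powr a1) - c2 * (x powr (- a1) * x powr (a1 + s)) * cos (x - \<theta>)" by (simp add: algebra_simps)
    also have "\<dots> = \<Lambda> d \<alpha> x * x powr (- a1) - c1 - c2 * x powr s * cos (x - \<theta>)" unfolding p by simp
    finally have "\<bar>\<Lambda> d \<alpha> x * x powr (- a1) - c1 - c2 * x powr s * cos (x - \<theta>)\<bar> \<le> K * (x powr (- 2) + x powr (s - 1))" .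
    moreover have "\<bar>c2 * x powr s * cos (x - \<theta>)\<bar> \<le> c2 * x powr s * 1" unfolding abs_mult using c by (intro mult_mono) auto
    ultimately show ?thesis by linarith
  qed
  \<comment> \<open>Limiting amplitude of the oscillating term relative to x^(-d-1). If s = 0, the
    Gamma factors in \<open>c1\<close> and \<open>c2\<close> agree and c2 = c1 / 2^((d-1)/2), which
    is below \<open>c1\<close> because \<alpha> > 1 forces d \<ge> 2.\<close>
  define q where "q = (if s = 0 then c2 else 0)"
  have q: "q < c1"
  proof (cases "s = 0")
    case True
    hence \<alpha>e: "\<alpha> = (real d + 1) / 2" by (simp add: s_def)
    hence "d \<ge> 2" using assms \<alpha> d by (cases "d = 1") auto
    hence "2 powr 0 < (2::real) powr ((real d - 1) / 2)" by (intro powr_less_mono) auto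
    hence "c2 < c1" unfolding c1_def c2_def \<alpha>e[symmetric] using G by (intro divide_strict_left_mono) (auto intro!: mult_pos_pos)
    thus ?thesis using True by (simp add: q_def)
  qed (use c in \<open>simp add: q_def\<close>)
  have lim: "((\<lambda>x. c2 * x powr s + K * (x powr (- 2) + x powr (s - 1))) \<longlongrightarrow> q + K * (0 + 0)) at_top"
  proof (intro tendsto_add tendsto_mult tendsto_const tendsto_neg_powr filterlim_ident)
    show "((\<lambda>x. c2 * x powr s) \<longlongrightarrow> q) at_top"
    proof (cases "s = 0")
      case True
      have "\<forall>\<^sub>F x in at_top. c2 = c2 * x powr s" using eventually_gt_at_top[of "0::real"] by eventually_elim (simp add: True)
      thus ?thesis using True by (auto simp: q_def intro: tendsto_eventually elim: eventually_mono)
    next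
      case False
      hence "((\<lambda>x. c2 * x powr s) \<longlongrightarrow> c2 * 0) at_top" using s by (intro tendsto_mult tendsto_const tendsto_neg_powr filterlim_ident) auto
      thus ?thesis using False by (simp add: q_def)
    qed
  qed (use s in auto)
  \<comment> \<open>The midpoint of \<open>q\<close> and \<open>c1\<close>: the deviation from
    \<open>c1\<close> is eventually below \<open>m\<close>, and \<open>c1 - m\<close> remains as a
    positive lower constant.\<close>
  define m where "m = (q + c1) / 2"
  have m: "q < m" "m < c1" "0 < c1 - m" using q by (auto simp: m_def field_simps)
  have "\<forall>\<^sub>F x in at_top. c2 * x powr s + K * (x powr (- 2) + x powr (s - 1)) < m"
    using order_tendstoD(2)[OF lim, of m] m by simp
  then obtain X where X: "\<And>x. x \<ge> X \<Longrightarrow> c2 * x powr s + K * (x powr (- 2) + x powr (s - 1)) < m"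
    unfolding eventually_at_top_linorder by blast
  define Y where "Y = max X 1"
  have Y: "Y \<ge> 1" "Y \<ge> X" by (auto simp: Y_def)
  have far: "c1 - m \<le> \<Lambda> d \<alpha> x * x powr (- a1)" "\<Lambda> d \<alpha> x * x powr (- a1) \<le> c1 + m" if "x \<ge> Y" for x
    using near[of x] X[of x] that Y by (auto simp: abs_le_iff)
  define \<phi> where "\<phi> x = \<Lambda> d \<alpha> x * (1 + x) powr (- a1)" for x
  have cont: "continuous_on {0..Y} \<phi>"
    unfolding \<phi>_def using isCont_\<Lambda>[OF d(1), of \<alpha>] \<alpha>
    by (intro continuous_on_mult continuous_on_powr continuous_intros continuous_at_imp_continuous_on) auto
  have \<phi>pos: "\<phi> x > 0" if "x \<ge> 0" for x
    unfolding \<phi>_def using \<Lambda>_pos[OF d, of x] that by (intro mult_pos_pos) auto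
  obtain x1 where x1: "x1 \<in> {0..Y}" "\<And>x. x \<in> {0..Y} \<Longrightarrow> \<phi> x1 \<le> \<phi> x"
    using continuous_attains_inf[OF _ _ cont] Y by auto
  obtain x2 where x2: "x2 \<in> {0..Y}" "\<And>x. x \<in> {0..Y} \<Longrightarrow> \<phi> x \<le> \<phi> x2"
    using continuous_attains_sup[OF _ _ cont] Y by auto
  have a1: "- a1 \<ge> 0" by (simp add: a1_def)
  define k1 where "k1 = min (\<phi> x1) (c1 - m)"
  \<comment> \<open>The factor \<open>2 powr (- a1)\<close> pays for 1 + x \<le> 2x, valid for x
    \<ge> 1.\<close>
  define k2 where "k2 = max (\<phi> x2) ((c1 + m) * 2 powr (- a1))"
  have k: "k1 > 0" "k2 > 0" using \<phi>pos[of x1] \<phi>pos[of x2] x1 x2 m by (auto simp: k1_def k2_def)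
  have main: "k1 \<le> \<phi> x \<and> \<phi> x \<le> k2" if x: "x \<ge> 0" for x
  proof (cases "x \<le> Y")
    case True
    thus ?thesis using x1(2)[of x] x2(2)[of x] x by (auto simp: k1_def k2_def)
  next
    case False
    hence xY: "x \<ge> Y" "x \<ge> 1" using Y by auto
    have L: "\<Lambda> d \<alpha> x > 0" by (rule \<Lambda>_pos[OF d])
    have "\<Lambda> d \<alpha> x * x powr (- a1) \<le> \<phi> x"
      unfolding \<phi>_def using L a1 xY by (intro mult_left_mono powr_mono2) auto
    moreover have "\<phi> x \<le> \<Lambda> d \<alpha> x * (2 * x) powr (- a1)"
      unfolding \<phi>_def using L a1 xY by (intro mult_left_mono powr_mono2) auto
    moreover have "\<Lambda> d \<alpha> x * (2 * x) powr (- a1) = (\<Lambda> d \<alpha> x * x powr (- a1)) * 2 powr (- a1)" using xY by (simp add: powr_mult)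
    moreover have "(\<Lambda> d \<alpha> x * x powr (- a1)) * 2 powr (- a1) \<le> (c1 + m) * 2 powr (- a1)" using far[OF xY(1)] by (intro mult_right_mono) auto
    ultimately have "c1 - m \<le> \<phi> x" "\<phi> x \<le> (c1 + m) * 2 powr (- a1)" using far[OF xY(1)] by linarith+
    thus ?thesis unfolding k1_def k2_def by linarith
  qed
  show ?thesis
    unfolding comparable_on_def
  proof (rule exI[of _ k1], rule conjI[OF k(1)], rule exI[of _ k2], rule conjI[OF k(2)], intro ballI conjI)
    fix x :: real assume "x \<in> {0..}"
    hence x: "x \<ge> 0" by simp
    have "(1 + x) powr (- a1) * (1 + x) powr a1 = 1" using x by (simp flip: powr_add)
    hence e: "\<Lambda> d \<alpha> x = \<phi> x * (1 + x) powr a1" unfolding \<phi>_def by (simp add: mult.assoc)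
    show "k1 * (1 + x) powr (- real d - 1) \<le> \<Lambda> d \<alpha> x" "\<Lambda> d \<alpha> x \<le> k2 * (1 + x) powr (- real d - 1)"
      unfolding e a1_def[symmetric] using main[OF x] by (auto intro!: mult_right_mono)
  qed
qed

text \<open>After multiplication by r^(d-1) the upper bound (1+r)^(-d-1) leaves (1+r)^(-2).\<close>

lemma \<Lambda>_integrable:
  fixes d :: nat and \<alpha> :: real
  assumes d: "d > 0" "d \<ge> 2 \<Longrightarrow> \<alpha> \<ge> (real d + 1) / 2" "d = 1 \<Longrightarrow> \<alpha> \<ge> 2"
  shows "integrable lborel (\<lambda>r. indicator {0..} r * (\<Lambda> d \<alpha> r * r ^ (d - 1)))"
proof -
  have \<alpha>: "\<alpha> > 0" using assms by (cases "d = 1") auto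
  obtain k where k: "k > 0" "\<And>r. r \<ge> 0 \<Longrightarrow> \<Lambda> d \<alpha> r \<le> k * (1 + r) powr (- real d - 1)"
    using \<Lambda>_comparable[OF d] unfolding comparable_on_def by auto
  have "(\<integral>\<^sup>+r. ennreal (1 / (1 + r)\<^sup>2) * indicator {0..} r \<partial>lborel) = ennreal (0 - (- 1 / (1 + 0)))"
  proof (rule nn_integral_FTC_atLeast)
    show "((\<lambda>x. - 1 / (1 + x)) has_real_derivative 1 / (1 + x)\<^sup>2) (at x)" if "0 \<le> x" for x :: real
      using that by (auto intro!: derivative_eq_intros simp: power2_eq_square)
    show "((\<lambda>x::real. - 1 / (1 + x)) \<longlongrightarrow> 0) at_top" by real_asymp
  qed auto
  also have "(\<integral>\<^sup>+r. ennreal (1 / (1 + r)\<^sup>2) * indicator {0..} r \<partial>lborel) =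
      (\<integral>\<^sup>+r. ennreal (indicator {0..} r * (1 / (1 + r)\<^sup>2)) \<partial>lborel)"
    by (intro nn_integral_cong) (auto split: split_indicator)
  finally have "has_bochner_integral lborel (\<lambda>r::real. indicator {0..} r * (1 / (1 + r)\<^sup>2) :: real) 1"
    by (intro has_bochner_integral_nn_integral) auto
  hence i: "integrable lborel (\<lambda>r::real. k * (indicator {0..} r * (1 / (1 + r)\<^sup>2)))"
    by (intro integrable_mult_right) (rule has_bochner_integral_iff[THEN iffD1, THEN conjunct1])
  have [measurable]: "\<Lambda> d \<alpha> \<in> borel_measurable borel"
    by (intro borel_measurable_continuous_onI continuous_at_imp_continuous_on ballI isCont_\<Lambda> d \<alpha>)
  show ?thesis
  proof (rule Bochner_Integration.integrable_bound[OF i])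
    show "AE r in lborel. norm (indicator {0..} r * (\<Lambda> d \<alpha> r * r ^ (d - 1))) \<le> norm (k * (indicator {0..} r * (1 / (1 + r)\<^sup>2)))"
    proof (rule AE_I2)
      fix r :: real
      show "norm (indicator {0..} r * (\<Lambda> d \<alpha> r * r ^ (d - 1))) \<le> norm (k * (indicator {0..} r * (1 / (1 + r)\<^sup>2)))"
      proof (cases "r \<ge> 0")
        case True
        have "\<Lambda> d \<alpha> r * r ^ (d - 1) \<le> k * (1 + r) powr (- real d - 1) * (1 + r) ^ (d - 1)"
          using True k \<Lambda>_pos[OF d, of r] by (intro mult_mono power_mono) auto
        also have "\<dots> = k * ((1 + r) powr (- real d - 1) * (1 + r) powr (real d - 1))"
          using True d(1) by (simp add: powr_realpow[symmetric] of_nat_diff)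
        also have "(1 + r) powr (- real d - 1) * (1 + r) powr (real d - 1) = 1 / (1 + r)\<^sup>2"
          using True by (simp add: powr_minus powr_numeral divide_inverse flip: powr_add)
        finally show ?thesis using True k \<Lambda>_pos[OF d, of r] by (simp add: abs_mult)
      qed simp
    qed
  qed measurable
qed

section \<open>The Fourier pair (1-|y|)_+^\<alpha> and \<Lambda>\<close>

text \<open>The constant, the area of the unit sphere times a Beta value, is the integral of
  (1-|y|)_+^\<alpha> itself, since \<Lambda> is 1 at 0.\<close>

lemma Askey_Fourier:
  fixes x :: "'a::euclidean_space" and \<alpha> :: real
  assumes \<alpha>: "\<alpha> > 0"
  shows "has_bochner_integral lborel (\<lambda>y::'a. pos_part (1 - norm y) powr \<alpha> * cos (x \<bullet> y))
    (real DIM('a) * measure lborel (cball (0::'a) 1) * Beta (\<alpha> + 1) (real DIM('a)) * \<Lambda> DIM('a) \<alpha> (norm x))"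
proof -
  have R: "has_bochner_integral lborel
     (\<lambda>t. indicator {0..} t * (\<Omega> (real DIM('a) / 2 - 1) (r * t) * pos_part (1 - t) powr \<alpha> * t ^ (DIM('a) - 1)))
     (Beta (\<alpha> + 1) (real DIM('a)) * \<Lambda> DIM('a) \<alpha> r)" for r
    by (rule \<Lambda>_integral_representation[OF _ \<alpha>]) simp
  have 1: "integrable lborel (\<lambda>r. indicator {0..} r * (pos_part (1 - r) powr \<alpha> * r ^ (DIM('a) - 1)))"
    using R[of 0] by (simp add: \<Omega>_0 has_bochner_integral_iff)
  have 2: "(\<lambda>r. pos_part (1 - r) powr \<alpha>) \<in> borel_measurable borel"
    unfolding pos_part_def by measurable
  have "has_bochner_integral lborel (\<lambda>y::'a. pos_part (1 - norm y) powr \<alpha> * cos (x \<bullet> y))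
    (real DIM('a) * measure lborel (cball (0::'a) 1) *
     (LINT r|lborel. indicator {0..} r * (\<Omega> (real DIM('a) / 2 - 1) (r * norm x) * pos_part (1 - r) powr \<alpha> * r ^ (DIM('a) - 1))))"
    by (rule has_bochner_integral_radial_cos(2)[OF 2 1])
  also have "(LINT r|lborel. indicator {0..} r * (\<Omega> (real DIM('a) / 2 - 1) (r * norm x) * pos_part (1 - r) powr \<alpha> * r ^ (DIM('a) - 1))) =
     Beta (\<alpha> + 1) (real DIM('a)) * \<Lambda> DIM('a) \<alpha> (norm x)"
    using has_bochner_integral_integral_eq[OF R[of "norm x"]] by (simp only: mult.commute[of "norm x"])
  finally show ?thesis by (simp only: mult.assoc)
qed

text \<open>Inversion for (1-|y|)_+^\<alpha>, whose transform is a multiple of \<Lambda>, and the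
  radial formula for \<Lambda> evaluate the same integral, and their comparison isolates the
  one-dimensional one. V^2 cancels; Gamma(d/2+1) = (d/2) Gamma(d/2) cancels d^2 and leaves the
  4.\<close>

lemma \<Lambda>_Fourier:
  fixes x :: "'a::euclidean_space" and \<alpha> :: real
  assumes d: "d = DIM('a)" "d \<ge> 2 \<Longrightarrow> \<alpha> \<ge> (real d + 1) / 2" "d = 1 \<Longrightarrow> \<alpha> \<ge> 2"
  defines "B \<equiv> Beta (\<alpha> + 1) (real d)"
  shows "integrable lborel (\<lambda>r. indicator {0..} r * (\<Omega> (real d / 2 - 1) (r * norm x) * \<Lambda> d \<alpha> r * r ^ (d - 1)))"
    and "has_bochner_integral lborel (\<lambda>y::'a. \<Lambda> d \<alpha> (norm y) * cos (x \<bullet> y))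
      (real d * measure lborel (cball (0::'a) 1) *
        (LINT r|lborel. indicator {0..} r * (\<Omega> (real d / 2 - 1) (r * norm x) * \<Lambda> d \<alpha> r * r ^ (d - 1))))"
    and "(LINT r|lborel. indicator {0..} r * (\<Omega> (real d / 2 - 1) (r * norm x) * \<Lambda> d \<alpha> r * r ^ (d - 1))) =
      2 ^ d * (Gamma (real d / 2))\<^sup>2 / (4 * B) * pos_part (1 - norm x) powr \<alpha>"
proof -
  have d0: "d > 0" using d by simp
  have \<alpha>: "\<alpha> > 1"
  proof (cases "d = 1")
    case False
    hence "d \<ge> 2" using d0 by simp
    thus ?thesis using d(2) by simp
  qed (use d(3) in simp)
  define V where "V = measure lborel (cball (0::'a) 1)"
  define I where "I = (LINT r|lborel. indicator {0..} r * (\<Omega> (real d / 2 - 1) (r * norm x) * \<Lambda> d \<alpha> r * r ^ (d - 1)))"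
  have V: "V > 0" unfolding V_def by (rule emeasure_cball_pos_finite)
  have B: "B > 0" unfolding B_def Beta_def using \<alpha> d0 by (intro divide_pos_pos mult_pos_pos Gamma_real_pos) auto
  have [measurable]: "\<Lambda> d \<alpha> \<in> borel_measurable borel"
    using \<alpha> by (intro borel_measurable_continuous_onI continuous_at_imp_continuous_on ballI isCont_\<Lambda> d0) auto
  have i: "integrable lborel (\<lambda>r. indicator {0..} r * (\<Lambda> d \<alpha> r * r ^ (d - 1)))"
    using \<Lambda>_integrable[OF d0 d(2,3)] .
  show "integrable lborel (\<lambda>r. indicator {0..} r * (\<Omega> (real d / 2 - 1) (r * norm x) * \<Lambda> d \<alpha> r * r ^ (d - 1)))"
    by (rule has_bochner_integral_radial_cos(1)[of "\<Lambda> d \<alpha>" x, folded d(1), OF _ i]) measurable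
  have C: "has_bochner_integral lborel (\<lambda>y::'a. \<Lambda> d \<alpha> (norm y) * cos (x \<bullet> y)) (real d * V * I)"
    unfolding V_def I_def by (rule has_bochner_integral_radial_cos(2)[of "\<Lambda> d \<alpha>" x, folded d(1), OF _ i]) measurable
  thus "has_bochner_integral lborel (\<lambda>y::'a. \<Lambda> d \<alpha> (norm y) * cos (x \<bullet> y)) (real d * measure lborel (cball (0::'a) 1) *
        (LINT r|lborel. indicator {0..} r * (\<Omega> (real d / 2 - 1) (r * norm x) * \<Lambda> d \<alpha> r * r ^ (d - 1))))"
    unfolding V_def I_def .
  have A: "has_bochner_integral lborel (\<lambda>y::'a. pos_part (1 - norm y) powr \<alpha> * cos (\<xi> \<bullet> y)) (real d * V * B * \<Lambda> d \<alpha> (norm \<xi>))" for \<xi> :: 'a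
    using Askey_Fourier[of \<alpha> \<xi>] \<alpha> unfolding d(1) V_def B_def by simp
  have C0: "integrable lborel (\<lambda>y::'a. \<Lambda> d \<alpha> (norm y))"
    using has_bochner_integral_radial_cos(2)[of "\<Lambda> d \<alpha>" "0::'a", folded d(1), OF _ i] by (simp add: has_bochner_integral_iff)
  have "has_bochner_integral lborel (\<lambda>\<xi>. real d * V * B * \<Lambda> d \<alpha> (norm \<xi>) * cos (x \<bullet> \<xi>))
     (2 ^ DIM('a) * (measure lborel (cball (0::'a) 1) * Gamma (real DIM('a) / 2 + 1))\<^sup>2 * pos_part (1 - norm x) powr \<alpha>)"
  proof (rule Fourier_inversion_cos[where M = 1])
    show "continuous_on UNIV (\<lambda>y::'a. pos_part (1 - norm y) powr \<alpha>)"
      unfolding pos_part_def using \<alpha> by (intro continuous_on_powr' continuous_intros) auto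
    show "\<bar>pos_part (1 - norm y) powr \<alpha>\<bar> \<le> 1" for y :: 'a
      using \<alpha> powr_mono2[of \<alpha> "pos_part (1 - norm y)" 1] by (auto simp: pos_part_def)
    show "integrable lborel (\<lambda>y::'a. pos_part (1 - norm y) powr \<alpha>)"
      using A[of 0] by (simp add: has_bochner_integral_iff)
    show "integrable lborel (\<lambda>\<xi>::'a. real d * V * B * \<Lambda> d \<alpha> (norm \<xi>))"
      using C0 by (intro integrable_mult_right) auto
  qed (use A in auto)
  moreover have "has_bochner_integral lborel (\<lambda>\<xi>. (real d * V * B) * (\<Lambda> d \<alpha> (norm \<xi>) * cos (x \<bullet> \<xi>))) (real d * V * B * (real d * V * I))"
    using C by (intro has_bochner_integral_mult_right) auto
  ultimately have "real d * V * B * (real d * V * I) =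
     2 ^ d * (V * Gamma (real d / 2 + 1))\<^sup>2 * pos_part (1 - norm x) powr \<alpha>"
    unfolding d(1)[symmetric] V_def[symmetric] mult.assoc[symmetric] by (rule has_bochner_integral_eq[rotated])
  also have "Gamma (real d / 2 + 1) = real d / 2 * Gamma (real d / 2)"
    using Gamma_plus1[of "real d / 2"] nonpos_Ints_nonpos[of "real d / 2"] d0 by (fastforce simp: add.commute)
  finally show "I = 2 ^ d * (Gamma (real d / 2))\<^sup>2 / (4 * B) * pos_part (1 - norm x) powr \<alpha>"
    using V B d0 by (simp add: field_simps power2_eq_square)
qed

text \<open>Duplication at z = d/2 reads Gamma(d/2) Gamma((d+1)/2) 2^d = 2 sqrt(pi) Gamma(d); the
  other Gamma values cancel against those of Beta(\<alpha>+1, d).\<close>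

lemma inversion_constant:
  fixes d :: nat and \<alpha> :: real
  assumes "d > 0" "\<alpha> > 0"
  shows "2 * Gamma (\<alpha> + 1) * Gamma ((real d + 1) / 2) / (sqrt pi * Gamma (\<alpha> + real d + 1) * Gamma (real d / 2)) *
     (2 ^ d * (Gamma (real d / 2))\<^sup>2 / (4 * Beta (\<alpha> + 1) (real d))) = 1"
proof -
  define a b c g h where "a = Gamma (\<alpha> + 1)" and "b = Gamma ((real d + 1) / 2)" and "c = Gamma (\<alpha> + real d + 1)"
    and "g = Gamma (real d / 2)" and "h = Gamma (real d)"
  have p: "a > 0" "b > 0" "c > 0" "g > 0" "h > 0"
    unfolding a_def b_def c_def g_def h_def using assms by (auto intro!: Gamma_real_pos)
  have "real d / 2 + 1/2 = (real d + 1) / 2" "2 * (real d / 2) = real d" by (simp_all add: add_divide_distrib)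
  note D = this
  have "g * b = 2 powr (1 - real d) * sqrt pi * h"
    using Gamma_legendre_duplication_real[of "real d / 2"] assms unfolding g_def b_def h_def D by simp
  also have "2 powr (1 - real d) = 2 / 2 ^ d" by (simp add: powr_diff powr_realpow)
  finally have D: "g * b * 2 ^ d = 2 * sqrt pi * h" by (simp add: field_simps)
  have "2 * a * b / (sqrt pi * c * g) * (2 ^ d * g\<^sup>2 / (4 * (a * h / c))) = (g * b * 2 ^ d) / (2 * sqrt pi * h)"
    using p by (simp add: field_simps power2_eq_square)
  also have "\<dots> = 1" unfolding D using p by simp
  also have "a * h / c = Beta (\<alpha> + 1) (real d)"
    unfolding a_def h_def c_def Beta_def by (simp add: add_ac)
  finally show ?thesis unfolding a_def b_def c_def g_def .
qed

text \<open>Each integral formula is accompanied by integrability: a Lebesgue integral that does not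
  exist has the value 0, so the equation alone would say less. The O-terms inside the brackets are
  two functions chosen jointly.\<close>

theorem theorem5p1:
  fixes d :: nat and \<alpha> :: real
  assumes "d = CARD('n::finite)"
    and "d \<ge> 2 \<Longrightarrow> \<alpha> \<ge> (real d + 1) / 2"
    and "d = 1 \<Longrightarrow> \<alpha> \<ge> 2"
  shows
    "(radial_positive_definite TYPE('n) (\<Lambda> d \<alpha>) \<and>
      (\<forall>r\<ge>0. set_integrable lborel {0..}
                (\<lambda>t. \<Omega> ((real d - 2) / 2) (r * t) * pos_part (1 - t) powr \<alpha> * t ^ (d - 1)) \<and>
              \<Lambda> d \<alpha> r = 1 / Beta (\<alpha> + 1) (real d) *
                (LINT t:{0..}|lborel.
                   \<Omega> ((real d - 2) / 2) (r * t) * pos_part (1 - t) powr \<alpha> * t ^ (d - 1))))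
     \<and>
     ((\<forall>r\<ge>0. 0 < \<Lambda> d \<alpha> r \<and> \<Lambda> d \<alpha> r \<le> 1) \<and>
      (\<exists>\<epsilon>\<^sub>1 \<epsilon>\<^sub>2 :: real \<Rightarrow> real.
         \<epsilon>\<^sub>1 \<in> O[at_top](\<lambda>r. r powr (- 2)) \<and> \<epsilon>\<^sub>2 \<in> O[at_top](\<lambda>r. r powr (- 1)) \<and>
         (\<forall>\<^sub>F r in at_top.
            \<Lambda> d \<alpha> r =
              Gamma (real d + \<alpha> + 1) / Gamma \<alpha> * r powr (- real d - 1) * (1 + \<epsilon>\<^sub>1 r) +
              Gamma (real d + \<alpha> + 1) / (2 powr ((real d - 1) / 2) * Gamma ((real d + 1) / 2)) *
                r powr (- ((real d + 2 * \<alpha> + 1) / 2)) *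
                (cos (r - (real d + 2 * \<alpha> + 1) * pi / 4) + \<epsilon>\<^sub>2 r))) \<and>
      comparable_on {0..} (\<Lambda> d \<alpha>) (\<lambda>r. (1 + r) powr (- real d - 1)))
     \<and>
     (continuous_on {0..} (\<Lambda> d \<alpha>) \<and>
      set_integrable lborel {0..} (\<lambda>r. \<Lambda> d \<alpha> r * r ^ (d - 1)) \<and>
      (\<forall>t\<ge>0. set_integrable lborel {0..}
                (\<lambda>r. \<Omega> ((real d - 2) / 2) (r * t) * \<Lambda> d \<alpha> r * r ^ (d - 1)) \<and>
              pos_part (1 - t) powr \<alpha> =
                2 * Gamma (\<alpha> + 1) * Gamma ((real d + 1) / 2) /
                (sqrt pi * Gamma (\<alpha> + real d + 1) * Gamma (real d / 2)) *
                (LINT r:{0..}|lborel.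
                   \<Omega> ((real d - 2) / 2) (r * t) * \<Lambda> d \<alpha> r * r ^ (d - 1))) \<and>
      radial_positive_definite TYPE('n) (\<lambda>t. pos_part (1 - t) powr \<alpha>))"
proof -
  have d: "d = DIM(real ^ 'n)" using assms(1) by simp
  have d0: "d > 0" using d by simp
  have \<alpha>: "\<alpha> > 1" "\<alpha> > 0" using assms(2,3) d0 by (cases "d = 1"; force)+
  have \<nu>: "(real d - 2) / 2 = real d / 2 - 1" by (simp add: diff_divide_distrib)
  define V where "V = measure lborel (cball (0::real ^ 'n) 1)"
  have V: "V > 0" unfolding V_def by (rule emeasure_cball_pos_finite)
  have B: "Beta (\<alpha> + 1) (real d) > 0"
    unfolding Beta_def using \<alpha> d0 by (intro divide_pos_pos mult_pos_pos Gamma_real_pos) auto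
  have G: "Gamma (real d / 2) > 0" using d0 by (intro Gamma_real_pos) auto
  have m\<Lambda>: "\<Lambda> d \<alpha> \<in> borel_measurable borel"
    by (intro borel_measurable_continuous_onI continuous_at_imp_continuous_on ballI isCont_\<Lambda> d0 \<alpha>)
  have PD1: "radial_positive_definite TYPE('n) (\<Lambda> d \<alpha>)"
  proof (rule radial_positive_definite_Fourier[where h = "\<lambda>t. pos_part (1 - t) powr \<alpha>" and K = "real d * V * Beta (\<alpha> + 1) (real d)"])
    show "has_bochner_integral lborel (\<lambda>y. pos_part (1 - norm y) powr \<alpha> * cos (x \<bullet> y))
       (real d * V * Beta (\<alpha> + 1) (real d) * \<Lambda> d \<alpha> (norm x))" for x :: "real ^ 'n"
      using Askey_Fourier[OF \<alpha>(2), of x] unfolding d V_def .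
    show "(\<lambda>t. pos_part (1 - t) powr \<alpha>) \<in> borel_measurable borel" unfolding pos_part_def by measurable
  qed (use V B d0 in \<open>auto simp: pos_part_def\<close>)
  \<comment> \<open>The roles are exchanged: \<Lambda> is now the density, and its strict positivity
    makes the form definite.\<close>
  have PD2: "radial_positive_definite TYPE('n) (\<lambda>t. pos_part (1 - t) powr \<alpha>)"
  proof (rule radial_positive_definite_Fourier[where h = "\<Lambda> d \<alpha>" and
        K = "real d * V * (2 ^ d * (Gamma (real d / 2))\<^sup>2 / (4 * Beta (\<alpha> + 1) (real d)))"])
    show "has_bochner_integral lborel (\<lambda>y. \<Lambda> d \<alpha> (norm y) * cos (x \<bullet> y))
       (real d * V * (2 ^ d * (Gamma (real d / 2))\<^sup>2 / (4 * Beta (\<alpha> + 1) (real d))) * pos_part (1 - norm x) powr \<alpha>)" for x :: "real ^ 'n"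
      using \<Lambda>_Fourier(2,3)[OF d assms(2,3), of x] unfolding V_def by (simp add: mult.assoc)
    show "0 < real d * V * (2 ^ d * (Gamma (real d / 2))\<^sup>2 / (4 * Beta (\<alpha> + 1) (real d)))"
      using V B G d0 by (intro mult_pos_pos divide_pos_pos zero_less_power) auto
  qed (use \<Lambda>_pos[OF d0 assms(2,3)] m\<Lambda> in \<open>auto simp: less_imp_le\<close>)
  have i: "set_integrable lborel {0..} (\<lambda>t. \<Omega> ((real d - 2) / 2) (r * t) * pos_part (1 - t) powr \<alpha> * t ^ (d - 1))"
    "\<Lambda> d \<alpha> r = 1 / Beta (\<alpha> + 1) (real d) *
                (LINT t:{0..}|lborel. \<Omega> ((real d - 2) / 2) (r * t) * pos_part (1 - t) powr \<alpha> * t ^ (d - 1))" for r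
    using \<Lambda>_integral_representation[OF d0 \<alpha>(2), of r] B
    by (simp_all add: has_bochner_integral_iff set_integrable_def set_lebesgue_integral_def \<nu>)
  have iii: "set_integrable lborel {0..} (\<lambda>r. \<Omega> ((real d - 2) / 2) (r * t) * \<Lambda> d \<alpha> r * r ^ (d - 1))" (is ?A)
    "pos_part (1 - t) powr \<alpha> =
                2 * Gamma (\<alpha> + 1) * Gamma ((real d + 1) / 2) /
                (sqrt pi * Gamma (\<alpha> + real d + 1) * Gamma (real d / 2)) *
                (LINT r:{0..}|lborel. \<Omega> ((real d - 2) / 2) (r * t) * \<Lambda> d \<alpha> r * r ^ (d - 1))" (is ?B) if t: "t \<ge> 0" for t
  proof -
    \<comment> \<open>A vector of norm t carries the formula, proved for points of the space, over
      to the number t.\<close>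
    obtain x :: "real ^ 'n" where x: "norm x = t" using vector_choose_size[OF t] by blast
    note F = \<Lambda>_Fourier[OF d assms(2,3), of x, unfolded x]
    show ?A using F(1) by (simp add: set_integrable_def \<nu>)
    have "p = a * (b * p)" if "a * b = 1" for a b p :: real using that by (simp add: mult.assoc[symmetric])
    from this[OF inversion_constant[OF d0 \<alpha>(2)], of "pos_part (1 - t) powr \<alpha>"]
    show ?B unfolding set_lebesgue_integral_def \<nu> real_scaleR_def by (subst F(3))
  qed
  have "\<forall>r\<ge>0. 0 < \<Lambda> d \<alpha> r \<and> \<Lambda> d \<alpha> r \<le> 1"
    using \<Lambda>_pos[OF d0 assms(2,3)] \<Lambda>_le_1[OF d \<alpha>(2)] by blast
  moreover have "continuous_on {0..} (\<Lambda> d \<alpha>)"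
    by (intro continuous_at_imp_continuous_on ballI isCont_\<Lambda> d0 \<alpha>)
  moreover have "set_integrable lborel {0..} (\<lambda>r. \<Lambda> d \<alpha> r * r ^ (d - 1))"
    using \<Lambda>_integrable[OF d0 assms(2,3)] by (simp add: set_integrable_def)
  ultimately show ?thesis
    using PD1 PD2 i iii \<Lambda>_two_term_asymptotics[OF d0 \<alpha>(1)] \<Lambda>_comparable[OF d0 assms(2,3)]
    by (intro conjI allI impI) (assumption | blast)+
qed

end
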